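(* Let $p$ be a prime with $p\equiv \pm 1\pmod 8$. If $p\equiv 1,7\pmod{24}$ and $x,y$ are integers with $p=x^2+6y^2$ (such integers exist), then $$\sum_{k=0}^{p-1}\binom{2k}{k}\frac{f_k}{32^k}\equiv 4x^2\pmod p.$$ If $p\equiv 17,23\pmod{24}$, then $$\sum_{k=0}^{p-1}\binom{2k}{k}\frac{f_k}{32^k}\equiv 0\pmod p.$$
   Context: The Franel numbers are $f_n=\sum_{k=0}^n\binom{n}{k}^3$ for $n=0,1,2,\ldots$. Congruences modulo $p$ are taken in the ring of rational numbers whose denominator is not divisible by $p$. *)

theory Defs
  imports "HOL-Number_Theory.Number_Theory"
begin

definition franel :: "nat \<Rightarrow> nat" where
  "franel n = (\<Sum>k\<le>n. (n choose k) ^ 3)"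

text \<open>The ring of rational numbers whose (reduced) denominator is not divisible by \<open>p\<close>;
  \<open>quotient_of\<close> returns the fraction in lowest terms.\<close>

definition p_integral_rats :: "nat \<Rightarrow> rat set" where
  "p_integral_rats p = {r. \<not> int p dvd snd (quotient_of r)}"

text \<open>Congruence modulo \<open>p\<close> in that ring. The library's \<open>cong\<close> is not usable on \<open>rat\<close>:
  in a field every two elements are congruent modulo a nonzero element.\<close>

definition rat_cong :: "nat \<Rightarrow> rat \<Rightarrow> rat \<Rightarrow> bool" where
  "rat_cong p a b \<longleftrightarrow>
     a \<in> p_integral_rats p \<and> b \<in> p_integral_rats p \<and>
     (\<exists>c \<in> p_integral_rats p. a - b = of_nat p * c)"

end

theory Submission
  imports Defs "Berlekamp_Zassenhaus.Finite_Field" "HOL-Computational_Algebra.Computational_Algebra"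
    "HOL-Library.Discrete_Functions"
begin

text \<open>Why the theorem holds. Write \<open>f\<^sub>k\<close> for the Franel numbers and work in the field with
  \<open>p\<close> elements, where \<open>p\<close> is congruent to 1 or -1 modulo 8, so that there is an \<open>r\<close> with
  \<open>r\<^sup>2 = 2\<close>. Let \<open>F\<close> be the truncated generating polynomial of the Franel numbers of degree less
  than \<open>p\<close> (\<open>franel_poly\<close>). Two facts turn the sum into the trace of Frobenius of an elliptic curve.

  The first is a Clausen identity. The recurrence of the Franel numbers is a differential equation
  of order two for \<open>F\<close>. Put \<open>P = t (1 + t) (1 - 8 t)\<close> and \<open>c = 1 + 8 t\<^sup>2\<close>. Both \<open>F\<^sup>2\<close> and the
  polynomial \<open>\<Sum>k. binom(2 k, k) f\<^sub>k P ^ k c ^ (p - 1 - 2 k)\<close> solve the symmetric square of that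
  equation. A solution of degree at most \<open>2 p - 2\<close> is determined by its coefficients at \<open>0\<close> and
  \<open>2 p - 2\<close>, hence the two are equal (\<open>clausen_mod_p\<close>). At \<open>t = 1 / (8 + 6 r)\<close> the quotient
  \<open>P / c\<^sup>2\<close> is \<open>1 / 32\<close>, so the sum of the theorem is \<open>F(t)\<^sup>2\<close> (\<open>sum_eq_franel_poly_square\<close>).

  The second is a point count. Expanding a power with exponent \<open>p - 1\<close> shows that \<open>F(1 / \<mu>)\<close>
  determines modulo \<open>p\<close> the number of points of the cubic \<open>\<mu> a b = (a + b) (1 + a) (1 + b)\<close>. In
  the variable \<open>a + b\<close> the count becomes a quadratic character sum:
  \<open>F(1 / \<mu>) = - \<Sum>z. (z (z\<^sup>2 + (\<mu>\<^sup>2 - 4 \<mu> - 8) z + 16 (1 + \<mu>)))\<^sup>n\<close> with \<open>n = (p - 1) / 2\<close>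
  (\<open>franel_poly_point_count\<close>). For \<open>\<mu> = 8 + 6 r\<close> the cubic is a twist of
  \<open>x\<^sup>3 + 6 (2 + r) x\<^sup>2 + 3 x\<close>, whose elliptic curve has an endomorphism of square \<open>-6\<close>.

  If \<open>p = x\<^sup>2 + 6 y\<^sup>2\<close>, this endomorphism determines the character sum up to sign: it is \<open>2 x\<close> or
  \<open>- 2 x\<close> (\<open>cm_trace\<close>). The proof follows Manin's elementary proof of the Hasse bound. Points of the
  twist of the curve over the field of rational functions stand for homomorphisms. By the
  parallelogram law the degrees of \<open>Q + k P\<close> form a monic quadratic polynomial in \<open>k\<close>, where \<open>P\<close> is
  the generic point and \<open>Q\<close> is \<open>y\<close> times the endomorphism of square \<open>-6\<close>. The action on the
  invariant differential shows that \<open>Q + x P\<close> is inseparable. Its degree is therefore divisible by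
  \<open>p\<close>, which forces the degree \<open>x\<^sup>2 + 6 y\<^sup>2 = p\<close>, and \<open>Q + x P\<close> is the Frobenius point up to sign.
  The degree of \<open>Q + (x + 1) P\<close> is then \<open>p + 2 x + 1\<close> by the quadratic formula, while counting poles
  expresses it by the character sum.

  If \<open>p\<close> is congruent to 2 modulo 3, the differential equation has the symmetry
  \<open>t \<mapsto> (1 - 8 t) / (8 (1 + t))\<close>, under which \<open>F\<close> is multiplied by \<open>F(1 / 8)\<close> up to a factor that is
  a power with exponent \<open>p - 1\<close>. The point count at \<open>\<mu> = 8\<close> degenerates and gives \<open>F(1 / 8) = - 1\<close>
  because \<open>-3\<close> is not a square. Since \<open>1 / (8 + 6 r)\<close> is a fixed point of the symmetry, \<open>F\<close> vanishes
  there.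

  The existence of \<open>x\<close> and \<open>y\<close> follows from Thue's lemma and the fact that \<open>-6\<close> is a square.\<close>

section \<open>Polynomials and rational functions inside formal Laurent series\<close>

text \<open>The field of rational functions is realised inside the formal Laurent series, which
  already form a field with a derivation.\<close>

definition rf :: "'a::field poly \<Rightarrow> 'a fls" where
  "rf p = fps_to_fls (fps_of_poly p)"

lemma rf_0 [simp]: "rf 0 = 0" and rf_1 [simp]: "rf 1 = 1"
  and rf_add: "rf (p + q) = rf p + rf q" and rf_diff: "rf (p - q) = rf p - rf q"
  and rf_minus: "rf (- p) = - rf p"
  and rf_mult: "rf (p * q) = rf p * rf q" and rf_power: "rf (p ^ n) = rf p ^ n"
  and rf_const: "rf [:c:] = fls_const c"
  and rf_X: "rf [:0, 1:] = fls_X"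
  and rf_numeral: "rf (numeral k) = numeral k"
  by (simp_all add: rf_def fps_of_poly_add fps_of_poly_diff fps_of_poly_uminus fps_of_poly_mult
        fps_of_poly_power fls_times_fps_to_fls fps_to_fls_power fps_of_poly_const)

lemmas rf_hom = rf_add rf_diff rf_minus rf_mult rf_power rf_const rf_X rf_numeral

lemma rf_eq_iff [simp]: "rf p = rf q \<longleftrightarrow> p = q"
  by (simp add: rf_def fps_of_poly_eq_iff)

lemma rf_eq_0_iff [simp]: "rf p = 0 \<longleftrightarrow> p = 0"
  using rf_eq_iff[of p 0] by simp

lemma rf_smult: "rf (smult c p) = fls_const c * rf p"
proof -
  have "smult c p = [:c:] * p" by simp
  then show ?thesis by (simp only: rf_mult rf_const)
qed

lemma fls_deriv_rf: "fls_deriv (rf p) = rf (pderiv p)"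
  by (simp add: rf_def fls_deriv_fps_to_fls fps_of_poly_pderiv)

lemma fls_deriv_divide:
  fixes f g :: "'a::field fls"
  assumes "g \<noteq> 0"
  shows "fls_deriv (f / g) = (fls_deriv f * g - f * fls_deriv g) / g\<^sup>2"
proof -
  define h where "h = f / g"
  have f: "f = h * g" using assms by (simp add: h_def)
  have "fls_deriv f = fls_deriv h * g + h * fls_deriv g" by (simp add: f)
  then show ?thesis unfolding h_def[symmetric] using assms
    by (simp add: f divide_simps power2_eq_square algebra_simps)
qed

text \<open>A relation instead of a pair of functions, because the reduced denominator is unique only
  up to a unit.\<close>

definition lowest_terms :: "'a::field_gcd fls \<Rightarrow> 'a poly \<Rightarrow> 'a poly \<Rightarrow> bool" where
  "lowest_terms A N D \<longleftrightarrow> D \<noteq> 0 \<and> coprime N D \<and> A * rf D = rf N"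

definition ratfun :: "'a::field_gcd fls \<Rightarrow> bool" where
  "ratfun A \<longleftrightarrow> (\<exists>N D. D \<noteq> 0 \<and> A = rf N / rf D)"

lemma ratfun_rf [simp]: "ratfun (rf p)"
  unfolding ratfun_def by (rule exI[of _ p], rule exI[of _ 1]) simp

lemma ratfun_const [simp]: "ratfun (fls_const c)"
  using ratfun_rf[of "[:c:]"] by (simp only: rf_const)

lemma ratfun_X [simp]: "ratfun fls_X"
  using ratfun_rf[of "[:0,1:]"] by (simp only: rf_X)

lemma ratfun_1 [simp]: "ratfun 1" and ratfun_numeral [simp]: "ratfun (numeral k)"
  using ratfun_rf[of 1] ratfun_rf[of "numeral k"] by (simp_all only: rf_1 rf_numeral)

lemma ratfun_add [simp]: "ratfun A \<Longrightarrow> ratfun B \<Longrightarrow> ratfun (A + B)"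
  unfolding ratfun_def
proof (elim exE conjE)
  fix N D N' D' :: "'a poly"
  assume "D \<noteq> 0" "D' \<noteq> 0" "A = rf N / rf D" "B = rf N' / rf D'"
  then have "D * D' \<noteq> 0 \<and> A + B = rf (N * D' + N' * D) / rf (D * D')"
    by (simp add: rf_hom add_frac_eq)
  then show "\<exists>N D. D \<noteq> 0 \<and> A + B = rf N / rf D" by blast
qed

lemma ratfun_mult [simp]: "ratfun A \<Longrightarrow> ratfun B \<Longrightarrow> ratfun (A * B)"
  unfolding ratfun_def
proof (elim exE conjE)
  fix N D N' D' :: "'a poly"
  assume "D \<noteq> 0" "D' \<noteq> 0" "A = rf N / rf D" "B = rf N' / rf D'"
  then have "D * D' \<noteq> 0 \<and> A * B = rf (N * N') / rf (D * D')"
    by (simp add: rf_hom)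
  then show "\<exists>N D. D \<noteq> 0 \<and> A * B = rf N / rf D" by blast
qed

lemma ratfun_inverse [simp]: "ratfun A \<Longrightarrow> ratfun (inverse A)"
  unfolding ratfun_def
proof (elim exE conjE)
  fix N D :: "'a poly"
  assume *: "D \<noteq> 0" "A = rf N / rf D"
  show "\<exists>N D. D \<noteq> 0 \<and> inverse A = rf N / rf D"
  proof (cases "N = 0")
    case True
    with * show ?thesis by (intro exI[of _ 0] exI[of _ 1]) simp
  next
    case False
    with * show ?thesis by (intro exI[of _ D] exI[of _ N]) simp
  qed
qed

lemma ratfun_minus [simp]: "ratfun A \<Longrightarrow> ratfun (- A)"
  using ratfun_mult[OF ratfun_const[of "-1"], of A] by (simp add: fls_const_uminus[symmetric])

lemma ratfun_diff [simp]: "ratfun A \<Longrightarrow> ratfun B \<Longrightarrow> ratfun (A - B)"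
  using ratfun_add[of A "-B"] by simp

lemma ratfun_divide [simp]: "ratfun A \<Longrightarrow> ratfun B \<Longrightarrow> ratfun (A / B)"
  by (simp add: divide_inverse)

lemma ratfun_power [simp]: "ratfun A \<Longrightarrow> ratfun (A ^ n)"
  by (induction n) simp_all

lemma ratfun_lowest_terms:
  assumes "ratfun A"
  obtains N D where "lowest_terms A N D"
proof -
  from assms obtain N D where D: "D \<noteq> 0" and A: "A = rf N / rf D"
    unfolding ratfun_def by blast
  define g where "g = gcd N D"
  have g: "g \<noteq> 0" using D by (simp add: g_def)
  obtain N' D' where N': "N = g * N'" and D': "D = g * D'"
    unfolding g_def by (metis dvdE gcd_dvd1 gcd_dvd2)
  have "N' = N div gcd N D" "D' = D div gcd N D"
    using g by (simp_all add: g_def[symmetric]) (simp_all add: N' D')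
  then have "coprime N' D'" using D by (simp add: div_gcd_coprime)
  moreover have "D' \<noteq> 0" using D D' by auto
  moreover have "A * rf D' = rf N'"
    using A D g \<open>D' \<noteq> 0\<close> by (simp add: N' D' rf_mult)
  ultimately show thesis using that unfolding lowest_terms_def by blast
qed

text \<open>Reduced fractions are unique up to units, so the degree of a rational function is well
  defined.\<close>

lemma lowest_terms_unique:
  assumes "lowest_terms A N D" "lowest_terms A N' D'"
  shows "degree N = degree N'" "degree D = degree D'"
proof -
  have e: "N * D' = N' * D"
  proof -
    have "rf (N * D') = rf (N' * D)"
      using assms unfolding lowest_terms_def rf_mult by (metis mult.assoc mult.commute)
    then show ?thesis by simp
  qed
  have "D dvd D'" using assms e unfolding lowest_terms_def
    by (metis coprime_commute coprime_dvd_mult_right_iff dvd_triv_right)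
  moreover have "D' dvd D" using assms e unfolding lowest_terms_def
    by (metis coprime_commute coprime_dvd_mult_right_iff dvd_triv_right)
  ultimately show D: "degree D = degree D'"
    by (metis assms dvd_imp_degree_le le_antisym lowest_terms_def)
  have "N dvd N'" using assms e unfolding lowest_terms_def
    by (metis coprime_dvd_mult_left_iff dvd_triv_left)
  moreover have "N' dvd N" using assms e unfolding lowest_terms_def
    by (metis coprime_dvd_mult_left_iff dvd_triv_left)
  ultimately show "degree N = degree N'"
    by (metis dvd_imp_degree_le le_antisym dvd_0_left_iff)
qed

lemma coprime_polyI:
  fixes a b :: "'a::field_gcd poly"
  assumes "b \<noteq> 0" and "\<And>g. prime g \<Longrightarrow> g dvd a \<Longrightarrow> g dvd b \<Longrightarrow> False"
  shows "coprime a b"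
proof (rule ccontr)
  assume "\<not> coprime a b"
  then have "\<not> is_unit (gcd a b)" using is_unit_gcd by blast
  moreover have "gcd a b \<noteq> 0" using assms(1) by simp
  ultimately obtain g where "g dvd gcd a b" "prime g"
    using prime_divisor_exists by blast
  then show False using assms(2)[of g] by simp
qed

section \<open>Degrees of the sum and the difference of two points\<close>

lemma degree_add_less:
  assumes "degree p < n" "degree q < n" shows "degree (p + q) < n"
  using assms degree_add_le_max[of p q] by linarith

definition pX :: "'a::field poly" where "pX = [:0, 1:]"
lemma degree_pX [simp]: "degree (pX::'a::field poly) = 1" by (simp add: pX_def)
lemma pX_nz [simp]: "pX \<noteq> 0" by (simp add: pX_def)
lemma rf_pX [simp]: "rf pX = fls_X" by (simp add: pX_def rf_X)
lemma pderiv_pX [simp]: "pderiv pX = 1" by (simp add: pX_def pderiv_pCons)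
lemma poly_pX [simp]: "poly pX z = z" by (simp add: pX_def)
text \<open>For a point \<open>Q\<close> with first coordinate \<open>N / D\<close> and the generic point \<open>P\<close>, the first
  coordinates of \<open>Q - P\<close> and \<open>Q + P\<close> are \<open>N1 / D1\<close> and \<open>N2 / D2\<close>. Their product is
  \<open>W\<^sup>2 / V\<^sup>2\<close> and their sum is \<open>2 U / V\<^sup>2\<close>. The triple \<open>D1 D2\<close>, \<open>N1 D2 + N2 D1\<close>, \<open>N1 N2\<close> is
  primitive because both fractions are reduced, and the triple \<open>V\<^sup>2\<close>, \<open>2 U\<close>, \<open>W\<^sup>2\<close> is
  primitive because the cubic has no multiple root. Proportional primitive triples agree up
  to a unit. Comparing degrees gives the parallelogram law for degrees of homomorphisms.\<close>

lemma neighbours_poly: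
  fixes N D N1 D1 N2 D2 :: "'a::field_gcd poly" and a b :: 'a
  defines "V \<equiv> N - pX * D"
  defines "W \<equiv> N * pX - [:b:] * D"
  defines "U \<equiv> N * pX * (N + pX * D) + 2 * [:a:] * N * pX * D + [:b:] * D * (N + pX * D)"
  assumes two: "(2::'a) \<noteq> 0" and b: "b \<noteq> 0" and disc: "a\<^sup>2 \<noteq> 4 * b"
  assumes ND: "coprime N D" "D \<noteq> 0" "degree D < degree N"
  assumes c1: "coprime N1 D1" "D1 \<noteq> 0" and c2: "coprime N2 D2" "D2 \<noteq> 0"
  assumes V: "V \<noteq> 0"
  assumes pr: "N1 * N2 * V\<^sup>2 = D1 * D2 * W\<^sup>2"
  assumes sm: "(N1 * D2 + N2 * D1) * V\<^sup>2 = D1 * D2 * (2 * U)"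
  shows "degree D1 + degree D2 = 2 * degree V" (is ?A)
    and "degree N1 + degree N2 = 2 * degree N + 2" (is ?B)
    and "degree D1 < degree N1" (is ?C) and "degree D2 < degree N2" (is ?D)
    and "D2 dvd V\<^sup>2" (is ?E)
proof -
  have N0: "N \<noteq> 0" using ND by auto
  have Wdeg: "degree W = degree N + 1"
  proof -
    have "degree ([:b:] * D) < degree (N * pX)"
      using ND N0 by (simp add: degree_mult_eq)
    then have "degree W = degree (N * pX)"
      unfolding W_def by (metis degree_add_eq_left degree_minus diff_conv_add_uminus)
    then show ?thesis using N0 by (simp add: degree_mult_eq)
  qed
  then have W0: "W \<noteq> 0" by auto
  have N12: "N1 \<noteq> 0" "N2 \<noteq> 0" using pr V W0 c1 c2 by auto
  \<comment> \<open>a common prime factor of \<open>V\<close>, \<open>W\<close> and \<open>U\<close> would divide the cubic and \<open>X\<^sup>2 - b\<close>, which are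
    coprime because \<open>b (a\<^sup>2 - 4 b)\<close> is nonzero\<close>
  have cop: "coprime V (gcd (W\<^sup>2) (2 * U))"
  proof (rule coprime_polyI)
    show "gcd (W\<^sup>2) (2 * U) \<noteq> 0" using W0 by simp
  next
    fix g :: "'a poly" assume g: "prime g" "g dvd V" "g dvd gcd (W\<^sup>2) (2 * U)"
    then have gW: "g dvd W" and gU: "g dvd 2 * U"
      by (auto dest: prime_dvd_power)
    have unitc: "\<not> g dvd [:c:]" if "c \<noteq> 0" for c
      using g(1) that by (metis not_prime_unit dvd_trans is_unit_const_poly_iff dvd_field_iff)
    have gD: "\<not> g dvd D"
    proof
      assume "g dvd D"
      moreover have "N = V + pX * D" by (simp add: V_def)
      ultimately have "g dvd N" using g(2) by simp
      with \<open>g dvd D\<close> ND(1) g(1) show False by (meson coprime_common_divisor not_prime_unit)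
    qed
    have "W - pX * V = D * (pX\<^sup>2 - [:b:])" by (simp add: V_def W_def algebra_simps power2_eq_square)
    then have "g dvd D * (pX\<^sup>2 - [:b:])" using gW g(2) by (metis dvd_diff dvd_mult)
    then have g1: "g dvd pX\<^sup>2 - [:b:]" using gD g(1) prime_dvd_mult_iff by blast
    have "2 * U = 2 * [:2:] * D\<^sup>2 * (pX * (pX\<^sup>2 + [:a:] * pX + [:b:])) + V * (2 * (N * pX + pX\<^sup>2 * D + pX\<^sup>2 * D + 2 * [:a:] * pX * D + [:b:] * D))"
    proof -
      have N: "N = V + pX * D" by (simp add: V_def)
      have two': "[:2::'a:] = 2" by (simp add: numeral_poly)
      have "2 * ((V + x * D) * x * (V + x * D + x * D) + 2 * u * (V + x * D) * x * D + v * D * (V + x * D + x * D))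
          = 2 * 2 * D\<^sup>2 * (x * (x\<^sup>2 + u * x + v))
            + V * (2 * ((V + x * D) * x + x\<^sup>2 * D + x\<^sup>2 * D + 2 * u * x * D + v * D))" for x u v :: "'a poly"
        by (simp add: algebra_simps power2_eq_square)
      then show ?thesis unfolding U_def N two' .
    qed
    then have "g dvd 2 * [:2:] * D\<^sup>2 * (pX * (pX\<^sup>2 + [:a:] * pX + [:b:]))"
      using gU g(2) by (metis dvd_add_left_iff dvd_triv_left dvd_mult2)
    moreover have "2 * [:2:] * D\<^sup>2 * (pX * (pX\<^sup>2 + [:a:] * pX + [:b:]))
        = [:4:] * (D\<^sup>2 * (pX * (pX\<^sup>2 + [:a:] * pX + [:b:])))"
    proof -
      have "2 * [:2:] = [:4::'a:]" by (simp add: numeral_poly)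
      then show ?thesis by (simp only: mult.assoc[symmetric])
    qed
    moreover have "(4::'a) \<noteq> 0" using two by (metis mult_eq_0_iff mult_2 numeral_Bit0)
    ultimately have "g dvd pX * (pX\<^sup>2 + [:a:] * pX + [:b:])"
      using g(1) gD unitc[of 4] by (metis prime_dvd_mult_iff prime_dvd_power)
    then consider "g dvd pX" | "g dvd pX\<^sup>2 + [:a:] * pX + [:b:]"
      using g(1) prime_dvd_mult_iff by blast
    then show False
    proof cases
      case 1
      then have "g dvd pX\<^sup>2 - (pX\<^sup>2 - [:b:])" using g1 by (metis dvd_diff dvd_mult power2_eq_square)
      then show False using unitc[OF b] by simp
    next
      case 2
      \<comment> \<open>the resultant of the two quadratic polynomials as an explicit combination\<close>
      have "[:4 * b - a\<^sup>2:] * [:b:] = ([:4:] * [:b:] - [:a:]\<^sup>2) * [:b:]" by (simp add: power2_eq_square)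
      also have "\<dots> = ([:2:] * [:b:] - [:a:] * pX) * (pX\<^sup>2 + [:a:] * pX + [:b:]) + ([:a:]\<^sup>2 - [:2:] * [:b:] + [:a:] * pX) * (pX\<^sup>2 - [:b:]) + 0"
      proof -
        have two': "[:2::'a:] = 2" "[:4::'a:] = 4" by (simp_all add: numeral_poly)
        have "(4 * v - u\<^sup>2) * v = (2 * v - u * x) * (x\<^sup>2 + u * x + v) + (u\<^sup>2 - 2 * v + u * x) * (x\<^sup>2 - v) + 0" for x u v :: "'a poly"
          by (simp add: algebra_simps power2_eq_square)
        then show ?thesis unfolding two' .
      qed
      finally have "g dvd [:4 * b - a\<^sup>2:] * [:b:]" using 2 g1 by (metis dvd_add dvd_mult add.right_neutral)
      then show False using unitc[of "4 * b - a\<^sup>2"] unitc[OF b] disc g(1) prime_dvd_mult_iff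
        by (metis eq_iff_diff_eq_0)
    qed
  qed
  \<comment> \<open>Gauss's lemma: the product of the linear forms \<open>D1 T - N1\<close> and \<open>D2 T - N2\<close> is primitive\<close>
  have cop2: "coprime (D1 * D2) (gcd (N1 * N2) (N1 * D2 + N2 * D1))"
  proof (rule coprime_polyI)
    show "gcd (N1 * N2) (N1 * D2 + N2 * D1) \<noteq> 0" using N12 by simp
  next
    fix g :: "'a poly" assume g: "prime g" "g dvd D1 * D2" "g dvd gcd (N1 * N2) (N1 * D2 + N2 * D1)"
    have n1: "\<not> (g dvd N1 \<and> g dvd D1)" and n2: "\<not> (g dvd N2 \<and> g dvd D2)"
      using c1 c2 g(1) by (meson coprime_common_divisor not_prime_unit)+
    from g have *: "g dvd D1 \<or> g dvd D2" "g dvd N1 \<or> g dvd N2" "g dvd N1 * D2 + N2 * D1"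
      by (auto simp: prime_dvd_mult_iff)
    show False
    proof (cases "g dvd D1")
      case True
      then have "g dvd N1 * D2" using *(3) by (simp add: dvd_add_left_iff)
      then show False using True n1 n2 * g(1) by (auto simp: prime_dvd_mult_iff)
    next
      case False
      then have "g dvd D2" using * by blast
      then have "g dvd N2 * D1" using *(3) by (simp add: dvd_add_right_iff)
      then show False using False \<open>g dvd D2\<close> n1 n2 * g(1) by (auto simp: prime_dvd_mult_iff)
    qed
  qed
  have dvd_gcd_mult: "d dvd k * gcd x y" if "d dvd k * x" "d dvd k * y" for d k x y :: "'a poly"
    using that by (simp add: gcd_mult_distrib)
  have "D1 * D2 dvd N1 * N2 * V\<^sup>2" "D1 * D2 dvd (N1 * D2 + N2 * D1) * V\<^sup>2"
    unfolding pr sm by simp_all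
  then have "D1 * D2 dvd V\<^sup>2 * gcd (N1 * N2) (N1 * D2 + N2 * D1)"
    by (intro dvd_gcd_mult) (simp_all add: mult.commute)
  then have d1: "D1 * D2 dvd V\<^sup>2" using cop2 by (metis coprime_dvd_mult_left_iff)
  have "V\<^sup>2 dvd D1 * D2 * gcd (W\<^sup>2) (2 * U)"
    by (intro dvd_gcd_mult) (simp_all only: pr[symmetric] sm[symmetric] dvd_triv_right)
  then have d2: "V\<^sup>2 dvd D1 * D2" using cop by (simp add: coprime_dvd_mult_left_iff)
  have "degree (D1 * D2) = degree (V\<^sup>2)"
    using d1 d2 V c1 c2 by (simp add: dvd_imp_degree_le le_antisym)
  then show A: ?A using c1 c2 by (simp add: degree_mult_eq degree_power_eq V)
  have "degree (N1 * N2 * V\<^sup>2) = degree (D1 * D2 * W\<^sup>2)" using pr by simp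
  then have "degree N1 + degree N2 + 2 * degree V = degree D1 + degree D2 + 2 * degree W"
    using N12 c1 c2 V W0 by (simp add: degree_mult_eq degree_power_eq)
  with A Wdeg show B: ?B by simp
  show ?E using d1 dvd_mult_right by blast
  have pXD: "degree (pX * D) \<le> degree N" using ND by (simp add: degree_mult_eq)
  have Vdeg: "degree V \<le> degree N" unfolding V_def using pXD by (simp add: degree_diff_le)
  have NpXD: "degree (N + pX * D) \<le> degree N" using pXD by (simp add: degree_add_le)
  have Udeg: "degree (2 * U) < 2 * degree N + 2"
  proof -
    have "degree (N * pX * (N + pX * D)) < 2 * degree N + 2"
      using degree_mult_le[of "N * pX" "N + pX * D"] NpXD N0 by (simp add: degree_mult_eq)
    moreover have "degree (2 * [:a:] * N * pX * D) < 2 * degree N + 2"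
    proof -
      have "2 * [:a:] * N * pX * D = smult (2 * a) (N * pX * D)"
        by (simp add: numeral_poly smult_add_left algebra_simps)
      then have "degree (2 * [:a:] * N * pX * D) \<le> degree (N * pX * D)"
        by (metis degree_smult_le)
      then show ?thesis using N0 ND by (simp add: degree_mult_eq)
    qed
    moreover have "degree ([:b:] * D * (N + pX * D)) < 2 * degree N + 2"
      using degree_mult_le[of "[:b:] * D" "N + pX * D"] NpXD ND b by (simp add: degree_mult_eq)
    ultimately have "degree U < 2 * degree N + 2"
      unfolding U_def by (intro degree_add_less)
    moreover have "degree (2 * U) \<le> degree U"
      by (metis degree_add_le le_refl mult_2)
    ultimately show ?thesis by simp
  qed
  have sum: "(N1 * D2 + N2 * D1) * W\<^sup>2 = N1 * N2 * (2 * U)"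
  proof -
    have "(N1 * D2 + N2 * D1) * W\<^sup>2 * (D1 * D2) = (N1 * D2 + N2 * D1) * V\<^sup>2 * (N1 * N2)"
      using pr by (simp add: algebra_simps)
    also have "\<dots> = N1 * N2 * (2 * U) * (D1 * D2)" unfolding sm by simp
    finally show ?thesis using c1 c2 by simp
  qed
  have dsum: "degree (N1 * D2 + N2 * D1) < degree N1 + degree N2"
  proof (cases "N1 * D2 + N2 * D1 = 0")
    case True then show ?thesis using B by simp
  next
    case False
    have "degree (N1 * D2 + N2 * D1) + 2 * degree W \<le> degree N1 + degree N2 + degree (2 * U)"
      using arg_cong[OF sum, of degree] False W0 N12 degree_mult_le[of "N1 * N2" "2 * U"]
      by (simp add: degree_mult_eq degree_power_eq)
    then show ?thesis using Udeg Wdeg by simp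
  qed
  \<comment> \<open>if one of the two functions had no pole at infinity, the sum would have too large a degree\<close>
  have key: "degree D2 < degree N2"
    if n: "N1 \<noteq> 0" "N2 \<noteq> 0" "D1 \<noteq> 0" "D2 \<noteq> 0"
      and dd: "degree D1 + degree D2 < degree N1 + degree N2"
      and ds: "degree (N1 * D2 + N2 * D1) < degree N1 + degree N2"
    for N1 N2 D1 D2 :: "'a poly"
  proof (rule ccontr)
    assume c: "\<not> degree D2 < degree N2"
    then have "degree D1 < degree N1" using dd by simp
    then have "degree (N2 * D1) < degree (N1 * D2)"
      using c n by (simp add: degree_mult_eq)
    then have "degree (N1 * D2 + N2 * D1) = degree (N1 * D2)" by (rule degree_add_eq_left)
    then show False using ds c n by (simp add: degree_mult_eq)
  qed
  have dd: "degree D1 + degree D2 < degree N1 + degree N2" using A B Vdeg by simp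
  show ?D by (rule key[OF N12 c1(2) c2(2) dd dsum])
  show ?C by (rule key[OF N12(2,1) c2(2) c1(2)]) (use dd dsum in \<open>simp_all add: algebra_simps\<close>)
qed

section \<open>Points of a twisted cubic over the field of rational functions\<close>

definition cubic :: "'a::field \<Rightarrow> 'a \<Rightarrow> 'a fls \<Rightarrow> 'a fls" where
  "cubic a b A = A ^ 3 + fls_const a * A\<^sup>2 + fls_const b * A"

text \<open>The series \<open>A\<close> and \<open>B\<close> are the coordinates of a point of the twist
  \<open>F y\<^sup>2 = x\<^sup>3 + a x\<^sup>2 + b x\<close>. When \<open>F\<close> is a cubic in the variable \<open>X\<close>, such a point is a
  map \<open>(X, Y) \<mapsto> (A, B Y)\<close> from the curve \<open>Y\<^sup>2 = F\<close> to the curve with coefficients \<open>a\<close> and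
  \<open>b\<close>. The last condition says that the pullback of the invariant differential is \<open>w\<close> times
  the invariant differential. Thus \<open>w\<close> is additive in the point, and it vanishes exactly for
  inseparable maps.\<close>

definition ell_pt :: "'a::field_gcd fls \<Rightarrow> 'a \<Rightarrow> 'a \<Rightarrow> 'a \<Rightarrow> 'a fls \<Rightarrow> 'a fls \<Rightarrow> bool" where
  "ell_pt F a b w A B \<longleftrightarrow> ratfun A \<and> ratfun B \<and> F * B\<^sup>2 = cubic a b A \<and> fls_deriv A = fls_const w * B"

text \<open>A rational function of degree \<open>d\<close> with a pole at infinity. The pole says that the map
  given by a point sends the origin to the origin.\<close>

definition has_deg :: "'a::field_gcd fls \<Rightarrow> nat \<Rightarrow> bool" where
  "has_deg A d \<longleftrightarrow> (\<exists>N D. lowest_terms A N D \<and> degree N = d \<and> degree D < d)"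

text \<open>The chord formula for the sum of \<open>(A, B)\<close> and the generic point \<open>P = (X, 1)\<close>. The second
  coordinate is given by \<open>add_P_y\<close>.\<close>

definition add_P :: "'a::field \<Rightarrow> 'a fls \<Rightarrow> 'a fls \<Rightarrow> 'a fls \<Rightarrow> 'a fls" where
  "add_P a F A B = F * ((B - 1) / (A - fls_X))\<^sup>2 - fls_const a - A - fls_X"

definition add_P_y :: "'a::field \<Rightarrow> 'a fls \<Rightarrow> 'a fls \<Rightarrow> 'a fls \<Rightarrow> 'a fls" where
  "add_P_y a F A B = - (1 + (B - 1) / (A - fls_X) * (add_P a F A B - fls_X))"

lemma has_deg_unique: "has_deg A d \<Longrightarrow> has_deg A d' \<Longrightarrow> d = d'"
  unfolding has_deg_def using lowest_terms_unique(1) by blast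

lemma has_deg_nonzero: "has_deg A d \<Longrightarrow> A \<noteq> 0"
  unfolding has_deg_def lowest_terms_def by auto

lemma fls_deriv_cubic:
  "fls_deriv (cubic a b A) = (3 * A\<^sup>2 + 2 * fls_const a * A + fls_const b) * fls_deriv A"
  by (simp add: cubic_def power2_eq_square power3_eq_cube algebra_simps)

text \<open>The pole at infinity dominates: the leading term of the numerator of \<open>A ^ 3\<close> cannot be
  cancelled.\<close>

lemma cubic_nonzero:
  assumes "has_deg A d" shows "cubic a b A \<noteq> 0"
proof
  assume 0: "cubic a b A = 0"
  obtain N D where r: "lowest_terms A N D" and d: "degree N = d" "degree D < d"
    using assms unfolding has_deg_def by blast
  have N0: "N \<noteq> 0" and D0: "D \<noteq> 0" using d r by (auto simp: lowest_terms_def)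
  have AD: "A * rf D = rf N" using r by (simp add: lowest_terms_def)
  have "cubic a b A * (rf D) ^ 3 = rf (N * (N\<^sup>2 + ([:a:] * (N * D) + [:b:] * D\<^sup>2)))"
    unfolding rf_hom AD[symmetric] cubic_def by (simp add: algebra_simps power2_eq_square power3_eq_cube)
  then have "N * (N\<^sup>2 + ([:a:] * (N * D) + [:b:] * D\<^sup>2)) = 0" using 0 rf_eq_0_iff by (metis mult_zero_left)
  then have z: "N\<^sup>2 + ([:a:] * (N * D) + [:b:] * D\<^sup>2) = 0" using N0 by simp
  have "degree ([:a:] * (N * D)) < 2 * d"
    using degree_smult_le[of a "N * D"] d N0 D0 by (simp add: degree_mult_eq)
  moreover have "degree ([:b:] * D\<^sup>2) < 2 * d"
    using degree_smult_le[of b "D\<^sup>2"] d D0 by (simp add: degree_power_eq)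
  ultimately have "degree ([:a:] * (N * D) + [:b:] * D\<^sup>2) < degree (N\<^sup>2)"
    using d N0 by (simp add: degree_power_eq degree_add_less)
  then have "degree (N\<^sup>2 + ([:a:] * (N * D) + [:b:] * D\<^sup>2)) = degree (N\<^sup>2)" by (rule degree_add_eq_left)
  then show False using z d N0 by (simp add: degree_power_eq)
qed

context
  fixes a b :: "'a::field_gcd" and F :: "'a fls"
  assumes F: "F = cubic a b fls_X"
begin

text \<open>The chord formula yields a point again, and \<open>w\<close> grows by the value 1 that belongs to \<open>P\<close>.
  Both claims are polynomial identities modulo the equation \<open>star\<close>, which is the difference
  of the equations of the two given points divided by \<open>A - X\<close>.\<close>

lemma add_P_pt:
  assumes pt: "ell_pt F a b w A B" and A: "A \<noteq> fls_X" and B: "B \<noteq> 0"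
  shows "ell_pt F a b (w + 1) (add_P a F A B) (add_P_y a F A B)"
proof -
  let ?X = "fls_X :: 'a fls"
  define l where "l = (B - 1) / (A - ?X)"
  define aa where "aa = fls_const a"
  define bb where "bb = fls_const b"
  define ww where "ww = fls_const w"
  define A' where "A' = add_P a F A B"
  have rF: "ratfun F" unfolding F cubic_def by simp
  have Bl: "B = 1 + l * (A - ?X)" using A by (simp add: l_def)
  have A': "A' = F * l\<^sup>2 - aa - A - ?X" by (simp add: A'_def add_P_def l_def aa_def)
  have B': "add_P_y a F A B = - (1 + l * (A' - ?X))" by (simp add: add_P_y_def l_def A'_def)
  have ra: "ratfun A" "ratfun B" using pt by (auto simp: ell_pt_def)
  have rl: "ratfun l" unfolding l_def using ra by simp
  have rA': "ratfun A'" unfolding A' aa_def using rl ra rF by simp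
  have rB': "ratfun (add_P_y a F A B)" unfolding B' using rl rA' by simp
  have FX: "F = ?X ^ 3 + aa * ?X\<^sup>2 + bb * ?X" by (simp add: F cubic_def aa_def bb_def)
  have FB: "F * B\<^sup>2 = A ^ 3 + aa * A\<^sup>2 + bb * A" using pt by (simp add: ell_pt_def cubic_def aa_def bb_def)
  have AX: "A - ?X \<noteq> 0" using A by simp
  have star: "F * (2 * l + l\<^sup>2 * (A - ?X)) = A\<^sup>2 + A * ?X + ?X\<^sup>2 + aa * (A + ?X) + bb"
  proof -
    have "(A - ?X) * (F * (2 * l + l\<^sup>2 * (A - ?X))) = F * B\<^sup>2 - F"
      unfolding Bl by (simp add: algebra_simps power2_eq_square)
    also have "\<dots> = A ^ 3 + aa * A\<^sup>2 + bb * A - (?X ^ 3 + aa * ?X\<^sup>2 + bb * ?X)"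
      unfolding FB by (simp add: FX)
    also have "\<dots> = (A - ?X) * (A\<^sup>2 + A * ?X + ?X\<^sup>2 + aa * (A + ?X) + bb)"
      by (simp add: algebra_simps power2_eq_square power3_eq_cube)
    finally show ?thesis using AX by simp
  qed
  have curve: "F * (add_P_y a F A B)\<^sup>2 = cubic a b A'"
    unfolding B' cubic_def aa_def[symmetric] bb_def[symmetric]
  proof -
    have "F * (- (1 + l * (A' - x)))\<^sup>2 - (A' ^ 3 + aa * A'\<^sup>2 + bb * A')
        = (F - (x ^ 3 + aa * x\<^sup>2 + bb * x)) + (A' - x) *
            ((F * (2 * l + l\<^sup>2 * (A - x)) - (A\<^sup>2 + A * x + x\<^sup>2 + aa * (A + x) + bb))
             + (A' - A) * (F * l\<^sup>2 - aa - A - x - A'))" for x :: "'a fls"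
      by (simp add: algebra_simps power2_eq_square power3_eq_cube)
    from this[of ?X] show "F * (- (1 + l * (A' - ?X)))\<^sup>2 = A' ^ 3 + aa * A'\<^sup>2 + bb * A'"
      using star FX A' by simp
  qed
  have dA: "fls_deriv A = ww * B" using pt by (simp add: ell_pt_def ww_def)
  have dF: "fls_deriv F = 3 * ?X\<^sup>2 + 2 * aa * ?X + bb" 
    unfolding F fls_deriv_cubic by (simp add: aa_def bb_def)
  have dB: "2 * F * fls_deriv B = (3 * A\<^sup>2 + 2 * aa * A + bb) * ww - fls_deriv F * B"
  proof -
    have "fls_deriv (F * B\<^sup>2) = fls_deriv (cubic a b A)" using pt by (simp add: ell_pt_def)
    then have "B * (fls_deriv F * B + 2 * F * fls_deriv B) = B * ((3 * A\<^sup>2 + 2 * aa * A + bb) * ww)"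
      unfolding fls_deriv_cubic dA by (simp add: power2_eq_square algebra_simps aa_def bb_def)
    then have "fls_deriv F * B + 2 * F * fls_deriv B = (3 * A\<^sup>2 + 2 * aa * A + bb) * ww"
      using B by simp
    then show ?thesis by (simp add: algebra_simps)
  qed
  have dl: "fls_deriv l * (A - ?X) = fls_deriv B - l * (ww * B - 1)"
  proof -
    have "fls_deriv B = fls_deriv l * (A - ?X) + l * (ww * B - 1)"
      by (subst Bl) (simp add: dA algebra_simps)
    then show ?thesis by simp
  qed
  have dA': "fls_deriv A' = fls_deriv F * l\<^sup>2 + 2 * F * l * fls_deriv l - ww * B - 1"
    unfolding A' by (simp add: dA power2_eq_square algebra_simps aa_def)
  have "(A - ?X) * fls_deriv A' = (A - ?X) * ((ww + 1) * add_P_y a F A B)"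
  proof -
    have "(A - ?X) * fls_deriv A' = fls_deriv F * l\<^sup>2 * (A - ?X) + l * (2 * F * fls_deriv B) 
        - 2 * F * l\<^sup>2 * (ww * B - 1) - (A - ?X) * (ww * B + 1)"
      unfolding dA' mult.assoc[of _ _ "- 1 + _"] using arg_cong[OF dl, of "\<lambda>u. 2 * F * l * u"]
      by (simp add: algebra_simps power2_eq_square)
    also have "\<dots> = (A - ?X) * ((ww + 1) * add_P_y a F A B)"
    proof -
      have "f' * l\<^sup>2 * (A - x) + l * ((3 * A\<^sup>2 + 2 * aa * A + bb) * ww - f' * (1 + l * (A - x)))
        - 2 * F * l\<^sup>2 * (ww * (1 + l * (A - x)) - 1) - (A - x) * (ww * (1 + l * (A - x)) + 1)
        - (A - x) * ((ww + 1) * (- (1 + l * ((F * l\<^sup>2 - aa - A - x) - x))))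
        = l * (1 - ww) * (F * (2 * l + l\<^sup>2 * (A - x)) - (A\<^sup>2 + A * x + x\<^sup>2 + aa * (A + x) + bb))"
        if "f' = 3 * x\<^sup>2 + 2 * aa * x + bb" for x f' :: "'a fls"
        unfolding that by (simp add: algebra_simps power2_eq_square power3_eq_cube)
      from this[OF dF] show ?thesis
        unfolding dB B' A' Bl[symmetric] using star by simp
    qed
    finally show ?thesis .
  qed
  then have "fls_deriv A' = fls_const (w + 1) * add_P_y a F A B"
    using AX by (simp add: ww_def fls_plus_const[symmetric])
  then show ?thesis unfolding ell_pt_def A'_def[symmetric] using rA' rB' curve by simp
qed

text \<open>The first coordinate of \<open>P - (Q + P) = - Q\<close> is that of \<open>Q\<close>; both chords have the same
  slope.\<close>

lemma add_P_back:
  assumes A: "A \<noteq> fls_X" and A': "add_P a F A B \<noteq> fls_X"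
  shows "add_P a F (add_P a F A B) (- add_P_y a F A B) = A"
proof -
  have "(- add_P_y a F A B - 1) / (add_P a F A B - fls_X) = (B - 1) / (A - fls_X)"
    using A' by (simp add: add_P_y_def)
  then show ?thesis
    by (subst add_P_def, simp only:) (simp add: add_P_def)
qed

text \<open>The first coordinates of \<open>Q + P\<close> and \<open>Q - P\<close> are the roots of a quadratic polynomial that
  depends on the first coordinate of \<open>Q\<close> alone.\<close>

lemma add_P_sum_prod:
  assumes pt: "ell_pt F a b w A B" and A: "A \<noteq> fls_X"
  shows "(add_P a F A B + add_P a F A (- B)) * (A - fls_X)\<^sup>2
      = 2 * (A * fls_X * (A + fls_X) + 2 * fls_const a * A * fls_X + fls_const b * (A + fls_X))"
    and "add_P a F A B * add_P a F A (- B) * (A - fls_X)\<^sup>2 = (A * fls_X - fls_const b)\<^sup>2"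
proof -
  let ?X = "fls_X :: 'a fls"
  define aa where "aa = fls_const a"
  define bb where "bb = fls_const b"
  define c where "c = inverse (A - ?X)"
  have c: "c * (A - ?X) = 1" using A by (simp add: c_def)
  have FX: "F = ?X ^ 3 + aa * ?X\<^sup>2 + bb * ?X" by (simp add: F cubic_def aa_def bb_def)
  have FB: "F * B\<^sup>2 = A ^ 3 + aa * A\<^sup>2 + bb * A" using pt by (simp add: ell_pt_def cubic_def aa_def bb_def)
  have s1: "add_P a F A B = F * ((B - 1) * c)\<^sup>2 - aa - A - ?X"
   and s2: "add_P a F A (- B) = F * ((- B - 1) * c)\<^sup>2 - aa - A - ?X"
    by (simp_all add: add_P_def divide_inverse aa_def c_def)
  have 1: "add_P a F A B * (A - ?X)\<^sup>2 = F * (B - 1)\<^sup>2 - (aa + A + ?X) * (A - ?X)\<^sup>2"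
  proof -
    have "(F * ((B - 1) * c)\<^sup>2 - aa - A - ?X) * (A - ?X)\<^sup>2
        = F * (B - 1)\<^sup>2 * (c * (A - ?X))\<^sup>2 - (aa + A + ?X) * (A - ?X)\<^sup>2"
      by (simp add: algebra_simps power2_eq_square)
    then show ?thesis by (simp add: s1 c)
  qed
  have 2: "add_P a F A (- B) * (A - ?X)\<^sup>2 = F * (B + 1)\<^sup>2 - (aa + A + ?X) * (A - ?X)\<^sup>2"
  proof -
    have "(F * ((- B - 1) * c)\<^sup>2 - aa - A - ?X) * (A - ?X)\<^sup>2
        = F * (B + 1)\<^sup>2 * (c * (A - ?X))\<^sup>2 - (aa + A + ?X) * (A - ?X)\<^sup>2"
      by (simp add: algebra_simps power2_eq_square)
    then show ?thesis by (simp add: s2 c)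
  qed
  have "(add_P a F A B + add_P a F A (- B)) * (A - ?X)\<^sup>2
      = 2 * (F * B\<^sup>2 + F) - 2 * (aa + A + ?X) * (A - ?X)\<^sup>2"
    unfolding distrib_right 1 2 by (simp add: algebra_simps power2_eq_square)
  also have "\<dots> = 2 * (A * ?X * (A + ?X) + 2 * aa * A * ?X + bb * (A + ?X))"
    unfolding FB unfolding FX by (simp add: algebra_simps power2_eq_square power3_eq_cube)
  finally show "(add_P a F A B + add_P a F A (- B)) * (A - fls_X)\<^sup>2
      = 2 * (A * fls_X * (A + fls_X) + 2 * fls_const a * A * fls_X + fls_const b * (A + fls_X))"
    by (simp add: aa_def bb_def)
  have "(A - ?X)\<^sup>2 * (add_P a F A B * add_P a F A (- B) * (A - ?X)\<^sup>2) = 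
      (F * (B - 1)\<^sup>2 - (aa + A + ?X) * (A - ?X)\<^sup>2) * (F * (B + 1)\<^sup>2 - (aa + A + ?X) * (A - ?X)\<^sup>2)"
    unfolding 1[symmetric] 2[symmetric] by (simp add: algebra_simps)
  also have "\<dots> = (F * B\<^sup>2 - F)\<^sup>2 - (aa + A + ?X) * (A - ?X)\<^sup>2 * (2 * (F * B\<^sup>2 + F)) + (aa + A + ?X)\<^sup>2 * (A - ?X) ^ 4"
  proof -
    have "(F * (B - 1)\<^sup>2 - s * g\<^sup>2) * (F * (B + 1)\<^sup>2 - s * g\<^sup>2)
        = (F * B\<^sup>2 - F)\<^sup>2 - s * g\<^sup>2 * (2 * (F * B\<^sup>2 + F)) + s\<^sup>2 * g ^ 4" for s g
      by (simp add: algebra_simps power2_eq_square power4_eq_xxxx)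
    then show ?thesis .
  qed
  also have "\<dots> = (A - ?X)\<^sup>2 * (A * ?X - bb)\<^sup>2"
    unfolding FB unfolding FX
    by (simp add: algebra_simps power2_eq_square power3_eq_cube power4_eq_xxxx)
  finally show "add_P a F A B * add_P a F A (- B) * (A - fls_X)\<^sup>2 = (A * fls_X - fls_const b)\<^sup>2"
    using A by (simp add: bb_def)
qed

end

section \<open>Multiples of the generic point\<close>

text \<open>The points \<open>P\<close> and \<open>- P\<close> act on the invariant differential by \<open>1\<close> and \<open>- 1\<close>.\<close>

lemma pt_not_P:
  assumes F: "F = cubic a b fls_X" "F \<noteq> 0" and pt: "ell_pt F a b w A B" and w: "w \<noteq> 1" "w \<noteq> -1"
  shows "A \<noteq> fls_X"
proof
  assume A: "A = fls_X"
  then have "F * B\<^sup>2 = F" and d: "1 = fls_const w * B" using pt F by (auto simp: ell_pt_def)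
  then have "B\<^sup>2 = 1" using F(2) by simp
  then have "B = 1 \<or> B = - 1" by (simp add: power2_eq_1_iff)
  then have "fls_const w = fls_const 1 \<or> fls_const w = fls_const (-1)"
  proof
    assume "B = 1" with d show ?thesis by simp
  next
    assume B: "B = -1"
    with d have "fls_const w = -1" by (metis equation_minus_iff mult.right_neutral mult_minus_right)
    then show ?thesis by (simp add: fls_const_uminus)
  qed
  then show False using w by (metis fls_const_nth)
qed

lemma degree_monic_combination:
  fixes N D :: "'a::field poly"
  assumes "degree D < degree N" shows "degree (N - [:c:] * D) = degree N"
proof -
  have "degree (- ([:c:] * D)) < degree N"
    using degree_smult_le[of c D] assms by (simp add: le_less_trans)
  then show ?thesis by (metis degree_add_eq_left diff_conv_add_uminus)
qed

lemma has_deg_X: "has_deg (fls_X::'a::field_gcd fls) 1"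
  unfolding has_deg_def lowest_terms_def by (rule exI[of _ pX], rule exI[of _ 1]) simp

text \<open>The coordinates of \<open>Q + k P\<close> for \<open>Q = (A, B)\<close>.\<close>

fun orbit :: "'a::field \<Rightarrow> 'a fls \<Rightarrow> 'a fls \<Rightarrow> 'a fls \<Rightarrow> nat \<Rightarrow> 'a fls \<times> 'a fls" where
  "orbit a F A B 0 = (A, B)"
| "orbit a F A B (Suc k) = (let (A', B') = orbit a F A B k in (add_P a F A' B', add_P_y a F A' B'))"

context
  fixes a b :: "'a::field_gcd" and F :: "'a fls"
  assumes F: "F = cubic a b fls_X"
  assumes two: "(2::'a) \<noteq> 0" and b: "b \<noteq> 0" and disc: "a\<^sup>2 \<noteq> 4 * b"
begin

lemma F_nonzero: "F \<noteq> 0" unfolding F by (rule cubic_nonzero[OF has_deg_X])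

lemma B_nonzero: "ell_pt F a b w A B \<Longrightarrow> has_deg A d \<Longrightarrow> B \<noteq> 0"
  using cubic_nonzero[of A d a b] by (auto simp: ell_pt_def)

text \<open>Translation of \<open>neighbours_poly\<close> to points; the divisibility of \<open>D2\<close> locates the poles of
  \<open>Q + P\<close>.\<close>

lemma add_P_neighbours:
  assumes pt: "ell_pt F a b w A B" and d: "has_deg A d" and A: "A \<noteq> fls_X"
  obtains N D N1 D1 N2 D2 where "lowest_terms A N D" "lowest_terms (add_P a F A (-B)) N1 D1" "lowest_terms (add_P a F A B) N2 D2"
    "degree N = d" "degree D1 + degree D2 = 2 * degree (N - pX * D)" "degree N1 + degree N2 = 2 * d + 2"
    "degree D1 < degree N1" "degree D2 < degree N2" "D2 dvd (N - pX * D)\<^sup>2"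
proof -
  obtain N D where r: "lowest_terms A N D" and ND: "degree N = d" "degree D < d"
    using d unfolding has_deg_def by blast
  have rat: "ratfun A" "ratfun B" "ratfun F" using pt by (auto simp: ell_pt_def F cubic_def)
  obtain N1 D1 where r1: "lowest_terms (add_P a F A (-B)) N1 D1"
    by (rule ratfun_lowest_terms[of "add_P a F A (-B)"]) (use rat in \<open>simp_all add: add_P_def\<close>)
  obtain N2 D2 where r2: "lowest_terms (add_P a F A B) N2 D2"
    by (rule ratfun_lowest_terms[of "add_P a F A B"]) (use rat in \<open>simp_all add: add_P_def\<close>)
  let ?A1 = "add_P a F A (-B)" and ?A2 = "add_P a F A B"
  have e: "rf N = A * rf D" "rf N1 = ?A1 * rf D1" "rf N2 = ?A2 * rf D2"
    and nz: "D \<noteq> 0" "D1 \<noteq> 0" "D2 \<noteq> 0" and cp: "coprime N D" "coprime N1 D1" "coprime N2 D2"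
    using r r1 r2 by (auto simp: lowest_terms_def)
  note sp = add_P_sum_prod[OF F pt A]
  have V: "N - pX * D \<noteq> 0"
  proof
    assume "N - pX * D = 0"
    then have "rf (N - pX * D) = 0" by simp
    then show False using A nz by (simp add: rf_hom e algebra_simps)
  qed
  have "rf (N1 * N2 * (N - pX * D)\<^sup>2) = rf (D1 * D2 * (N * pX - [:b:] * D)\<^sup>2)"
  proof -
    have "rf (N1 * N2 * (N - pX * D)\<^sup>2) = (?A2 * ?A1 * (A - fls_X)\<^sup>2) * (rf D1 * rf D2 * (rf D)\<^sup>2)"
      unfolding rf_hom rf_pX e by (simp add: algebra_simps power2_eq_square)
    also have "\<dots> = rf (D1 * D2 * (N * pX - [:b:] * D)\<^sup>2)"
      unfolding sp rf_hom rf_pX e by (simp add: algebra_simps power2_eq_square)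
    finally show ?thesis .
  qed
  then have pr: "N1 * N2 * (N - pX * D)\<^sup>2 = D1 * D2 * (N * pX - [:b:] * D)\<^sup>2" by (simp only: rf_eq_iff)
  have "rf ((N1 * D2 + N2 * D1) * (N - pX * D)\<^sup>2) = rf (D1 * D2 * (2 * (N * pX * (N + pX * D) + 2 * [:a:] * N * pX * D + [:b:] * D * (N + pX * D))))"
  proof -
    have "rf ((N1 * D2 + N2 * D1) * (N - pX * D)\<^sup>2) = ((?A2 + ?A1) * (A - fls_X)\<^sup>2) * (rf D1 * rf D2 * (rf D)\<^sup>2)"
      unfolding rf_hom rf_pX e by (simp add: algebra_simps power2_eq_square)
    also have "\<dots> = rf (D1 * D2 * (2 * (N * pX * (N + pX * D) + 2 * [:a:] * N * pX * D + [:b:] * D * (N + pX * D))))"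
      unfolding sp rf_hom rf_pX e by (simp add: algebra_simps power2_eq_square)
    finally show ?thesis .
  qed
  then have sm: "(N1 * D2 + N2 * D1) * (N - pX * D)\<^sup>2 = D1 * D2 * (2 * (N * pX * (N + pX * D) + 2 * [:a:] * N * pX * D + [:b:] * D * (N + pX * D)))" by (simp only: rf_eq_iff)
  have "degree D < degree N" using ND by simp
  note nb = neighbours_poly[OF two b disc cp(1) nz(1) this cp(2) nz(2) cp(3) nz(3) V pr sm]
  show thesis using that[OF r r1 r2 ND(1) nb(1) _ nb(3,4,5)] nb(2) ND by simp
qed

lemma add_P_degrees:
  assumes pt: "ell_pt F a b w A B" and d: "has_deg A d" and A: "A \<noteq> fls_X"
  obtains d1 d2 where "has_deg (add_P a F A (-B)) d1" "has_deg (add_P a F A B) d2" "d1 + d2 = 2 * d + 2"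
  using add_P_neighbours[OF assms] unfolding has_deg_def by metis

text \<open>By the parallelogram law the second difference of the degrees of \<open>Q + k P\<close> is 2, so the
  degrees are a monic quadratic polynomial in \<open>k\<close>. Its linear coefficient is determined by
  the degrees \<open>d\<close> of \<open>Q\<close> and \<open>d'\<close> of \<open>Q - P\<close>. The recursion may continue as long as no
  \<open>Q + k P\<close> equals \<open>P\<close> or \<open>- P\<close>, where the chord formula breaks down.\<close>

lemma orbit_quadratic:
  assumes pt: "ell_pt F a b w A B" and d: "has_deg A d" "has_deg (add_P a F A (-B)) d'"
    and m: "\<And>k. k < m \<Longrightarrow> fst (orbit a F A B k) \<noteq> fls_X"
  shows "k \<le> m \<Longrightarrow> (\<exists>dk dk'. ell_pt F a b (w + of_nat k) (fst (orbit a F A B k)) (snd (orbit a F A B k)) \<and>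
     has_deg (fst (orbit a F A B k)) dk \<and> int dk = int k ^ 2 + (int d + 1 - int d') * int k + int d \<and>
     (fst (orbit a F A B k) \<noteq> fls_X \<longrightarrow> has_deg (add_P a F (fst (orbit a F A B k)) (- snd (orbit a F A B k))) dk') \<and>
     int dk' = (int k - 1) ^ 2 + (int d + 1 - int d') * (int k - 1) + int d)"
proof (induction k)
  case 0
  then show ?case using assms by (intro exI[of _ d] exI[of _ d']) simp
next
  case (Suc k)
  obtain A1 B1 where AB: "orbit a F A B k = (A1, B1)" by fastforce
  have A1: "A1 \<noteq> fls_X" using m[of k] Suc.prems AB by simp
  from Suc.IH Suc.prems obtain dk dk' where
    IH: "ell_pt F a b (w + of_nat k) A1 B1" "has_deg A1 dk" "int dk = int k ^ 2 + (int d + 1 - int d') * int k + int d"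
     "has_deg (add_P a F A1 (- B1)) dk'"
     "int dk' = (int k - 1) ^ 2 + (int d + 1 - int d') * (int k - 1) + int d"
    unfolding AB using A1 by auto
  have S: "orbit a F A B (Suc k) = (add_P a F A1 B1, add_P_y a F A1 B1)" by (simp add: AB)
  obtain e1 e2 where e: "has_deg (add_P a F A1 (-B1)) e1" "has_deg (add_P a F A1 B1) e2" "e1 + e2 = 2 * dk + 2"
    using add_P_degrees[OF IH(1,2) A1] by blast
  have "e1 = dk'" using e(1) IH(4) has_deg_unique by blast
  then have e2: "int e2 = 2 * int dk + 2 - int dk'" using e(3) by simp
  show ?case unfolding S fst_conv snd_conv
  proof (intro exI conjI impI)
    show "ell_pt F a b (w + of_nat (Suc k)) (add_P a F A1 B1) (add_P_y a F A1 B1)"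
      using add_P_pt[OF F IH(1) A1 B_nonzero[OF IH(1,2)]] by (simp add: algebra_simps)
    show "has_deg (add_P a F A1 B1) e2" by (rule e)
    show "int e2 = (int (Suc k))\<^sup>2 + (int d + 1 - int d') * int (Suc k) + int d"
      unfolding e2 IH(3,5) by (simp add: algebra_simps power2_eq_square)
    show "int dk = (int (Suc k) - 1)\<^sup>2 + (int d + 1 - int d') * (int (Suc k) - 1) + int d"
      using IH(3) by simp
  next
    assume "add_P a F A1 B1 \<noteq> fls_X"
    then show "has_deg (add_P a F (add_P a F A1 B1) (- add_P_y a F A1 B1)) dk"
      using add_P_back[OF F A1] IH(2) by simp
  qed
qed

text \<open>The tangent formula. The chord formula does not apply to \<open>P + P\<close>, so the iteration \<open>k P\<close>
  starts at \<open>k = 2\<close>, with the degree 4 of \<open>2 P\<close> and the degree 1 of \<open>2 P - P\<close>.\<close>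

lemma double_pt:
  obtains A B where "ell_pt F a b 2 A B" "has_deg A 4" "A \<noteq> fls_X \<longrightarrow> add_P a F A (- B) = fls_X"
proof -
  let ?X = "fls_X :: 'a fls"
  define aa where "aa = fls_const a"
  define bb where "bb = fls_const b"
  define l where "l = (3 * ?X\<^sup>2 + 2 * aa * ?X + bb) / (2 * F)"
  define A where "A = F * l\<^sup>2 - aa - 2 * ?X"
  define B where "B = - (1 + l * (A - ?X))"
  have FX: "F = ?X ^ 3 + aa * ?X\<^sup>2 + bb * ?X" by (simp add: F cubic_def aa_def bb_def)
  have two': "(2 :: 'a fls) \<noteq> 0" using two by (metis fls_const_numeral fls_const_eq_0_iff)
  have l: "2 * F * l = 3 * ?X\<^sup>2 + 2 * aa * ?X + bb" using F_nonzero two' by (simp add: l_def)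
  have dF: "fls_deriv F = 2 * F * l"
    unfolding l unfolding F fls_deriv_cubic by (simp add: aa_def bb_def)
  have rat: "ratfun A" "ratfun B" unfolding B_def A_def l_def aa_def bb_def F cubic_def by simp_all
  have curve: "F * B\<^sup>2 = A ^ 3 + aa * A\<^sup>2 + bb * A"
  proof -
    have "F * (- (1 + l * (A - x)))\<^sup>2 - (A ^ 3 + aa * A\<^sup>2 + bb * A)
        = (F - (x ^ 3 + aa * x\<^sup>2 + bb * x)) + (A - x) *
            ((2 * F * l - (3 * x\<^sup>2 + 2 * aa * x + bb)) + (A - x) * (F * l\<^sup>2 - aa - 2 * x - A))" for x :: "'a fls"
      by (simp add: algebra_simps power2_eq_square power3_eq_cube)
    from this[of ?X] show ?thesis using FX l by (simp add: B_def A_def)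
  qed
  have "2 * fls_deriv F * l + 2 * F * fls_deriv l = 6 * ?X + 2 * aa"
    using arg_cong[OF l, of fls_deriv] by (simp add: power2_eq_square algebra_simps aa_def bb_def)
  then have "2 * (F * fls_deriv l) = 2 * (3 * ?X + aa - 2 * F * l * l)" unfolding dF by (simp add: algebra_simps)
  then have dl: "F * fls_deriv l = 3 * ?X + aa - 2 * F * l * l" using two' by (metis mult_left_cancel)
  have "fls_deriv A = 2 * F * l * l\<^sup>2 + 2 * l * (F * fls_deriv l) - 2"
    unfolding A_def by (simp add: dF power2_eq_square algebra_simps aa_def)
  also have "\<dots> = 2 * B" unfolding dl B_def A_def by (simp add: power2_eq_square algebra_simps)
  finally have dA: "fls_deriv A = fls_const 2 * B" by simp
  have pt: "ell_pt F a b 2 A B"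
    using rat curve dA unfolding ell_pt_def cubic_def aa_def bb_def by blast
  define f where "f = pX ^ 3 + [:a:] * pX\<^sup>2 + [:b:] * pX"
  have f: "rf f = F" by (simp only: f_def rf_hom rf_pX FX aa_def bb_def)
  have fact: "f = pX * (pX\<^sup>2 + [:a:] * pX + [:b:])" by (simp add: f_def algebra_simps power2_eq_square power3_eq_cube)
  have four: "(4::'a) \<noteq> 0" using two by (metis mult_eq_0_iff mult_2 numeral_Bit0)
  have f0: "f \<noteq> 0" using F_nonzero f by auto
  have "4 * F * A = (2 * F * l)\<^sup>2 - 4 * F * (aa + 2 * ?X)" unfolding A_def by (simp add: algebra_simps power2_eq_square)
  also have "\<dots> = (?X\<^sup>2 - bb)\<^sup>2" unfolding l unfolding FX by (simp add: algebra_simps power2_eq_square power3_eq_cube)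
  finally have A4: "4 * F * A = (?X\<^sup>2 - bb)\<^sup>2" .
  have "lowest_terms A ((pX\<^sup>2 - [:b:])\<^sup>2) ([:4:] * f)"
    unfolding lowest_terms_def
  proof (intro conjI)
    show "[:4:] * f \<noteq> 0" using four f0 by simp
    have "rf [:4::'a:] = 4" by (simp add: rf_const)
    then show "A * rf ([:4:] * f) = rf ((pX\<^sup>2 - [:b:])\<^sup>2)"
      using A4 by (simp add: rf_hom rf_smult f bb_def algebra_simps)
    show "coprime ((pX\<^sup>2 - [:b:])\<^sup>2) ([:4:] * f)"
    proof (rule coprime_polyI[OF \<open>[:4:] * f \<noteq> 0\<close>])
      fix g :: "'a poly" assume g: "prime g" "g dvd (pX\<^sup>2 - [:b:])\<^sup>2" "g dvd [:4:] * f"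
      have unitc: "\<not> g dvd [:c:]" if "c \<noteq> 0" for c
        using g(1) that by (metis not_prime_unit dvd_trans is_unit_const_poly_iff dvd_field_iff)
      have g1: "g dvd pX\<^sup>2 - [:b:]" using g by (metis prime_dvd_power)
      from g four unitc have "g dvd f" by (metis prime_dvd_mult_iff)
      then consider "g dvd pX" | "g dvd pX\<^sup>2 + [:a:] * pX + [:b:]"
        unfolding fact using g(1) prime_dvd_mult_iff by blast
      then show False
      proof cases
        case 1
        then have "g dvd pX\<^sup>2 - (pX\<^sup>2 - [:b:])" using g1 by (metis dvd_diff dvd_mult power2_eq_square)
        then show False using unitc[OF b] by simp
      next
        case 2
        have gen: "(4 * v - u\<^sup>2) * v = (2 * v - u * x) * (x\<^sup>2 + u * x + v) + (u\<^sup>2 - 2 * v + u * x) * (x\<^sup>2 - v)" for x u v :: "'a poly"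
          by (simp add: algebra_simps power2_eq_square)
        have "g dvd (4 * [:b:] - [:a:]\<^sup>2) * [:b:]"
          unfolding gen[of "[:b:]" "[:a:]" pX] using 2 g1 by (metis dvd_add dvd_mult)
        moreover have "4 * [:b:] - [:a:]\<^sup>2 = [:4 * b - a\<^sup>2:]" by (simp add: power2_eq_square numeral_poly)
        ultimately show False using unitc[of "4 * b - a\<^sup>2"] unitc[OF b] disc g(1) prime_dvd_mult_iff
          by (metis eq_iff_diff_eq_0)
      qed
    qed
  qed
  moreover have "degree ((pX\<^sup>2 - [:b:])\<^sup>2) = 4"
  proof -
    have "degree (pX\<^sup>2 - [:b:]) = 2" using degree_monic_combination[of 1 "pX\<^sup>2" b] by (simp add: degree_power_eq one_pCons)
    then show ?thesis by (metis degree_0 degree_power_eq mult_2 numeral_Bit0 zero_neq_numeral)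
  qed
  moreover have "degree ([:4:] * f) < 4"
  proof -
    have "degree (pX\<^sup>2 + [:a:] * pX + [:b:]) \<le> 2"
      using degree_smult_le[of a pX] by (intro degree_add_le) (simp_all add: degree_power_eq)
    then have "degree f \<le> 3" unfolding fact
      using degree_mult_le[of pX "pX\<^sup>2 + [:a:] * pX + [:b:]"] by simp
    then show ?thesis by (simp add: four)
  qed
  ultimately have deg: "has_deg A 4" unfolding has_deg_def by blast
  \<comment> \<open>the chord from \<open>2 P\<close> to \<open>- P\<close> is the tangent at \<open>P\<close>\<close>
  have "add_P a F A (- B) = ?X" if "A \<noteq> ?X"
  proof -
    have "(- B - 1) / (A - ?X) = l" using that by (simp add: B_def)
    then show ?thesis by (simp add: add_P_def A_def aa_def)
  qed
  with pt deg that show thesis by blast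
qed

text \<open>The degrees 1 of \<open>P\<close> and 4 of \<open>2 P\<close> and the parallelogram law give the degree \<open>y\<^sup>2\<close> of
  \<open>y P\<close>. Since \<open>j P\<close> acts on the invariant differential by \<open>j\<close>, the hypothesis excludes that
  an intermediate multiple is \<open>P\<close> or \<open>- P\<close>.\<close>

lemma multiple_pt:
  assumes "y \<ge> 1" and "\<And>j. 2 \<le> j \<Longrightarrow> j < y \<Longrightarrow> of_nat j \<noteq> (1::'a) \<and> of_nat j \<noteq> (-1::'a)"
  shows "\<exists>A B. ell_pt F a b (of_nat y) A B \<and> has_deg A (y\<^sup>2)"
proof (cases "y = 1")
  case True
  have "ell_pt F a b 1 fls_X 1" by (simp add: ell_pt_def F)
  then show ?thesis using True has_deg_X by auto
next
  case False
  obtain A B where AB: "ell_pt F a b 2 A B" "has_deg A 4" "A \<noteq> fls_X \<longrightarrow> add_P a F A (- B) = fls_X"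
    using double_pt by blast
  have A: "A \<noteq> fls_X" using AB(2) has_deg_X has_deg_unique[of A 4 1] by auto
  have prev: "has_deg (add_P a F A (- B)) 1" using AB(3) A has_deg_X by simp
  have "k \<le> y - 2 \<Longrightarrow> (\<forall>j<k. fst (orbit a F A B j) \<noteq> fls_X) \<and> ell_pt F a b (2 + of_nat k) (fst (orbit a F A B k)) (snd (orbit a F A B k)) \<and> has_deg (fst (orbit a F A B k)) ((k+2)\<^sup>2)" for k
  proof (induction k)
    case 0
    then show ?case using AB by (simp add: power2_eq_square numeral_eq_Suc)
  next
    case (Suc k)
    then have IH: "\<forall>j<k. fst (orbit a F A B j) \<noteq> fls_X" "ell_pt F a b (2 + of_nat k) (fst (orbit a F A B k)) (snd (orbit a F A B k))" by auto
    have "fst (orbit a F A B k) \<noteq> fls_X"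
      using pt_not_P[OF F F_nonzero IH(2)] assms(2)[of "k + 2"] Suc.prems by (simp add: add.commute)
    then have m: "\<And>j. j < Suc k \<Longrightarrow> fst (orbit a F A B j) \<noteq> fls_X" using IH(1) less_Suc_eq by auto
    obtain dk where dk: "ell_pt F a b (2 + of_nat (Suc k)) (fst (orbit a F A B (Suc k))) (snd (orbit a F A B (Suc k)))"
     "has_deg (fst (orbit a F A B (Suc k))) dk" "int dk = int (Suc k) ^ 2 + (int 4 + 1 - int 1) * int (Suc k) + int 4"
      using orbit_quadratic[OF AB(1,2) prev m, of "Suc k"] by blast
    have "dk = (Suc k + 2)\<^sup>2"
      using dk(3) by (simp add: power2_eq_square algebra_simps flip: of_nat_eq_iff[where 'a=int])
    then show ?case using dk m by blast
  qed
  from this[of "y - 2"] have "ell_pt F a b (2 + of_nat (y - 2)) (fst (orbit a F A B (y - 2))) (snd (orbit a F A B (y - 2)))"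
    "has_deg (fst (orbit a F A B (y - 2))) ((y - 2 + 2)\<^sup>2)" by simp_all
  moreover have "y - 2 + 2 = y" using assms(1) False by simp
  moreover have "2 + of_nat (y - 2) = (of_nat y :: 'a)"
    using \<open>y - 2 + 2 = y\<close> by (metis add.commute of_nat_add of_nat_numeral)
  ultimately show ?thesis by auto
qed

end

section \<open>Isogenies and the endomorphism of square -6\<close>

lemma fls_const_hom:
  "fls_const (x + y) = fls_const x + fls_const y" "fls_const (x - y) = fls_const x - fls_const (y::'a::field)"
  "fls_const (- x) = - fls_const x" "fls_const (x * y) = fls_const x * fls_const y"
  by (simp_all add: fls_plus_const fls_minus_const)

text \<open>This rule would multiply out constants whose factors have to remain visible below.\<close>

declare fls_const_mult_const [simp del]

lemma fls_deriv_divide_const: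
  fixes A :: "'a::field fls"
  shows "fls_deriv (A / fls_const c) = fls_deriv A / fls_const c"
  by (simp add: divide_inverse fls_inverse_const)

text \<open>The isogeny of degree 2 whose kernel is generated by the point \<open>(0, 0)\<close>. It is normalised,
  so it keeps \<open>w\<close>.\<close>

lemma pt_two_isogeny:
  assumes pt: "ell_pt F a b w A B" and A: "A \<noteq> 0"
  shows "ell_pt F (- 2 * a) (a\<^sup>2 - 4 * b) w ((A\<^sup>2 + fls_const a * A + fls_const b) / A)
    (B * (A\<^sup>2 - fls_const b) / A\<^sup>2)"
proof -
  define aa where "aa = fls_const a"
  define bb where "bb = fls_const b"
  have c: "fls_const (- 2 * a) = - 2 * aa" "fls_const (a\<^sup>2 - 4 * b) = aa\<^sup>2 - 4 * bb"
    by (simp_all add: aa_def bb_def fls_const_hom power2_eq_square)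
  define C where "C = (A\<^sup>2 + aa * A + bb) / A"
  have FB: "F * B\<^sup>2 = A ^ 3 + aa * A\<^sup>2 + bb * A" using pt by (simp add: ell_pt_def cubic_def aa_def bb_def)
  have dA: "fls_deriv A = fls_const w * B" using pt by (simp add: ell_pt_def)
  have rat: "ratfun A" "ratfun B" using pt by (auto simp: ell_pt_def)
  have CA: "C * A = A\<^sup>2 + aa * A + bb" using A by (simp add: C_def)
  have "A ^ 3 * (F * (B * (A\<^sup>2 - bb) / A\<^sup>2)\<^sup>2) = A ^ 3 * (C ^ 3 + (- 2 * aa) * C\<^sup>2 + (aa\<^sup>2 - 4 * bb) * C)"
  proof -
    have "A ^ 3 * (F * (B * (A\<^sup>2 - bb) / A\<^sup>2)\<^sup>2) * A = F * B\<^sup>2 * (A\<^sup>2 - bb)\<^sup>2"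
      using A by (simp add: power_divide power_mult_distrib power2_eq_square power3_eq_cube)
    also have "\<dots> = ((A\<^sup>2 + aa * A + bb) ^ 3 + (- 2 * aa) * A * (A\<^sup>2 + aa * A + bb)\<^sup>2 + (aa\<^sup>2 - 4 * bb) * A\<^sup>2 * (A\<^sup>2 + aa * A + bb)) * A"
      unfolding FB by (simp add: algebra_simps power2_eq_square power3_eq_cube)
    also have "\<dots> = A ^ 3 * (C ^ 3 + (- 2 * aa) * C\<^sup>2 + (aa\<^sup>2 - 4 * bb) * C) * A"
      unfolding CA[symmetric] by (simp add: algebra_simps power2_eq_square power3_eq_cube)
    finally show ?thesis using A by simp
  qed
  then have curve: "F * (B * (A\<^sup>2 - bb) / A\<^sup>2)\<^sup>2 = cubic (- 2 * a) (a\<^sup>2 - 4 * b) C"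
    unfolding cubic_def c using A by simp
  have "fls_deriv C = (fls_deriv (A\<^sup>2 + aa * A + bb) * A - (A\<^sup>2 + aa * A + bb) * fls_deriv A) / A\<^sup>2"
    unfolding C_def by (rule fls_deriv_divide[OF A])
  also have "fls_deriv (A\<^sup>2 + aa * A + bb) * A - (A\<^sup>2 + aa * A + bb) * fls_deriv A = fls_const w * (B * (A\<^sup>2 - bb))"
    by (simp add: dA power2_eq_square algebra_simps aa_def bb_def)
  finally have "fls_deriv C = fls_const w * (B * (A\<^sup>2 - bb) / A\<^sup>2)" by simp
  then show ?thesis unfolding ell_pt_def C_def[symmetric] aa_def[symmetric] bb_def[symmetric]
    using curve rat by (simp add: C_def aa_def bb_def)
qed

lemma degree_two_isogeny:
  fixes A :: "'a::field_gcd fls"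
  assumes d: "has_deg A d" and b: "b \<noteq> 0"
  shows "has_deg ((A\<^sup>2 + fls_const a * A + fls_const b) / A) (2 * d)"
proof -
  obtain N D where r: "lowest_terms A N D" and ND: "degree N = d" "degree D < d"
    using d unfolding has_deg_def by blast
  have AD: "A * rf D = rf N" and D0: "D \<noteq> 0" and cp: "coprime N D" using r by (auto simp: lowest_terms_def)
  have N0: "N \<noteq> 0" using ND by auto
  have A0: "A \<noteq> 0" using AD N0 by auto
  let ?N = "N\<^sup>2 + ([:a:] * (N * D) + [:b:] * D\<^sup>2)"
  have "lowest_terms ((A\<^sup>2 + fls_const a * A + fls_const b) / A) ?N (N * D)"
    unfolding lowest_terms_def
  proof (intro conjI)
    show "N * D \<noteq> 0" using N0 D0 by simp
    show "(A\<^sup>2 + fls_const a * A + fls_const b) / A * rf (N * D) = rf ?N"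
      unfolding rf_hom AD[symmetric] using A0 by (simp add: field_simps power2_eq_square)
    show "coprime ?N (N * D)"
    proof (rule coprime_polyI[OF \<open>N * D \<noteq> 0\<close>])
      fix g assume g: "prime g" "g dvd ?N" "g dvd N * D"
      have n: "\<not> (g dvd N \<and> g dvd D)" using cp g(1) by (meson coprime_common_divisor not_prime_unit)
      have ub: "\<not> g dvd [:b:]"
        using g(1) b by (metis not_prime_unit dvd_trans is_unit_const_poly_iff dvd_field_iff)
      from g(3) consider "g dvd N" | "g dvd D" using g(1) prime_dvd_mult_iff by blast
      then show False
      proof cases
        case 1
        then have "g dvd N * (N + [:a:] * D)" by simp
        moreover have "?N = N * (N + [:a:] * D) + [:b:] * D\<^sup>2" by (simp add: algebra_simps power2_eq_square)
        ultimately have "g dvd [:b:] * D\<^sup>2" using g(2) by (metis dvd_add_right_iff)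
        then show False using ub n 1 g(1) by (metis prime_dvd_mult_iff prime_dvd_power)
      next
        case 2
        then have "g dvd D * ([:a:] * N + [:b:] * D)" by simp
        moreover have "?N = N\<^sup>2 + D * ([:a:] * N + [:b:] * D)" by (simp add: algebra_simps power2_eq_square)
        ultimately have "g dvd N\<^sup>2" using g(2) by (metis dvd_add_left_iff)
        then show False using n 2 g(1) by (metis prime_dvd_power)
      qed
    qed
  qed
  moreover have "degree ?N = 2 * d"
  proof -
    have "degree ([:a:] * (N * D)) < 2 * d"
      using degree_smult_le[of a "N * D"] ND N0 D0 by (simp add: degree_mult_eq)
    moreover have "degree ([:b:] * D\<^sup>2) < 2 * d"
      using degree_smult_le[of b "D\<^sup>2"] ND D0 by (simp add: degree_power_eq)
    ultimately have "degree ([:a:] * (N * D) + [:b:] * D\<^sup>2) < degree (N\<^sup>2)"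
      using ND N0 by (simp add: degree_power_eq degree_add_less)
    then have "degree ?N = degree (N\<^sup>2)" by (rule degree_add_eq_left)
    then show ?thesis using ND N0 by (simp add: degree_power_eq)
  qed
  moreover have "degree (N * D) < 2 * d" using ND N0 D0 by (simp add: degree_mult_eq)
  ultimately show ?thesis unfolding has_deg_def by blast
qed

lemma degree_three_isogeny:
  fixes A :: "'a::field_gcd fls"
  assumes d: "has_deg A d" and x0: "x0 \<noteq> 0" "e \<noteq> x0"
  shows "has_deg (A * (A - fls_const e)\<^sup>2 / (A - fls_const x0)\<^sup>2) (3 * d)" and "A \<noteq> fls_const x0"
proof -
  obtain N D where r: "lowest_terms A N D" and ND: "degree N = d" "degree D < d"
    using d unfolding has_deg_def by blast
  have AD: "A * rf D = rf N" and D0: "D \<noteq> 0" and cp: "coprime N D" using r by (auto simp: lowest_terms_def)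
  have N0: "N \<noteq> 0" using ND by auto
  have deg: "degree (N - [:c:] * D) = d" for c using degree_monic_combination[of D N c] ND by simp
  then have nz: "N - [:c:] * D \<noteq> 0" for c using ND by (metis degree_0 less_nat_zero_code)
  have Ac: "(A - fls_const c) * rf D = rf (N - [:c:] * D)" for c
    unfolding rf_hom AD[symmetric] by (simp add: algebra_simps)
  show Ax: "A \<noteq> fls_const x0" using Ac[of x0] nz[of x0] by auto
  let ?N = "N * (N - [:e:] * D)\<^sup>2" and ?D = "(N - [:x0:] * D)\<^sup>2 * D"
  have "lowest_terms (A * (A - fls_const e)\<^sup>2 / (A - fls_const x0)\<^sup>2) ?N ?D"
    unfolding lowest_terms_def
  proof (intro conjI)
    show D': "?D \<noteq> 0" using nz D0 by simp
    have "rf ?N = A * (A - fls_const e)\<^sup>2 * rf D ^ 3"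
      unfolding rf_mult[of N] rf_power Ac[symmetric] AD[symmetric]
      by (simp add: power2_eq_square power3_eq_cube)
    moreover have "rf ?D = (A - fls_const x0)\<^sup>2 * rf D ^ 3"
      unfolding rf_mult[of "_ ^ 2"] rf_power Ac[symmetric]
      by (simp add: power2_eq_square power3_eq_cube)
    ultimately show "A * (A - fls_const e)\<^sup>2 / (A - fls_const x0)\<^sup>2 * rf ?D = rf ?N"
      using Ax by simp
    show "coprime ?N ?D"
    proof (rule coprime_polyI[OF D'])
      fix g assume g: "prime g" "g dvd ?N" "g dvd ?D"
      have n: "\<not> (g dvd N \<and> g dvd D)" using cp g(1) by (meson coprime_common_divisor not_prime_unit)
      have unitc: "\<not> g dvd [:c:]" if "c \<noteq> 0" for c
        using g(1) that by (metis not_prime_unit dvd_trans is_unit_const_poly_iff dvd_field_iff)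
      have gN: "g dvd N \<or> g dvd N - [:e:] * D" using g by (metis prime_dvd_mult_iff prime_dvd_power)
      have gD: "\<not> g dvd D"
      proof
        assume *: "g dvd D"
        then have "g dvd N" using gN by (metis dvd_mult dvd_diff_left_iff)
        then show False using n * by blast
      qed
      then have gx: "g dvd N - [:x0:] * D" using g(1,3) by (metis prime_dvd_mult_iff prime_dvd_power)
      from gN show False
      proof
        assume "g dvd N"
        then have "g dvd [:x0:] * D" using gx by (metis dvd_diff_right_iff)
        then show False using gD unitc[OF x0(1)] g(1) by (metis prime_dvd_mult_iff)
      next
        assume "g dvd N - [:e:] * D"
        then have "g dvd (N - [:x0:] * D) - (N - [:e:] * D)" using gx by (metis dvd_diff)
        moreover have "(N - [:x0:] * D) - (N - [:e:] * D) = [:e - x0:] * D"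
          by (simp add: smult_diff_left)
        ultimately show False using gD unitc[of "e - x0"] x0 g(1)
          by (metis prime_dvd_mult_iff right_minus_eq)
      qed
    qed
  qed
  moreover have "degree ?N = 3 * d"
    using nz[of e] N0 deg[of e] ND by (simp add: degree_mult_eq degree_power_eq)
  moreover have "degree ?D < 3 * d"
    using nz[of x0] D0 deg[of x0] ND by (simp add: degree_mult_eq degree_power_eq)
  ultimately show "has_deg (A * (A - fls_const e)\<^sup>2 / (A - fls_const x0)\<^sup>2) (3 * d)"
    unfolding has_deg_def by blast
qed

text \<open>The isogeny of degree 3 whose kernel consists of the origin and the two points with first
  coordinate \<open>14 + 10 r\<close>. The hypothesis \<open>r\<^sup>2 = 2\<close> makes this number a root of the
  polynomial whose roots are the first coordinates of the points of order 3.\<close>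

lemma pt_three_isogeny:
  fixes r :: "'a::field_gcd"
  assumes r: "r\<^sup>2 = 2"
    and pt: "ell_pt F (- 12 * (2 + r)) (204 + 144 * r) w A B" and A: "A \<noteq> fls_const (14 + 10 * r)"
  defines "e \<equiv> fls_const (6 + 6 * r)" and "x0 \<equiv> fls_const (14 + 10 * r)"
  shows "ell_pt F (- 36 * (2 + r)) 108 w (A * (A - e)\<^sup>2 / (A - x0)\<^sup>2)
    (B * ((A - e) * (A\<^sup>2 + (e - 3 * x0) * A + e * x0)) / (A - x0) ^ 3)"
proof -
  define R where "R = fls_const r"
  have RR: "R * R = 2" using r by (simp add: R_def power2_eq_square fls_const_hom(4)[symmetric])
  then have RRz: "R * (R * z) = 2 * z" for z by (metis mult.assoc)
  have e: "e = 6 + 6 * R" and x0: "x0 = 14 + 10 * R"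
    by (simp_all add: e_def x0_def R_def fls_const_hom)
  have c: "fls_const (- 12 * (2 + r)) = - (24 + 12 * R)" "fls_const (204 + 144 * r) = 204 + 144 * R"
     "fls_const (- 36 * (2 + r)) = - (72 + 36 * R)" "fls_const (108::'a) = 108"
    by (simp_all add: R_def fls_const_hom algebra_simps)
  define G where "G = A - x0"
  define H where "H = A - e"
  define K where "K = A\<^sup>2 + (e - 3 * x0) * A + e * x0"
  define C where "C = A * H\<^sup>2 / G\<^sup>2"
  have G: "G \<noteq> 0" using A by (simp add: G_def x0_def)
  have rat: "ratfun A" "ratfun B" using pt by (auto simp: ell_pt_def)
  have FB: "F * B\<^sup>2 = A * (A\<^sup>2 - (24 + 12 * R) * A + (204 + 144 * R))"
    using pt unfolding ell_pt_def cubic_def c by (simp add: algebra_simps power2_eq_square power3_eq_cube)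
  have dA: "fls_deriv A = fls_const w * B" using pt by (simp add: ell_pt_def)
  \<comment> \<open>the equation of the target curve; the factor \<open>K\<close> comes from the derivative of the isogeny\<close>
  have key: "(A\<^sup>2 - (24 + 12 * R) * A + (204 + 144 * R)) * K\<^sup>2
      = A\<^sup>2 * H ^ 4 - (72 + 36 * R) * A * H\<^sup>2 * G\<^sup>2 + 108 * G ^ 4"
    unfolding K_def H_def G_def e x0
    by (simp add: algebra_simps power2_eq_square power4_eq_xxxx RR RRz)
  have "F * (B * (H * K) / G ^ 3)\<^sup>2 = (F * B\<^sup>2) * H\<^sup>2 * K\<^sup>2 / G ^ 6"
    by (simp add: power_divide power_mult_distrib flip: power_mult)
  also have "\<dots> = A * H\<^sup>2 * ((A\<^sup>2 - (24 + 12 * R) * A + (204 + 144 * R)) * K\<^sup>2) / G ^ 6"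
    unfolding FB by (simp add: mult_ac)
  also have "\<dots> = cubic (- 36 * (2 + r)) 108 C"
    unfolding key cubic_def c C_def using G
    by (simp add: field_simps power2_eq_square power3_eq_cube power4_eq_xxxx eval_nat_numeral)
  finally have curve: "F * (B * (H * K) / G ^ 3)\<^sup>2 = cubic (- 36 * (2 + r)) 108 C" .
  have dG: "fls_deriv G = fls_const w * B" and dH: "fls_deriv H = fls_const w * B"
    by (simp_all add: G_def H_def dA e_def x0_def)
  have "fls_deriv C = (fls_deriv (A * H\<^sup>2) * G\<^sup>2 - A * H\<^sup>2 * fls_deriv (G\<^sup>2)) / (G\<^sup>2)\<^sup>2"
    unfolding C_def by (rule fls_deriv_divide) (use G in simp)
  also have "fls_deriv (A * H\<^sup>2) * G\<^sup>2 - A * H\<^sup>2 * fls_deriv (G\<^sup>2) = fls_const w * B * (H * K) * G"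
  proof -
    have "fls_deriv (A * H\<^sup>2) * G\<^sup>2 - A * H\<^sup>2 * fls_deriv (G\<^sup>2) = fls_const w * B * (H * (H * G + 2 * A * G - 2 * A * H)) * G"
      by (simp add: dA dG dH power2_eq_square algebra_simps)
    also have "H * G + 2 * A * G - 2 * A * H = K"
      unfolding K_def H_def G_def by (simp add: power2_eq_square algebra_simps)
    finally show ?thesis .
  qed
  finally have "fls_deriv C = fls_const w * (B * (H * K) / G ^ 3)"
    using G by (simp add: power2_eq_square power3_eq_cube)
  then show ?thesis unfolding ell_pt_def C_def[symmetric] H_def[symmetric] K_def[symmetric] G_def[symmetric]
    using curve rat by (simp add: C_def K_def H_def G_def e_def x0_def)
qed

text \<open>An isomorphism between two models multiplies the invariant differential by the scaling
  factor.\<close>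

lemma pt_scale:
  fixes s :: "'a::field_gcd"
  assumes pt: "ell_pt F a b w A B" and s: "s \<noteq> 0"
  shows "ell_pt F (a / s\<^sup>2) (b / s ^ 4) (s * w) (A / fls_const (s\<^sup>2)) (B / fls_const (s ^ 3))"
proof -
  define S where "S = fls_const s"
  have S: "S \<noteq> 0" using s by (simp add: S_def)
  have c: "fls_const (s\<^sup>2) = S\<^sup>2" "fls_const (s ^ 3) = S ^ 3" "fls_const (a / s\<^sup>2) = fls_const a / S\<^sup>2"
    "fls_const (b / s ^ 4) = fls_const b / S ^ 4" "fls_const (s * w) = S * fls_const w"
    by (simp_all add: S_def fls_const_power fls_const_hom fls_const_divide_const[symmetric])
  have FB: "F * B\<^sup>2 = A ^ 3 + fls_const a * A\<^sup>2 + fls_const b * A"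
    and rat: "ratfun A" "ratfun B" and dA: "fls_deriv A = fls_const w * B"
    using pt by (auto simp: ell_pt_def cubic_def)
  have "F * (B / S ^ 3)\<^sup>2 = (F * B\<^sup>2) / S ^ 6" by (simp add: power_divide flip: power_mult)
  also have "\<dots> = cubic (a / s\<^sup>2) (b / s ^ 4) (A / S\<^sup>2)"
    unfolding FB cubic_def c using S by (simp add: field_simps power2_eq_square power3_eq_cube eval_nat_numeral)
  finally have 1: "F * (B / S ^ 3)\<^sup>2 = cubic (a / s\<^sup>2) (b / s ^ 4) (A / S\<^sup>2)" .
  have "fls_deriv (A / S\<^sup>2) = fls_deriv A / S\<^sup>2"
    unfolding c(1)[symmetric] by (rule fls_deriv_divide_const)
  also have "\<dots> = S * fls_const w * (B / S ^ 3)"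
    unfolding dA using S by (simp add: field_simps power2_eq_square power3_eq_cube)
  finally show ?thesis unfolding ell_pt_def c using 1 rat by (simp add: S_def)
qed

lemma degree_scale:
  fixes A :: "'a::field_gcd fls"
  assumes d: "has_deg A d" and c: "c \<noteq> 0"
  shows "has_deg (A / fls_const c) d"
proof -
  obtain N D where r: "lowest_terms A N D" and ND: "degree N = d" "degree D < d"
    using d unfolding has_deg_def by blast
  have "lowest_terms (A / fls_const c) (smult (inverse c) N) D"
  proof -
    have "coprime ([:inverse c:] * N) D"
      using r c unfolding lowest_terms_def coprime_mult_left_iff by (simp add: is_unit_left_imp_coprime is_unit_const_poly_iff dvd_field_iff)
    then show ?thesis using r by (simp add: lowest_terms_def rf_smult fls_inverse_const divide_inverse mult_ac)
  qed
  then show ?thesis unfolding has_deg_def using ND c by (metis degree_smult_eq inverse_nonzero_iff_nonzero)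
qed

text \<open>The curve \<open>y\<^sup>2 = x\<^sup>3 + 6 (2 + r) x\<^sup>2 + 3 x\<close> has an endomorphism of degree 6 that acts on
  the invariant differential by \<open>s\<close> with \<open>s\<^sup>2 = -6\<close>. It is the composition of the isogeny of
  degree 2, the isogeny of degree 3 and a scaling that leads back to the original model.\<close>

lemma sqrt_minus_six:
  fixes r s :: "'a::field_gcd"
  assumes r: "r\<^sup>2 = 2" and s: "s\<^sup>2 = -6" and two: "(2::'a) \<noteq> 0" and three: "(3::'a) \<noteq> 0"
    and pt: "ell_pt F (6 * (2 + r)) 3 w A B" and d: "has_deg A d"
  obtains A' B' where "ell_pt F (6 * (2 + r)) 3 (s * w) A' B'" "has_deg A' (6 * d)"
proof -
  let ?a = "6 * (2 + r)"
  have rr: "r * r = 2" using r by (simp add: power2_eq_square)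
  then have rrz: "r * (r * z) = 2 * z" for z by (metis mult.assoc)
  have six: "(6::'a) \<noteq> 0"
  proof -
    have "(6::'a) = 2 * 3" by simp
    then show ?thesis using two three by (metis mult_eq_0_iff)
  qed
  then have s0: "s \<noteq> 0" using s by auto
  define A1 where "A1 = (A\<^sup>2 + fls_const ?a * A + fls_const 3) / A"
  have "ell_pt F (- 2 * ?a) (?a\<^sup>2 - 4 * 3) w A1 (B * (A\<^sup>2 - fls_const 3) / A\<^sup>2)"
    unfolding A1_def by (rule pt_two_isogeny[OF pt has_deg_nonzero[OF d]])
  moreover have "- 2 * ?a = - 12 * (2 + r)" "?a\<^sup>2 - 4 * 3 = 204 + 144 * r"
    by (simp_all add: algebra_simps power2_eq_square rr rrz)
  ultimately have pt1: "ell_pt F (- 12 * (2 + r)) (204 + 144 * r) w A1 (B * (A\<^sup>2 - fls_const 3) / A\<^sup>2)" by simp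
  have d1: "has_deg A1 (2 * d)" unfolding A1_def by (rule degree_two_isogeny[OF d three])
  have x0: "14 + 10 * r \<noteq> 0"
  proof
    assume "14 + 10 * r = 0"
    then have "(14 + 10 * r) * (10 * r - 14) = 0" by simp
    then have "(4::'a) = 0" by (simp add: algebra_simps rr rrz)
    then show False using two by (metis mult_eq_0_iff mult_2 numeral_Bit0)
  qed
  have ex: "6 + 6 * r \<noteq> 14 + 10 * r"
  proof
    assume "6 + 6 * r = 14 + 10 * r"
    then have "8 + 4 * r = 0" by (simp add: algebra_simps)
    then have "(8 + 4 * r) * (8 - 4 * r) = 0" by simp
    then have "(32::'a) = 0" by (simp add: algebra_simps rr rrz)
    moreover have "(32::'a) = 2 ^ 5" by simp
    ultimately show False using two by (metis power_not_zero)
  qed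
  note d2 = degree_three_isogeny[OF d1 x0 ex]
  obtain B2 where pt2: "ell_pt F (- 36 * (2 + r)) 108 w (A1 * (A1 - fls_const (6 + 6 * r))\<^sup>2 / (A1 - fls_const (14 + 10 * r))\<^sup>2) B2"
    using pt_three_isogeny[OF r pt1 d2(2)] by blast
  have "- 36 * (2 + r) / s\<^sup>2 = ?a" "108 / s ^ 4 = 3"
  proof -
    have "s ^ 4 = (s\<^sup>2)\<^sup>2" by (simp flip: power_mult)
    then have "s ^ 4 = 36" by (simp add: s)
    moreover have "s ^ 4 \<noteq> 0" using s0 by simp
    ultimately show "108 / s ^ 4 = 3" by (subst nonzero_divide_eq_eq) simp_all
    have "- 36 * (2 + r) = ?a * s\<^sup>2" by (simp add: s algebra_simps)
    then show "- 36 * (2 + r) / s\<^sup>2 = ?a" using s0 by (subst nonzero_divide_eq_eq) simp_all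
  qed
  then have "ell_pt F ?a 3 (s * w) (A1 * (A1 - fls_const (6 + 6 * r))\<^sup>2 / (A1 - fls_const (14 + 10 * r))\<^sup>2 / fls_const (s\<^sup>2)) (B2 / fls_const (s ^ 3))"
    using pt_scale[OF pt2 s0] by simp
  moreover have "has_deg (A1 * (A1 - fls_const (6 + 6 * r))\<^sup>2 / (A1 - fls_const (14 + 10 * r))\<^sup>2 / fls_const (s\<^sup>2)) (6 * d)"
    using degree_scale[OF d2(1), of "s\<^sup>2"] s0 by simp
  ultimately show thesis using that by blast
qed

section \<open>Polynomials over a prime field and inseparability\<close>

lemma char_dvd_of_nat: "of_nat k = (0 :: 'p::prime_card mod_ring) \<longleftrightarrow> CARD('p) dvd k"
  by (metis dvdE mult_zero_left of_nat_0_mod_ring_dvd of_nat_card_eq_0 of_nat_mult)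

lemma fermat_mod_ring: "(z :: 'p::prime_card mod_ring) ^ CARD('p) = z"
  using finite_field_power_card_eq_same[of z] by simp

lemma fermat_mod_ring_unit: "z \<noteq> 0 \<Longrightarrow> (z :: 'p::prime_card mod_ring) ^ (CARD('p) - 1) = 1"
proof -
  assume z: "z \<noteq> 0"
  have "CARD('p) > 0" by simp
  then have "z * z ^ (CARD('p) - 1) = z * 1" using fermat_mod_ring[of z] by (simp flip: power_Suc)
  then show ?thesis using z by (metis mult_left_cancel)
qed

lemma frobenius_poly_add:
  fixes u v :: "'p::prime_card mod_ring poly"
  shows "(u + v) ^ CARD('p) = u ^ CARD('p) + v ^ CARD('p)"
proof -
  have "CHAR('p mod_ring poly) = CARD('p)" by simp
  then show ?thesis
    by (intro freshmans_dream) (simp_all add: prime_card)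
qed

lemma const_poly_frobenius: "[:c:] ^ CARD('p) = [:c :: 'p::prime_card mod_ring:]"
  by (simp add: poly_const_pow fermat_mod_ring)

lemma pderiv_zero_coeff:
  fixes N :: "'p::prime_card mod_ring poly"
  assumes "pderiv N = 0" "coeff N i \<noteq> 0"
  shows "CARD('p) dvd i"
proof (cases i)
  case (Suc j)
  have "of_nat (Suc j) * coeff N (Suc j) = 0" using assms(1) by (metis coeff_0 coeff_pderiv)
  then have "of_nat (Suc j) = (0 :: 'p mod_ring)" using assms(2) Suc by (simp del: of_nat_Suc)
  then show ?thesis using Suc char_dvd_of_nat by metis
qed simp

text \<open>If \<open>N / D\<close> is reduced with derivative zero, then \<open>D\<close> divides its own derivative, which has
  smaller degree.\<close>

lemma rat_deriv_zero:
  fixes A :: "'a::field_gcd fls"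
  assumes "lowest_terms A N D" "fls_deriv A = 0" "degree D < degree N"
  shows "pderiv N = 0 \<and> pderiv D = 0"
proof -
  have AD: "A * rf D = rf N" and D: "D \<noteq> 0" and cp: "coprime N D" using assms by (auto simp: lowest_terms_def)
  have "fls_deriv (A * rf D) = fls_deriv (rf N)" by (simp only: AD)
  then have "A * rf (pderiv D) = rf (pderiv N)" using assms(2) by (simp add: fls_deriv_rf)
  then have "rf (N * pderiv D) = rf (pderiv N * D)"
    unfolding rf_mult AD[symmetric] by (metis mult.assoc mult.commute)
  then have e: "N * pderiv D = pderiv N * D" by simp
  then have "D dvd pderiv D" using cp by (metis coprime_commute coprime_dvd_mult_right_iff dvd_triv_right)
  then have pD: "pderiv D = 0"
  proof (rule contrapos_pp)
    assume "pderiv D \<noteq> 0"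
    then have "degree D \<noteq> 0" using degree_pderiv_le[of D] by (metis degree_eq_zeroE pderiv_0 pderiv_pCons pderiv_1 add.right_neutral mult_zero_right pCons_0_0)
    moreover have "degree (pderiv D) \<le> degree D - 1" by (rule degree_pderiv_le)
    ultimately have "degree (pderiv D) < degree D" by linarith
    then show "\<not> D dvd pderiv D" using \<open>pderiv D \<noteq> 0\<close> dvd_imp_degree_le leD by metis
  qed
  then show ?thesis using e D by simp
qed

lemma squarefree_dvd_square:
  fixes f B :: "'a::factorial_semiring_gcd"
  assumes "squarefree f" "f dvd B\<^sup>2" "f \<noteq> 0"
  shows "f dvd B"
proof -
  define d where "d = gcd f B"
  have d: "d \<noteq> 0" using assms by (simp add: d_def)
  obtain f1 B1 where f1: "f = d * f1" and B1: "B = d * B1" unfolding d_def by (metis dvdE gcd_dvd1 gcd_dvd2)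
  have "f1 = f div gcd f B" "B1 = B div gcd f B" using d by (simp_all add: d_def[symmetric]) (simp_all add: f1 B1)
  then have cp: "coprime f1 B1" using assms(3) by (simp add: div_gcd_coprime)
  have "d * f1 dvd d * (d * B1\<^sup>2)" using assms(2) by (simp add: f1 B1 power2_eq_square mult_ac)
  then have "f1 dvd d * B1\<^sup>2" using d by simp
  then have "f1 dvd d" using cp by (simp add: coprime_dvd_mult_left_iff)
  then have "f1\<^sup>2 dvd f" by (simp add: f1 power2_eq_square mult_dvd_mono)
  then have "f1 dvd 1" using assms(1) squarefreeD by blast
  then have "d * f1 dvd d" by (simp add: mult_unit_dvd_iff)
  then show ?thesis unfolding f1 B1 by (rule dvd_mult2)
qed

definition cubic_poly :: "'a::field \<Rightarrow> 'a \<Rightarrow> 'a poly" where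
  "cubic_poly a b = pX ^ 3 + [:a:] * pX\<^sup>2 + [:b:] * pX"

lemma cubic_poly_coeffs: "cubic_poly a b = [:0, b, a, 1:]"
  by (simp add: cubic_poly_def pX_def power2_eq_square power3_eq_cube)

lemma rf_cubic_poly: "rf (cubic_poly a b) = cubic a b fls_X"
  by (simp only: cubic_poly_def rf_hom rf_pX cubic_def)

lemma cubic_poly_pderiv: "pderiv (cubic_poly a b) = [:b, 2 * a, 3:]"
  by (simp add: cubic_poly_coeffs pderiv_pCons)

lemma cubic_poly_coprime_pderiv:
  fixes a b :: "'a::field_gcd"
  assumes "b \<noteq> 0" "a\<^sup>2 \<noteq> 4 * b"
  shows "coprime (cubic_poly a b) (pderiv (cubic_poly a b))"
proof (rule coprime_polyI)
  have p: "pderiv (cubic_poly a b) = 3 * pX\<^sup>2 + 2 * [:a:] * pX + [:b:]"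
    by (simp add: cubic_poly_pderiv pX_def power2_eq_square numeral_poly)
  show "pderiv (cubic_poly a b) \<noteq> 0" using assms(1) by (simp add: cubic_poly_pderiv)
  fix g :: "'a poly" assume g: "prime g" "g dvd cubic_poly a b" "g dvd pderiv (cubic_poly a b)"
  have unitc: "\<not> g dvd [:c:]" if "c \<noteq> 0" for c
    using g(1) that by (metis not_prime_unit dvd_trans is_unit_const_poly_iff dvd_field_iff)
  let ?q = "pX\<^sup>2 + [:a:] * pX + [:b:]"
  have f: "cubic_poly a b = pX * ?q" by (simp add: cubic_poly_def power2_eq_square power3_eq_cube algebra_simps)
  have q1: "pderiv (cubic_poly a b) = ?q + pX * (2 * pX + [:a:])" unfolding p
  proof -
    show "3 * x\<^sup>2 + 2 * u * x + v = x\<^sup>2 + u * x + v + x * (2 * x + u)" for x u v :: "'a poly"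
      by (simp add: power2_eq_square algebra_simps)
  qed
  have "g dvd pX \<or> g dvd ?q" using g(1,2) f prime_dvd_mult_iff by metis
  then show False
  proof
    assume X: "g dvd pX"
    then have "g dvd ?q" using g(3) unfolding q1 by (metis dvd_add_left_iff dvd_mult2)
    moreover have "?q = pX * (pX + [:a:]) + [:b:]" by (simp add: power2_eq_square algebra_simps)
    ultimately have "g dvd [:b:]" using X by (metis dvd_add_right_iff dvd_mult2)
    then show False using unitc assms by blast
  next
    assume q: "g dvd ?q"
    then have "g dvd pX * (2 * pX + [:a:])" using g(3) unfolding q1 by (metis dvd_add_right_iff)
    then consider "g dvd pX" | "g dvd 2 * pX + [:a:]" using g(1) prime_dvd_mult_iff by blast
    then show False
    proof cases
      case 1
      moreover have "?q = pX * (pX + [:a:]) + [:b:]" by (simp add: power2_eq_square algebra_simps)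
      ultimately have "g dvd [:b:]" using q by (metis dvd_add_right_iff dvd_mult2)
      then show False using unitc assms by blast
    next
      case 2
      have "u\<^sup>2 - 4 * v = (2 * x + u)\<^sup>2 - 4 * (x\<^sup>2 + u * x + v)" for x u v :: "'a poly"
        by (simp add: power2_eq_square algebra_simps)
      then have "g dvd [:a:]\<^sup>2 - 4 * [:b:]" using 2 q
        by (metis dvd_diff dvd_mult dvd_mult2 power2_eq_square)
      moreover have "[:a:]\<^sup>2 - 4 * [:b:] = [:a\<^sup>2 - 4 * b:]" by (simp add: power2_eq_square numeral_poly)
      ultimately show False using unitc[of "a\<^sup>2 - 4 * b"] assms by simp
    qed
  qed
qed

lemma cubic_poly_squarefree:
  fixes a b :: "'a::field_gcd"
  assumes "b \<noteq> 0" "a\<^sup>2 \<noteq> 4 * b"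
  shows "squarefree (cubic_poly a b)"
proof (rule squarefreeI)
  fix h assume "h\<^sup>2 dvd cubic_poly a b"
  then obtain k where k: "cubic_poly a b = h\<^sup>2 * k" by blast
  have "pderiv (cubic_poly a b) = h * (2 * pderiv h * k + h * pderiv k)"
    unfolding k by (simp add: pderiv_mult power2_eq_square algebra_simps)
  then have "h dvd pderiv (cubic_poly a b)" by simp
  moreover have "h dvd cubic_poly a b" unfolding k by (simp add: power2_eq_square)
  ultimately show "h dvd 1" using cubic_poly_coprime_pderiv[OF assms] by (meson coprime_common_divisor)
qed

text \<open>If \<open>c X + e\<close> permutes the roots of the cubic \<open>X ^ 3 + a X\<^sup>2 + b X\<close>, it is the identity
  unless the curve has additional automorphisms. The two hypotheses \<open>a\<^sup>2 \<noteq> 3 b\<close> and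
  \<open>2 a\<^sup>2 \<noteq> 9 b\<close> exclude the j-invariants 0 and 1728.\<close>

lemma affine_automorphism_trivial:
  fixes a b c e :: "'a::field"
  assumes nz: "a \<noteq> 0" "b \<noteq> 0" "c \<noteq> 0" "(3::'a) \<noteq> 0" and j: "a\<^sup>2 \<noteq> 3 * b" "2 * a\<^sup>2 \<noteq> 9 * b"
    and e1: "3 * e + a = c * a" and e2: "3 * e\<^sup>2 + 2 * a * e + b = c\<^sup>2 * b" and e3: "e ^ 3 + a * e\<^sup>2 + b * e = 0"
  shows "c = 1 \<and> e = 0"
proof (cases "e = 0")
  case True then show ?thesis using e1 nz by simp
next
  case False
  have q: "e\<^sup>2 + a * e + b = 0"
  proof -
    have "e * (e\<^sup>2 + a * e + b) = 0" using e3 by (simp add: algebra_simps power2_eq_square power3_eq_cube)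
    then show ?thesis using False by simp
  qed
  have e: "3 * e = (c - 1) * a" using e1 by (simp add: algebra_simps)
  have c1: "c - 1 \<noteq> 0" using e False nz by auto
  have "(3 * e)\<^sup>2 + 3 * a * (3 * e) + 9 * b = 9 * (e\<^sup>2 + a * e + b)" by (simp add: algebra_simps power2_eq_square)
  then have "(3 * e)\<^sup>2 + 3 * a * (3 * e) + 9 * b = 0" using q by simp
  then have 1: "a\<^sup>2 * (c - 1) * (c + 2) + 9 * b = 0" unfolding e by (simp add: algebra_simps power2_eq_square)
  have "(3 * e)\<^sup>2 + 2 * a * (3 * e) + 3 * b = 3 * (3 * e\<^sup>2 + 2 * a * e + b)" by (simp add: algebra_simps power2_eq_square)
  then have "(c - 1) * ((c + 1) * (a\<^sup>2 - 3 * b)) = 0"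
    unfolding e e2 by (simp add: algebra_simps power2_eq_square)
  then have "c + 1 = 0" using c1 j(1) by auto
  then have "c = -1" by (simp add: eq_neg_iff_add_eq_0)
  then show ?thesis using 1 j(2) by (simp add: algebra_simps)
qed

section \<open>The Frobenius point\<close>

text \<open>An inseparable point of degree \<open>p\<close> is the Frobenius point up to sign. Its first coordinate
  is \<open>c X ^ p + e\<close>, hence a power \<open>l ^ p\<close> with \<open>l\<close> of degree 1. The equation of the curve
  makes \<open>f g\<close> a square, where \<open>g\<close> is the composition of the cubic \<open>f\<close> with \<open>l\<close>. As \<open>f\<close> is
  squarefree it divides \<open>g\<close>, so \<open>l\<close> permutes the roots of \<open>f\<close>.\<close>

lemma frobenius_image:
  fixes a b :: "'p::prime_card mod_ring" and F :: "'p mod_ring fls"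
  assumes F: "F = cubic a b fls_X"
  assumes pt: "ell_pt F a b 0 A B" and deg: "has_deg A (CARD('p))"
  assumes nz: "a \<noteq> 0" "b \<noteq> 0" "(2::'p mod_ring) \<noteq> 0" "(3::'p mod_ring) \<noteq> 0"
    and disc: "a\<^sup>2 \<noteq> 4 * b" and j: "a\<^sup>2 \<noteq> 3 * b" "2 * a\<^sup>2 \<noteq> 9 * b"
  shows "A = fls_X ^ CARD('p)"
proof -
  let ?p = "CARD('p)"
  have p: "prime ?p" by (rule prime_card)
  have podd: "odd ?p"
  proof
    assume "even ?p"
    then have "2 = ?p" using primes_dvd_imp_eq[OF two_is_prime_nat p] by simp
    then have "of_nat 2 = (0::'p mod_ring)" using of_nat_card_eq_0[where ?'a = 'p] by simp
    then show False using nz by simp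
  qed
  obtain N D where r: "lowest_terms A N D" and ND: "degree N = ?p" "degree D < ?p"
    using deg unfolding has_deg_def by blast
  have "fls_deriv A = 0" using pt by (simp add: ell_pt_def)
  then have pd: "pderiv N = 0" "pderiv D = 0" using rat_deriv_zero[OF r] ND by auto
  have "D \<noteq> 0" using r by (simp add: lowest_terms_def)
  then have "?p dvd degree D" using pderiv_zero_coeff[OF pd(2), of "degree D"] by simp
  then have "degree D = 0" using ND(2) by (metis dvd_imp_le not_gr_zero not_le)
  obtain c' where c': "D = [:c':]" using \<open>degree D = 0\<close> degree_eq_zeroE by blast
  have c'0: "c' \<noteq> 0" using \<open>D \<noteq> 0\<close> c' by simp
  define c where "c = coeff N ?p / c'"
  define e where "e = coeff N 0 / c'"
  have c0: "c \<noteq> 0" unfolding c_def using ND(1) c'0 p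
    by (metis degree_0 divide_eq_0_iff leading_coeff_0_iff not_prime_0)
  have N: "N = [:c':] * ([:e:] + [:c:] * pX ^ ?p)"
  proof (rule poly_eqI)
    fix i
    have X: "pX ^ ?p = (monom 1 ?p :: 'p mod_ring poly)"
      by (simp only: pX_def monom_altdef smult_1_left)
    have "coeff N i = 0" if "i \<noteq> 0" "i \<noteq> ?p"
    proof (rule ccontr)
      assume ne: "coeff N i \<noteq> 0"
      then have "?p dvd i" "i \<le> ?p" using pderiv_zero_coeff[OF pd(1) ne] le_degree[OF ne] ND(1) by simp_all
      then show False using that by (metis dvd_imp_le le_antisym not_gr_zero)
    qed
    then show "coeff N i = coeff ([:c':] * ([:e:] + [:c:] * pX ^ ?p)) i"
      using c'0 prime_gt_0_nat[OF p]
      by (cases "i = 0"; cases "i = ?p") (simp_all add: X c_def e_def coeff_pCons split: nat.split)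
  qed
  have L: "[:e:] + [:c:] * pX ^ ?p = ([:e:] + [:c:] * pX) ^ ?p"
    by (simp only: frobenius_poly_add power_mult_distrib const_poly_frobenius)
  have A: "A = rf (([:e:] + [:c:] * pX) ^ ?p)"
  proof -
    have "A * rf [:c':] = rf ([:c':] * ([:e:] + [:c:] * pX ^ ?p))"
      using r unfolding lowest_terms_def c' N by blast
    then have "rf [:c':] * A = rf [:c':] * rf ([:e:] + [:c:] * pX ^ ?p)"
      by (simp only: rf_mult mult.commute)
    moreover have "rf [:c':] \<noteq> 0" using c'0 by (simp add: rf_const)
    ultimately show ?thesis unfolding L[symmetric] by (metis mult_left_cancel)
  qed
  define f where "f = cubic_poly a b"
  define l where "l = [:e:] + [:c:] * pX"
  define g where "g = l ^ 3 + [:a:] * l\<^sup>2 + [:b:] * l"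
  have f0: "f \<noteq> 0" by (simp add: f_def cubic_poly_coeffs)
  have Ff: "F = rf f" by (simp add: F f_def rf_cubic_poly)
  have cub: "cubic a b A = rf (g ^ ?p)"
  proof -
    have "g ^ ?p = (l ^ ?p) ^ 3 + [:a:] * (l ^ ?p)\<^sup>2 + [:b:] * l ^ ?p"
      unfolding g_def by (simp only: frobenius_poly_add power_mult_distrib const_poly_frobenius power_commutes
        flip: power_mult) (simp only: mult.commute)
    then show ?thesis unfolding A cubic_def l_def[symmetric] by (simp only: rf_hom)
  qed
  have l1: "degree l = 1" by (simp add: l_def pX_def c0)
  have gcoef: "g = [:e ^ 3 + a * e\<^sup>2 + b * e, c * (3 * e\<^sup>2 + 2 * a * e + b), c\<^sup>2 * (3 * e + a), c ^ 3:]"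
    by (simp add: g_def l_def pX_def power2_eq_square power3_eq_cube algebra_simps)
  have g0: "g \<noteq> 0" using c0 by (simp add: gcoef)
  define n where "n = (?p - 1) div 2"
  have pn: "?p = 2 * n + 1" using podd by (auto simp: n_def elim: oddE)
  have FB: "rf f * B\<^sup>2 = rf (g ^ ?p)" using pt cub by (simp add: ell_pt_def Ff)
  \<comment> \<open>with \<open>p = 2 n + 1\<close> the even part of \<open>g ^ p\<close> is removed, which leaves a square root of
    \<open>f g\<close>\<close>
  define B1 where "B1 = rf f * B / rf (g ^ n)"
  have gn0: "rf (g ^ n) \<noteq> 0" using g0 by simp
  have "B1\<^sup>2 * (rf (g ^ n))\<^sup>2 = rf f * (rf f * B\<^sup>2)"
    unfolding B1_def using gn0 by (simp add: power_divide power_mult_distrib power2_eq_square)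
  also have "\<dots> = rf (f * g) * (rf (g ^ n))\<^sup>2"
    unfolding FB by (simp add: pn rf_hom power_mult power_even_eq power2_eq_square power_mult_distrib)
  finally have "B1\<^sup>2 * (rf (g ^ n))\<^sup>2 = rf (f * g) * (rf (g ^ n))\<^sup>2" .
  moreover have "(rf (g ^ n))\<^sup>2 \<noteq> 0" using gn0 by (rule power_not_zero)
  ultimately have B1: "B1\<^sup>2 = rf (f * g)" by (metis mult_right_cancel)
  have ratB1: "ratfun B1" unfolding B1_def using pt by (simp add: ell_pt_def)
  obtain N1 D1 where r1: "lowest_terms B1 N1 D1" using ratfun_lowest_terms[OF ratB1] .
  have "rf (N1\<^sup>2) = rf (f * g * D1\<^sup>2)"
    using r1 B1 unfolding lowest_terms_def rf_power rf_mult[of "f * g"] by (metis power_mult_distrib)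
  then have e1: "N1\<^sup>2 = f * g * D1\<^sup>2" by (simp only: rf_eq_iff)
  have "coprime (N1\<^sup>2) (D1\<^sup>2)" using r1 by (simp add: lowest_terms_def)
  then have "is_unit (D1\<^sup>2)" using e1 by (metis coprime_common_divisor dvd_refl dvd_triv_right)
  then have "f dvd N1\<^sup>2" using e1 by simp
  then have "f dvd N1" using squarefree_dvd_square cubic_poly_squarefree[OF nz(2) disc] f0 unfolding f_def by blast
  then have "f * f dvd N1 * N1" by (intro mult_dvd_mono)
  then have "f * f dvd f * g * D1\<^sup>2" unfolding e1[symmetric] by (simp add: power2_eq_square)
  then have "f dvd g * D1\<^sup>2" using f0 by (simp add: mult.assoc)
  then have "f dvd g" using \<open>is_unit (D1\<^sup>2)\<close> by (simp add: dvd_mult_unit_iff)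
  then obtain k where k: "g = f * k" by blast
  have "degree g = 3" using c0 by (simp add: gcoef)
  moreover have "degree f = 3" by (simp add: f_def cubic_poly_coeffs)
  ultimately have "degree k = 0" using k g0 by (simp add: degree_mult_eq)
  then obtain k0 where k0: "k = [:k0:]" using degree_eq_zeroE by blast
  have "g = smult k0 f" using k k0 by simp
  then have eqs: "e ^ 3 + a * e\<^sup>2 + b * e = 0" "c * (3 * e\<^sup>2 + 2 * a * e + b) = k0 * b" "c\<^sup>2 * (3 * e + a) = k0 * a" "c ^ 3 = k0"
    unfolding gcoef f_def cubic_poly_coeffs by simp_all
  have "c\<^sup>2 * (3 * e + a) = c\<^sup>2 * (c * a)" using eqs(3) unfolding eqs(4)[symmetric] by (simp add: power2_eq_square power3_eq_cube mult.assoc)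
  then have e2: "3 * e + a = c * a" using c0 by simp
  have "c * (3 * e\<^sup>2 + 2 * a * e + b) = c * (c\<^sup>2 * b)" using eqs(2) unfolding eqs(4)[symmetric] by (simp add: power2_eq_square power3_eq_cube mult.assoc)
  then have e3: "3 * e\<^sup>2 + 2 * a * e + b = c\<^sup>2 * b" using c0 by simp
  have "c = 1 \<and> e = 0" using affine_automorphism_trivial[OF nz(1,2) c0 nz(4) j e2 e3 eqs(1)] .
  then show ?thesis unfolding A by (simp add: rf_hom one_pCons[symmetric])
qed

text \<open>The derivative of \<open>X ^ p - X\<close> is \<open>- 1\<close>, so every element of the prime field is a simple
  root.\<close>

lemma order_artin_schreier:
  fixes z :: "'p::prime_card mod_ring"
  shows "order z (pX ^ CARD('p) - pX) = 1"
proof -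
  let ?W = "pX ^ CARD('p) - pX :: 'p mod_ring poly"
  have W': "pderiv ?W = -1"
    by (simp add: pderiv_diff pderiv_power)
  have W0: "?W \<noteq> 0" using W' by (metis neg_0_equal_iff_equal pderiv_0 zero_neq_one)
  have "poly ?W z = 0" by (simp add: fermat_mod_ring)
  then have 1: "order z ?W \<ge> 1" using W0 order_gt_0_iff[of ?W z] by simp
  have "\<not> order z ?W \<ge> 2"
  proof
    assume "order z ?W \<ge> 2"
    then have "[:- z, 1:] ^ 2 dvd ?W" by (simp add: order_divides)
    then obtain k where k: "?W = [:- z, 1:]\<^sup>2 * k" by blast
    define q where "q = [:- z, 1:]"
    have "pderiv ?W = q * (2 * pderiv q * k + q * pderiv k)"
      unfolding k q_def[symmetric] by (simp add: pderiv_mult power2_eq_square algebra_simps)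
    moreover have "poly q z = 0" by (simp add: q_def)
    ultimately have "poly (pderiv ?W) z = 0" by simp
    then show False unfolding W' by simp
  qed
  with 1 show ?thesis by simp
qed

lemma degree_artin_schreier: "degree (pX ^ CARD('p) - pX :: 'p::prime_card mod_ring poly) = CARD('p)"
proof -
  have "degree (- pX) < degree (pX ^ CARD('p) :: 'p mod_ring poly)"
    using prime_gt_1_nat[OF prime_card[where ?'a='p]] by (simp add: degree_power_eq)
  then have "degree (pX ^ CARD('p) + (- pX) :: 'p mod_ring poly) = degree (pX ^ CARD('p) :: 'p mod_ring poly)"
    by (rule degree_add_eq_left)
  then show ?thesis by (simp add: degree_power_eq)
qed

text \<open>A divisor of \<open>(X ^ p - X)\<^sup>2\<close> splits into linear factors over the prime field. Counting
  roots of the divisor and of the cofactor avoids a factorisation.\<close>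

lemma sum_order_eq_degree:
  fixes D :: "'p::prime_card mod_ring poly"
  assumes "D dvd (pX ^ CARD('p) - pX)\<^sup>2"
  shows "(\<Sum>z\<in>UNIV. order z D) = degree D"
proof -
  let ?W = "pX ^ CARD('p) - pX :: 'p mod_ring poly"
  have W0: "?W \<noteq> 0" using degree_artin_schreier[where ?'p='p] prime_gt_1_nat[OF prime_card[where ?'a='p]] by auto
  obtain E where E: "?W\<^sup>2 = D * E" using assms by blast
  then have nz: "D \<noteq> 0" "E \<noteq> 0" using W0 by auto
  have le: "(\<Sum>z\<in>UNIV. order z P) \<le> degree P" if "P \<noteq> 0" for P :: "'p mod_ring poly"
  proof -
    have "(\<Sum>z\<in>UNIV. order z P) = (\<Sum>z | poly P z = 0. order z P)"
      by (rule sum.mono_neutral_right) (auto simp: order_0I)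
    then show ?thesis using sum_order_le_degree[OF that] by simp
  qed
  have "order z D + order z E = 2" for z
  proof -
    have "order z (D * E) = order z (?W * ?W)" using E by (simp add: power2_eq_square)
    then show ?thesis using nz W0 order_artin_schreier[of z] by (simp add: order_mult)
  qed
  then have "(\<Sum>z\<in>UNIV. order z D) + (\<Sum>z\<in>UNIV. order z E) = 2 * CARD('p)"
    by (simp flip: sum.distrib)
  moreover have "degree D + degree E = 2 * CARD('p)"
  proof -
    have "degree (?W\<^sup>2) = degree (D * E)" using E by simp
    then show ?thesis using nz W0 degree_artin_schreier[where ?'p='p] by (simp add: degree_mult_eq degree_power_eq)
  qed
  ultimately show ?thesis using le[OF nz(1)] le[OF nz(2)] by linarith
qed

section \<open>The character sum of the curve with complex multiplication\<close>

text \<open>The degree of Frobenius plus \<open>P\<close> is one more than the number of finite poles of its first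
  coordinate, counted with multiplicity. These poles lie at the elements \<open>z\<close> of the prime
  field. Their multiplicity is 0 or 2 when \<open>f(z)\<close> is nonzero, according to the quadratic
  character of \<open>f(z)\<close>, and 1 when \<open>f(z) = 0\<close>.\<close>

lemma frobenius_neighbour_degree:
  fixes a b :: "'p::prime_card mod_ring" and F :: "'p mod_ring fls"
  assumes F: "F = cubic a b fls_X"
  assumes nz: "b \<noteq> 0" "(2::'p mod_ring) \<noteq> 0" and disc: "a\<^sup>2 \<noteq> 4 * b"
    and n: "CARD('p) = 2 * n + 1" "n > 0"
    and pt: "ell_pt F a b w (fls_X ^ CARD('p)) B"
    and e: "has_deg (add_P a F (fls_X ^ CARD('p)) B) e"
  obtains \<epsilon> where "\<epsilon> = 1 \<or> \<epsilon> = -1" "of_nat e = 1 - \<epsilon> * (\<Sum>z\<in>UNIV. poly (cubic_poly a b) z ^ n)"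
proof -
  let ?p = "CARD('p)" and ?A = "fls_X ^ CARD('p) :: 'p mod_ring fls"
  define f where "f = cubic_poly a b"
  have f0: "f \<noteq> 0" by (simp add: f_def cubic_poly_coeffs)
  have Ff: "F = rf f" by (simp add: F f_def rf_cubic_poly)
  have fp: "f ^ ?p = (pX ^ ?p) ^ 3 + [:a:] * (pX ^ ?p)\<^sup>2 + [:b:] * pX ^ ?p"
    unfolding f_def cubic_poly_def by (simp only: frobenius_poly_add power_mult_distrib const_poly_frobenius
        flip: power_mult) (simp only: mult.commute)
  have FB: "rf f * B\<^sup>2 = rf (f ^ ?p)"
  proof -
    have "cubic a b ?A = rf (f ^ ?p)" unfolding fp cubic_def by (simp only: rf_hom rf_pX)
    then show ?thesis using pt by (simp add: ell_pt_def Ff)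
  qed
  have "rf f * B\<^sup>2 = rf f * (rf (f ^ n))\<^sup>2"
    unfolding FB n(1) by (simp add: rf_hom power2_eq_square mult_2 power_add)
  then have "B\<^sup>2 = (rf (f ^ n))\<^sup>2" using f0 by simp
  then have "B = rf (f ^ n) \<or> B = - rf (f ^ n)" by (simp add: power2_eq_iff)
  \<comment> \<open>the second coordinate of the Frobenius point is \<open>f ^ n\<close>, up to the sign \<open>\<epsilon>\<close>\<close>
  then obtain \<epsilon> :: "'p mod_ring" where \<epsilon>: "\<epsilon> = 1 \<or> \<epsilon> = -1" and B: "B = rf ([:\<epsilon>:] * f ^ n)"
  proof
    assume "B = rf (f ^ n)" then show thesis using that[of 1] by (simp add: one_pCons[symmetric])
  next
    assume "B = - rf (f ^ n)" then show thesis using that[of "-1"] by (simp add: rf_minus)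
  qed
  have p1: "?p > 1" using n by simp
  have degA: "has_deg ?A ?p"
  proof -
    have "lowest_terms ?A (pX ^ ?p) 1" by (simp add: lowest_terms_def rf_hom)
    moreover have "degree (pX ^ ?p :: 'p mod_ring poly) = ?p" by (simp add: degree_power_eq)
    moreover have "degree (1 :: 'p mod_ring poly) < ?p" using p1 by simp
    ultimately show ?thesis unfolding has_deg_def by blast
  qed
  have AX: "?A \<noteq> fls_X"
    using has_deg_unique[OF degA, of 1] has_deg_X p1 by auto
  define W where "W = (pX ^ ?p - pX :: 'p mod_ring poly)"
  have W0: "W \<noteq> 0" using degree_artin_schreier[where ?'p='p] p1 by (auto simp: W_def)
  have rW: "rf W = ?A - fls_X" by (simp add: W_def rf_hom)
  have AX0: "?A - fls_X \<noteq> 0" using AX by simp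
  obtain N D N1 D1 N2 D2 where nb: "lowest_terms ?A N D" "lowest_terms (add_P a F ?A (-B)) N1 D1" "lowest_terms (add_P a F ?A B) N2 D2"
    "degree N = ?p" "degree D1 + degree D2 = 2 * degree (N - pX * D)" "degree N1 + degree N2 = 2 * ?p + 2"
    "degree D1 < degree N1" "degree D2 < degree N2" "D2 dvd (N - pX * D)\<^sup>2"
    using add_P_neighbours[OF F nz(2,1) disc pt degA AX] by blast
  have "rf (pX ^ ?p * D) = rf N" using nb(1) by (simp add: lowest_terms_def rf_hom)
  then have N: "N = pX ^ ?p * D" by simp
  have D: "D \<noteq> 0" "coprime N D" using nb(1) by (auto simp: lowest_terms_def)
  have uD: "is_unit D" using D(2) unfolding N by simp
  have V: "N - pX * D = W * D" by (simp add: N W_def algebra_simps)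
  have degV: "degree (N - pX * D) = ?p"
    unfolding V using W0 D uD degree_artin_schreier[where ?'p='p]
    by (simp add: degree_mult_eq W_def is_unit_iff_degree)
  have D2W: "D2 dvd W\<^sup>2"
  proof -
    have "is_unit (D\<^sup>2)" unfolding power2_eq_square using is_unit_mult_iff[of D D] uD by blast
    then show ?thesis using nb(9) unfolding V power_mult_distrib by (metis dvd_mult_unit_iff)
  qed
  have e2: "e = degree N2" using e nb(3) unfolding has_deg_def using lowest_terms_unique(1) by blast
  have degN2: "degree N2 = degree D2 + 1" using nb(5-8) degV by linarith
  \<comment> \<open>the numerator of the chord formula: the first coordinate of the sum is \<open>M / W\<^sup>2\<close> before
    reduction\<close>
  define M where "M = f * ([:\<epsilon>:] * f ^ n - 1)\<^sup>2 - ([:a:] + pX ^ ?p + pX) * W\<^sup>2"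
  have "rf (N2 * W\<^sup>2) = rf (D2 * M)"
  proof -
    have "rf (N2 * W\<^sup>2) = rf D2 * (add_P a F ?A B * (?A - fls_X)\<^sup>2)"
      using nb(3) unfolding rf_mult rf_power rW lowest_terms_def by (simp add: mult_ac)
    also have "add_P a F ?A B * (?A - fls_X)\<^sup>2 = F * (B - 1)\<^sup>2 - (fls_const a + ?A + fls_X) * (?A - fls_X)\<^sup>2"
      unfolding add_P_def using AX0 by (simp add: power_divide left_diff_distrib distrib_right)
    also have "\<dots> = rf M"
      unfolding M_def B Ff by (simp only: rf_hom rW[unfolded W_def] W_def rf_pX rf_1)
    finally show ?thesis by (simp only: rf_mult)
  qed
  then have NM: "N2 * W\<^sup>2 = D2 * M" by simp
  have D20: "D2 \<noteq> 0" and cp2: "coprime N2 D2" using nb(3) by (auto simp: lowest_terms_def)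
  have N20: "N2 \<noteq> 0" using nb(8) by auto
  have M0: "M \<noteq> 0" using NM N20 W0 by auto
  have ord: "order z N2 + 2 = order z D2 + order z M" for z
  proof -
    have "order z (N2 * (W * W)) = order z (D2 * M)" using NM by (simp add: power2_eq_square)
    then show ?thesis using N20 W0 D20 M0 order_artin_schreier[of z] by (simp add: order_mult W_def[symmetric])
  qed
  have cop: "order z D2 = 0 \<or> order z N2 = 0" for z
  proof (rule ccontr)
    assume "\<not> ?thesis"
    then have "[:- z, 1:] dvd N2" "[:- z, 1:] dvd D2" by (metis order_root poly_eq_0_iff_dvd)+
    then have "is_unit [:- z, 1:]" using cp2 coprime_common_divisor by blast
    then show False by (simp add: is_unit_iff_degree)
  qed
  have Wz: "poly W z = 0" for z by (simp add: W_def fermat_mod_ring)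
  have ppf: "poly f z ^ ?p = poly f z" for z by (rule fermat_mod_ring)
  \<comment> \<open>the multiplicity of the pole at \<open>z\<close> is 2 minus the order of \<open>M\<close>, and at least 0\<close>
  have main: "of_nat (order z D2) = 1 - \<epsilon> * poly f z ^ n" for z
  proof (cases "poly f z = 0")
    case True
    have "poly M z = 0" using True n by (simp add: M_def Wz)
    then have oM1: "order z M \<ge> 1" using M0 order_gt_0_iff[of M z] by simp
    \<comment> \<open>modulo \<open>(X - z)\<^sup>2\<close> the numerator \<open>M\<close> agrees with \<open>f\<close>, which has a simple root\<close>
    have "\<not> order z M \<ge> 2"
    proof
      assume "order z M \<ge> 2"
      then have "[:- z, 1:] ^ 2 dvd M" by (simp add: order_divides)
      then obtain k where k: "M = [:- z, 1:]\<^sup>2 * k" by blast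
      define q where "q = [:- z, 1:]"
      have "pderiv M = q * (2 * pderiv q * k + q * pderiv k)"
        unfolding k q_def[symmetric] by (simp add: pderiv_mult power2_eq_square algebra_simps)
      moreover have "poly q z = 0" by (simp add: q_def)
      ultimately have "poly (pderiv M) z = 0" by simp
      moreover have "poly (pderiv M) z = poly (pderiv f) z"
      proof -
        define h where "h = [:\<epsilon>:] * f ^ n - 1"
        have h: "poly h z = -1" using True n by (simp add: h_def)
        define u where "u = [:a:] + pX ^ ?p + pX"
        have "pderiv M = pderiv f * h\<^sup>2 + f * (2 * h * pderiv h) - (pderiv u * W\<^sup>2 + u * (2 * W * pderiv W))"
          unfolding M_def h_def[symmetric] u_def[symmetric]
          by (simp add: pderiv_mult pderiv_diff power2_eq_square algebra_simps)
        then show ?thesis using True h by (simp add: Wz)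
      qed
      ultimately have "[:- z, 1:] dvd pderiv f" "[:- z, 1:] dvd f" using True by (simp_all add: poly_eq_0_iff_dvd)
      then have "is_unit [:- z, 1:]"
        using cubic_poly_coprime_pderiv[OF nz(1) disc] unfolding f_def[symmetric] by (meson coprime_common_divisor)
      then show False by (simp add: is_unit_iff_degree)
    qed
    then have "order z M = 1" using oM1 by simp
    then have "order z D2 = 1" using ord[of z] cop[of z] by auto
    then show ?thesis using True n by simp
  next
    case False
    have "(poly f z ^ n)\<^sup>2 = 1"
    proof -
      have "poly f z * (poly f z ^ n)\<^sup>2 = poly f z * 1"
        using ppf[of z] unfolding n(1) by (simp add: power2_eq_square mult_2 power_add)
      then show ?thesis using False by simp
    qed
    then have "(\<epsilon> * poly f z ^ n)\<^sup>2 = 1" using \<epsilon> by (auto simp: power_mult_distrib)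
    then consider "\<epsilon> * poly f z ^ n = 1" | "\<epsilon> * poly f z ^ n = -1" by (auto simp: power2_eq_1_iff)
    then show ?thesis
    proof cases
      case 1
      have "[:- z, 1:] dvd [:\<epsilon>:] * f ^ n - 1" "[:- z, 1:] dvd W"
        using 1 Wz by (simp_all add: poly_eq_0_iff_dvd[symmetric])
      then have "[:- z, 1:]\<^sup>2 dvd M" unfolding M_def
        by (intro dvd_diff dvd_mult) (simp_all only: dvd_power_same)
      then have "order z M \<ge> 2" using M0 by (simp add: order_divides)
      then have "order z D2 = 0" using ord[of z] cop[of z] by auto
      then show ?thesis using 1 by simp
    next
      case 2
      have "poly M z = 4 * poly f z" using 2 by (simp add: M_def Wz power2_eq_square)
      moreover have "(4::'p mod_ring) \<noteq> 0" using nz(2) by (metis mult_eq_0_iff mult_2 numeral_Bit0)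
      ultimately have "order z M = 0" using False by (simp add: order_0I)
      then have "order z D2 = 2" using ord[of z] cop[of z] by auto
      then show ?thesis using 2 by simp
    qed
  qed
  have "of_nat (degree D2) = (of_nat (\<Sum>z\<in>UNIV. order z D2) :: 'p mod_ring)"
    using sum_order_eq_degree[of D2] D2W unfolding W_def by simp
  also have "\<dots> = (\<Sum>z\<in>UNIV. 1 - \<epsilon> * poly f z ^ n)" by (simp add: main)
  also have "\<dots> = - \<epsilon> * (\<Sum>z\<in>UNIV. poly f z ^ n)"
    by (simp add: sum_subtractf sum_distrib_left[symmetric])
  finally have "of_nat e = 1 - \<epsilon> * (\<Sum>z\<in>UNIV. poly f z ^ n)"
    unfolding e2 degN2 by simp
  then show thesis using that \<epsilon> unfolding f_def by blast
qed

text \<open>Let \<open>Q\<close> be \<open>y\<close> times the endomorphism of square \<open>-6\<close>. It acts on the invariant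
  differential by \<open>s y\<close>, and the square root \<open>s = - x / y\<close> of \<open>-6\<close> makes \<open>Q + x P\<close>
  inseparable. The primes 17 and 23 are excluded because the curve has additional
  automorphisms there.\<close>

lemma cm_trace:
  fixes r :: "'p::prime_card mod_ring" and x y :: nat
  assumes p: "CARD('p) = x\<^sup>2 + 6 * y\<^sup>2" and r: "r\<^sup>2 = 2"
    and big: "CARD('p) > 3" "CARD('p) \<noteq> 17" "CARD('p) \<noteq> 23"
    and n: "n = (CARD('p) - 1) div 2"
  shows "(\<Sum>z\<in>UNIV. poly (cubic_poly (6 * (2 + r)) 3) z ^ n)\<^sup>2 = 4 * of_nat x ^ 2"
proof -
  let ?p = "CARD('p)"
  define a where "a = 6 * (2 + r)"
  define F where "F = cubic a 3 (fls_X :: 'p mod_ring fls)"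
  have pp: "prime ?p" by (rule prime_card)
  have odd: "odd ?p" using pp big(1) prime_odd_nat by simp
  have pn: "?p = 2 * n + 1" and n0: "n > 0" using odd big by (auto simp: n elim!: oddE)
  have small: "of_nat k \<noteq> (0::'p mod_ring)" if "0 < k" "k < ?p" for k
    using that by (simp add: char_dvd_of_nat nat_dvd_not_less)
  have primenz: "of_nat k \<noteq> (0::'p mod_ring)" if "prime k" "k \<noteq> ?p" for k
    using that pp by (metis char_dvd_of_nat primes_dvd_imp_eq)
  have two: "(2::'p mod_ring) \<noteq> 0" and three: "(3::'p mod_ring) \<noteq> 0" using small[of 2] small[of 3] big by simp_all
  have n17: "(17::'p mod_ring) \<noteq> 0" using primenz[of 17] big by simp
  have n23: "(23::'p mod_ring) \<noteq> 0" using primenz[of 23] big by simp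
  have y1: "y \<ge> 1"
  proof (rule ccontr)
    assume "\<not> y \<ge> 1"
    then have "?p = x * x" using p by (simp add: power2_eq_square)
    then show False using pp by (metis prime_product nat_mult_1 not_prime_1)
  qed
  have x1: "x \<ge> 1"
  proof (rule ccontr)
    assume "\<not> x \<ge> 1"
    then have "?p = 2 * (3 * y\<^sup>2)" using p by simp
    then show False using odd by simp
  qed
  have xodd: "odd x" using odd p by simp
  have yp: "y + 1 < ?p" 
  proof -
    have "y \<le> y\<^sup>2" using y1 by (simp add: power2_eq_square)
    moreover have "x\<^sup>2 \<ge> 1" using x1 by simp
    ultimately show ?thesis using p y1 by linarith
  qed
  have xp: "x + 1 < ?p"
  proof -
    have "x \<le> x\<^sup>2" using x1 by (simp add: power2_eq_square)
    moreover have "y\<^sup>2 \<ge> 1" using y1 by simp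
    ultimately show ?thesis using p by linarith
  qed
  have y0: "of_nat y \<noteq> (0::'p mod_ring)" using small[of y] y1 yp by simp
  have x0: "of_nat x \<noteq> (0::'p mod_ring)" using small[of x] x1 xp by simp
  \<comment> \<open>this choice of the square root of \<open>-6\<close> makes \<open>s y + x\<close> vanish\<close>
  define s :: "'p mod_ring" where "s = - of_nat x / of_nat y"
  have xy: "(of_nat x)\<^sup>2 + 6 * (of_nat y)\<^sup>2 = (0::'p mod_ring)"
  proof -
    have "of_nat (x\<^sup>2 + 6 * y\<^sup>2) = (0::'p mod_ring)" unfolding p[symmetric] by (rule of_nat_card_eq_0)
    then show ?thesis by simp
  qed
  have s: "s\<^sup>2 = -6"
  proof -
    have "s\<^sup>2 * (of_nat y)\<^sup>2 = (of_nat x)\<^sup>2" using y0 by (simp add: s_def power_divide)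
    also have "\<dots> = -6 * (of_nat y)\<^sup>2" using xy by (simp add: eq_neg_iff_add_eq_0)
    finally have "s\<^sup>2 * (of_nat y)\<^sup>2 = -6 * (of_nat y)\<^sup>2" .
    moreover have "(of_nat y)\<^sup>2 \<noteq> (0::'p mod_ring)" using y0 by simp
    ultimately show ?thesis by (metis mult_right_cancel)
  qed
  have rr: "r * r = 2" using r by (simp add: power2_eq_square)
  then have rrz: "r * (r * z) = 2 * z" for z by (metis mult.assoc)
  have a2: "a\<^sup>2 = 216 + 144 * r" by (simp add: a_def power2_eq_square algebra_simps rr rrz)
  have nzprod: "u \<noteq> 0" if "u * v = w" "w \<noteq> 0" for u v w :: "'p mod_ring" using that by auto
  have a0: "a \<noteq> 0"
  proof (rule nzprod)
    show "a * (2 - r) = 2\<^sup>2 * 3" by (simp add: a_def algebra_simps rr rrz)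
  qed (rule no_zero_divisors power_not_zero two three)+
  have disc: "a\<^sup>2 \<noteq> 4 * 3"
  proof -
    have "a\<^sup>2 - 4 * 3 \<noteq> 0"
    proof (rule nzprod)
      show "(a\<^sup>2 - 4 * 3) * (17 - 12 * r) = 2\<^sup>2 * 3" unfolding a2 by (simp add: algebra_simps rr rrz)
    qed (rule no_zero_divisors power_not_zero two three)+
    then show ?thesis by simp
  qed
  \<comment> \<open>multiplying by the conjugate shows that the j-invariant is not 0, away from 17\<close>
  have j1: "a\<^sup>2 \<noteq> 3 * 3"
  proof -
    have "a\<^sup>2 - 3 * 3 \<noteq> 0"
    proof (rule nzprod)
      show "(a\<^sup>2 - 3 * 3) * (23 - 16 * r) = 3\<^sup>2 * 17" unfolding a2 by (simp add: algebra_simps rr rrz)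
    qed (rule no_zero_divisors power_not_zero n17 three)+
    then show ?thesis by simp
  qed
  \<comment> \<open>the same for the j-invariant 1728, away from 23\<close>
  have j2: "2 * a\<^sup>2 \<noteq> 9 * 3"
  proof -
    have "2 * a\<^sup>2 - 9 * 3 \<noteq> 0"
    proof (rule nzprod)
      show "(2 * a\<^sup>2 - 9 * 3) * (32 * r - 45) = 3\<^sup>2 * 23" unfolding a2 by (simp add: algebra_simps rr rrz)
    qed (rule no_zero_divisors power_not_zero n23 three)+
    then show ?thesis by simp
  qed
  have ym: "of_nat j \<noteq> (1::'p mod_ring) \<and> of_nat j \<noteq> (-1::'p mod_ring)" if j: "2 \<le> j" "j < y" for j
  proof -
    have "of_nat (j - 1) \<noteq> (0::'p mod_ring)" "of_nat (j + 1) \<noteq> (0::'p mod_ring)"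
      using small[of "j - 1"] small[of "j + 1"] j yp by simp_all
    then show ?thesis using j by (auto simp: of_nat_diff eq_neg_iff_add_eq_0 add.commute)
  qed
  obtain A' B' where AB': "ell_pt F a 3 (of_nat y) A' B'" "has_deg A' (y\<^sup>2)"
    using multiple_pt[OF F_def two three disc y1 ym] by blast
  obtain A B where AB: "ell_pt F a 3 (s * of_nat y) A B" "has_deg A (6 * y\<^sup>2)"
    using sqrt_minus_six[OF r s two three AB'[unfolded a_def]] unfolding a_def by blast
  have w: "s * of_nat y = - of_nat x" using y0 by (simp add: s_def)
  define P where "P = orbit a F A B"
  have A0: "A \<noteq> fls_X" using has_deg_unique[OF AB(2), of 1] has_deg_X y1 by auto
  obtain d' d1 where dd: "has_deg (add_P a F A (-B)) d'" "has_deg (add_P a F A B) d1" "d' + d1 = 2 * (6 * y\<^sup>2) + 2"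
    using add_P_degrees[OF F_def two three disc AB A0] by blast
  have pos: "d' \<ge> 1" "d1 \<ge> 1" using dd(1,2) unfolding has_deg_def by auto
  define c where "c = int (6 * y\<^sup>2) + 1 - int d'"
  \<comment> \<open>the degrees of \<open>Q - P\<close> and \<open>Q + P\<close> are positive and add up to \<open>12 y\<^sup>2 + 2\<close>\<close>
  have cb: "\<bar>c\<bar> < int ?p"
  proof -
    have "int d' \<ge> 1" "int d1 \<ge> 1" "int d' + int d1 = 12 * int (y\<^sup>2) + 2" using pos dd(3) by linarith+
    then have "\<bar>c\<bar> \<le> 6 * int (y\<^sup>2)" unfolding c_def by simp
    also have "\<dots> < int ?p"
    proof -
      have "x\<^sup>2 \<ge> 1" using x1 by simp
      then have "6 * y\<^sup>2 < ?p" using p by linarith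
      then show ?thesis by linarith
    qed
    finally show ?thesis .
  qed
  note oq = orbit_quadratic[OF F_def two three disc AB dd(1)]
  \<comment> \<open>for \<open>k < x - 1\<close> the differential excludes \<open>P\<close> and \<open>- P\<close>; for \<open>k = x - 1\<close> it does not
    exclude \<open>- P\<close>, but then the degree would be 1, whereas the quadratic formula gives an even
    number\<close>
  have avoid: "k < x \<Longrightarrow> fst (P k) \<noteq> fls_X" for k
  proof (induction k rule: less_induct)
    case (less k)
    then have m: "\<And>j. j < k \<Longrightarrow> fst (orbit a F A B j) \<noteq> fls_X" unfolding P_def by simp
    obtain dk where dk: "ell_pt F a 3 (s * of_nat y + of_nat k) (fst (P k)) (snd (P k))"
      "has_deg (fst (P k)) dk" "int dk = int k ^ 2 + c * int k + int (6 * y\<^sup>2)"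
      using oq[OF m, of k k] unfolding P_def c_def by blast
    have wk: "s * of_nat y + of_nat k = - of_nat (x - k)"
      using less.prems w by (simp add: of_nat_diff)
    have F0: "F \<noteq> 0" using F_nonzero[OF F_def two three disc] .
    show ?case
    proof (cases "k = x - 1")
      case False
      have "of_nat (x - k - 1) \<noteq> (0::'p mod_ring)" "of_nat (x - k + 1) \<noteq> (0::'p mod_ring)"
        using small[of "x - k - 1"] small[of "x - k + 1"] False less.prems xp by simp_all
      moreover have "of_nat (x - k - 1) = of_nat (x - k) - (1::'p mod_ring)"
        using False less.prems by (simp add: of_nat_diff)
      ultimately have "- of_nat (x - k) \<noteq> (1::'p mod_ring)" "- of_nat (x - k) \<noteq> (-1::'p mod_ring)"
        by (auto simp: neg_eq_iff_add_eq_0 add.commute)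
      then show ?thesis using pt_not_P[OF F_def F0 dk(1)] unfolding wk by blast
    next
      case True
      show ?thesis
      proof
        assume "fst (P k) = fls_X"
        then have "dk = 1" using dk(2) has_deg_unique[OF dk(2), of 1] has_deg_X by auto
        then have "1 = int k ^ 2 + c * int k + int (6 * y\<^sup>2)" using dk(3) by simp
        moreover have "even (int k)" using True xodd x1 by simp
        then have "even (int k ^ 2 + c * int k + int (6 * y\<^sup>2))" by simp
        ultimately show False by (metis odd_one)
      qed
    qed
  qed
  obtain dx where dx: "ell_pt F a 3 (s * of_nat y + of_nat x) (fst (P x)) (snd (P x))"
      "has_deg (fst (P x)) dx" "int dx = int x ^ 2 + c * int x + int (6 * y\<^sup>2)"
    using oq[of x x] avoid unfolding P_def c_def by blast
  have w0: "s * of_nat y + of_nat x = 0" using w by simp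
  have dxp: "int dx = int ?p + c * int x" using dx(3) p by simp
  \<comment> \<open>\<open>Q + x P\<close> is inseparable, so \<open>p\<close> divides its degree \<open>p + c x\<close>\<close>
  have pdx: "?p dvd dx"
  proof -
    obtain N D where r: "lowest_terms (fst (P x)) N D" and ND: "degree N = dx" "degree D < dx"
      using dx(2) unfolding has_deg_def by blast
    have "fls_deriv (fst (P x)) = 0" using dx(1) unfolding w0 by (simp add: ell_pt_def)
    then have "pderiv N = 0" using rat_deriv_zero[OF r] ND by auto
    moreover have "coeff N dx \<noteq> 0" using ND by (metis leading_coeff_0_iff degree_0 less_nat_zero_code)
    ultimately show ?thesis by (rule pderiv_zero_coeff)
  qed
  have c0: "c = 0"
  proof -
    have "int ?p dvd int dx" using pdx by (simp only: int_dvd_int_iff)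
    then have "int ?p dvd c * int x" unfolding dxp by (simp add: dvd_add_right_iff)
    moreover have "\<not> int ?p dvd int x" using x1 xp by (simp add: nat_dvd_not_less)
    moreover have "prime (int ?p)" using pp by simp
    ultimately have "int ?p dvd c" using prime_dvd_mult_iff by blast
    then show ?thesis using cb by (metis dvd_imp_le_int not_le abs_of_nat)
  qed
  have dxp': "dx = ?p" using dxp c0 by simp
  have Ax: "fst (P x) = fls_X ^ ?p"
    by (rule frobenius_image[OF F_def _ _ a0 three two three disc j1 j2])
       (use dx w0 dxp' in auto)
  have AxX: "fst (P x) \<noteq> fls_X" using has_deg_unique[OF dx(2), of 1] has_deg_X dxp' big(1) by auto
  have avoid': "k < Suc x \<Longrightarrow> fst (P k) \<noteq> fls_X" for k
    using avoid AxX less_Suc_eq by auto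
  obtain e where e: "has_deg (fst (P (Suc x))) e" "int e = int (Suc x) ^ 2 + c * int (Suc x) + int (6 * y\<^sup>2)"
    using oq[of "Suc x" "Suc x"] avoid' unfolding P_def c_def by blast
  have "e = ?p + 2 * x + 1"
  proof -
    have "int e = int (?p + 2 * x + 1)" unfolding e(2) c0 p by (simp add: power2_eq_square algebra_simps)
    then show ?thesis by simp
  qed
  then have e': "(of_nat e :: 'p mod_ring) = 2 * of_nat x + 1" by simp
  have "P (Suc x) = (add_P a F (fst (P x)) (snd (P x)), add_P_y a F (fst (P x)) (snd (P x)))"
    unfolding P_def by (simp add: case_prod_beta Let_def)
  then have eS: "has_deg (add_P a F (fls_X ^ ?p) (snd (P x))) e" using e(1) Ax by simp
  have ptx: "ell_pt F a 3 0 (fls_X ^ ?p) (snd (P x))" using dx(1) w0 Ax by simp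
  obtain \<epsilon> where \<epsilon>: "\<epsilon> = 1 \<or> \<epsilon> = -1" "of_nat e = 1 - \<epsilon> * (\<Sum>z\<in>UNIV. poly (cubic_poly a 3) z ^ n)"
    using frobenius_neighbour_degree[OF F_def three two disc pn n0 ptx eS] by blast
  have "(2 * of_nat x)\<^sup>2 = (\<epsilon> * (\<Sum>z\<in>UNIV. poly (cubic_poly a 3) z ^ n))\<^sup>2"
  proof -
    have "2 * of_nat x = - (\<epsilon> * (\<Sum>z\<in>UNIV. poly (cubic_poly a 3) z ^ n))" using \<epsilon>(2) e' by (simp add: algebra_simps eq_neg_iff_add_eq_0)
    then show ?thesis by simp
  qed
  also have "\<dots> = (\<Sum>z\<in>UNIV. poly (cubic_poly a 3) z ^ n)\<^sup>2" using \<epsilon>(1) by auto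
  finally show ?thesis unfolding a_def by (simp add: power_mult_distrib)
qed

section \<open>The recurrence of the Franel numbers\<close>

text \<open>The certificate of creative telescoping for the summand \<open>binom(n + 2, k) ^ 3\<close>, with
  denominators cleared.\<close>

lemma franel_certificate:
  fixes n k :: "'a::comm_ring_1"
  defines "Q \<equiv> (\<lambda>k. (-72 - 272 * n - 402 * n^2 - 290 * n^3 - 102 * n^4 - 14 * n^5)
     + (78 + 249 * n + 291 * n^2 + 147 * n^3 + 27 * n^4) * k
     + (-30 - 78 * n - 66 * n^2 - 18 * n^3) * k^2 + (4 + 8 * n + 4 * n^2) * k^3)"
  shows "(n + 2)^5 * (n + 1)^3 - (7 * n^2 + 21 * n + 16) * (n + 1)^3 * (n + 2 - k)^3
      - 8 * (n + 1)^2 * (n + 2 - k)^3 * (n + 1 - k)^3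
    = (n + 2 - k)^3 * Q (k + 1) - k^3 * Q k"
  unfolding Q_def by (simp add: algebra_simps eval_nat_numeral)

text \<open>Creative telescoping: the three shifted summands are rational multiples of
  \<open>binom(n + 2, k) ^ 3\<close>, and their combination is a difference in \<open>k\<close>.\<close>

lemma franel_recurrence_rat:
  fixes n :: nat
  shows "(of_nat n + 2)^2 * (of_nat (franel (n + 2)) :: rat)
    = (7 * of_nat n ^ 2 + 21 * of_nat n + 16) * of_nat (franel (n + 1)) + 8 * (of_nat n + 1)^2 * of_nat (franel n)"
proof -
  define N where "N = (of_nat n :: rat)"
  define T where "T = (\<lambda>k. of_nat ((n + 2) choose k) :: rat)"
  define Q where "Q = (\<lambda>k::rat. (-72 - 272 * N - 402 * N^2 - 290 * N^3 - 102 * N^4 - 14 * N^5)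
     + (78 + 249 * N + 291 * N^2 + 147 * N^3 + 27 * N^4) * k
     + (-30 - 78 * N - 66 * N^2 - 18 * N^3) * k^2 + (4 + 8 * N + 4 * N^2) * k^3)"
  define G where "G = (\<lambda>k. T k ^ 3 * of_nat k ^ 3 * Q (of_nat k))"
  have "N \<ge> 0" by (simp add: N_def)
  then have N2: "N + 2 \<noteq> 0" "N + 1 \<noteq> 0" by linarith+
  have down: "of_nat (Suc m) * of_nat (m choose k) = (of_nat (Suc m) - of_nat k) * (of_nat (Suc m choose k) :: rat)"
    if "k \<le> Suc m" for m k
  proof -
    have "Suc m * (m choose k) = (Suc m - k) * (Suc m choose k)"
      using binomial_absorb_comp[of "Suc m" k] by simp
    then have "of_nat (Suc m * (m choose k)) = (of_nat ((Suc m - k) * (Suc m choose k)) :: rat)" by simp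
    then show ?thesis using that by (simp only: of_nat_mult of_nat_diff)
  qed
  have T1: "(N + 2) * of_nat ((n + 1) choose k) = (N + 2 - of_nat k) * T k" if "k \<le> n + 2" for k
    using down[of k "n + 1"] that by (simp add: T_def N_def add_ac)
  have T0: "(N + 1) * of_nat (n choose k) = (N + 1 - of_nat k) * of_nat ((n + 1) choose k)" if "k \<le> n + 1" for k
    using down[of k n] that by (simp add: N_def add_ac)
  \<comment> \<open>the case \<open>k = n + 2\<close>, where both sides vanish, is needed to sum over a common range\<close>
  have T0': "(N + 1) * of_nat (n choose k) * (N + 2) = (N + 1 - of_nat k) * ((N + 2 - of_nat k) * T k)" if "k \<le> n + 2" for k
  proof (cases "k \<le> n + 1")
    case True
    have "(N + 1) * of_nat (n choose k) * (N + 2) = (N + 1 - of_nat k) * ((N + 2) * of_nat ((n + 1) choose k))"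
      unfolding T0[OF True] by (simp add: mult_ac)
    then show ?thesis unfolding T1[OF that] .
  next
    case False
    then have "k = n + 2" using that by simp
    then show ?thesis by (simp add: N_def)
  qed
  have up: "T (Suc k) * of_nat (Suc k) = (N + 2 - of_nat k) * T k" if "k \<le> n + 2" for k
  proof -
    have "Suc k * ((n + 2) choose Suc k) = (n + 2 - k) * ((n + 2) choose k)"
      by (simp only: binomial_absorption binomial_absorb_comp)
    then have "of_nat (Suc k * ((n + 2) choose Suc k)) = (of_nat ((n + 2 - k) * ((n + 2) choose k)) :: rat)" by simp
    then show ?thesis unfolding T_def N_def using that by (simp only: of_nat_mult of_nat_diff of_nat_add of_nat_numeral mult.commute)
  qed
  have tele: "T k ^ 3 * ((N + 2)^5 * (N + 1)^3) 
      - (7 * N^2 + 21 * N + 16) * (N + 1)^3 * ((N + 2) * of_nat ((n + 1) choose k))^3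
      - 8 * (N + 1)^2 * ((N + 1) * of_nat (n choose k) * (N + 2))^3 = G (Suc k) - G k"
    if "k \<le> n + 2" for k
  proof -
    have "G (Suc k) = (T (Suc k) * of_nat (Suc k)) ^ 3 * Q (of_nat k + 1)"
      by (simp add: G_def power_mult_distrib add.commute)
    also have "\<dots> = T k ^ 3 * ((N + 2 - of_nat k)^3 * Q (of_nat k + 1))"
      unfolding up[OF that] by (simp add: power_mult_distrib)
    finally have "G (Suc k) - G k = T k ^ 3 * ((N + 2 - of_nat k)^3 * Q (of_nat k + 1) - of_nat k ^ 3 * Q (of_nat k))"
      by (simp add: G_def algebra_simps)
    also have "\<dots> = T k ^ 3 * ((N + 2)^5 * (N + 1)^3 - (7 * N^2 + 21 * N + 16) * (N + 1)^3 * (N + 2 - of_nat k)^3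
      - 8 * (N + 1)^2 * (N + 2 - of_nat k)^3 * (N + 1 - of_nat k)^3)"
      unfolding Q_def franel_certificate[of N "of_nat k"] by simp
    also have "\<dots> = T k ^ 3 * ((N + 2)^5 * (N + 1)^3) 
      - (7 * N^2 + 21 * N + 16) * (N + 1)^3 * ((N + 2) * of_nat ((n + 1) choose k))^3
      - 8 * (N + 1)^2 * ((N + 1) * of_nat (n choose k) * (N + 2))^3"
      unfolding T1[OF that] T0'[OF that] power_mult_distrib by (simp add: algebra_simps)
    finally show ?thesis by simp
  qed
  have fr: "of_nat (franel m) = (\<Sum>k<n + 3. (of_nat (m choose k) :: rat)^3)" if "m \<le> n + 2" for m
  proof -
    have "franel m = (\<Sum>k<n + 3. (m choose k)^3)" unfolding franel_def
      by (rule sum.mono_neutral_left) (use that in \<open>auto simp: binomial_eq_0\<close>)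
    then show ?thesis by simp
  qed
  have "(\<Sum>k<n + 3. T k ^ 3 * ((N + 2)^5 * (N + 1)^3) 
      - (7 * N^2 + 21 * N + 16) * (N + 1)^3 * ((N + 2) * of_nat ((n + 1) choose k))^3
      - 8 * (N + 1)^2 * ((N + 1) * of_nat (n choose k) * (N + 2))^3) = (\<Sum>k<n + 3. G (Suc k) - G k)"
    by (rule sum.cong) (use tele in auto)
  also have "\<dots> = G (n + 3) - G 0" by (rule sum_lessThan_telescope)
  also have "\<dots> = 0" by (simp add: G_def T_def binomial_eq_0)
  finally have sum0: "(\<Sum>k<n + 3. T k ^ 3 * ((N + 2)^5 * (N + 1)^3)
      - (7 * N^2 + 21 * N + 16) * (N + 1)^3 * ((N + 2) * of_nat ((n + 1) choose k))^3
      - 8 * (N + 1)^2 * ((N + 1) * of_nat (n choose k) * (N + 2))^3) = 0" .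
  have lin: "(\<Sum>k\<in>A. x k ^ 3 * u - v * (w * y k)^3 - v' * (w' * z k * w)^3)
      = u * (\<Sum>k\<in>A. x k ^ 3) - v * w^3 * (\<Sum>k\<in>A. y k ^ 3) - v' * (w' * w)^3 * (\<Sum>k\<in>A. z k ^ 3)"
    for A :: "nat set" and x y z :: "nat \<Rightarrow> rat" and u v w v' w'
    by (simp add: sum_subtractf sum_distrib_left power_mult_distrib mult_ac)
  have "(N + 2)^5 * (N + 1)^3 * of_nat (franel (n + 2))
      - (7 * N^2 + 21 * N + 16) * (N + 1)^3 * (N + 2)^3 * of_nat (franel (n + 1))
      - 8 * (N + 1)^2 * ((N + 1) * (N + 2))^3 * of_nat (franel n) = 0"
    using sum0 unfolding lin T_def fr[OF le_refl] fr[OF add_le_mono[OF le_refl one_le_numeral]] fr[OF le_add1] .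
  moreover have "(N + 2)^5 = (N + 2)^3 * (N + 2)^2" by (simp flip: power_add)
  ultimately have "(N + 2)^3 * (N + 1)^3 * ((N + 2)^2 * of_nat (franel (n + 2)) - (7 * N^2 + 21 * N + 16) * of_nat (franel (n + 1))
      - 8 * (N + 1)^2 * of_nat (franel n)) = 0"
    by (simp only: power_mult_distrib right_diff_distrib mult_ac)
  then have "(N + 2)^2 * of_nat (franel (n + 2)) - (7 * N^2 + 21 * N + 16) * of_nat (franel (n + 1))
      - 8 * (N + 1)^2 * of_nat (franel n) = 0" using N2 by simp
  then show ?thesis unfolding N_def by (simp add: algebra_simps)
qed

lemma franel_recurrence:
  "(n + 2)^2 * franel (n + 2) = (7 * n^2 + 21 * n + 16) * franel (n + 1) + 8 * (n + 1)^2 * franel n"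
proof -
  have "of_nat ((n + 2)^2 * franel (n + 2)) = (of_nat ((7 * n^2 + 21 * n + 16) * franel (n + 1) + 8 * (n + 1)^2 * franel n) :: rat)"
    using franel_recurrence_rat[of n] by (simp add: add_ac)
  then show ?thesis by (simp only: of_nat_eq_iff)
qed

lemma franel_0 [simp]: "franel 0 = 1" and franel_1 [simp]: "franel (Suc 0) = 2"
  by (simp_all add: franel_def)

section \<open>The differential equation and its symmetric square\<close>

text \<open>The differential equation is \<open>theta (theta F) = ode_Q * F\<close> for the derivation \<open>theta\<close>. The
  leading coefficient is absorbed into the derivation, so that the equation has no term of
  first order and its symmetric square has the simple form of \<open>sym2_op\<close> below.\<close>

definition ode_P :: "'a::field poly" where "ode_P = [:0, 1, -7, -8:]"
definition ode_Q :: "'a::field poly" where "ode_Q = [:0, 2, -6, -72, -64:]"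
definition theta :: "'a::field poly \<Rightarrow> 'a poly" where "theta v = ode_P * pderiv v"

lemma coeff_theta_0 [simp]: "coeff (theta v) 0 = 0"
  by (simp add: theta_def ode_P_def coeff_mult)

lemma coeff_theta_Suc:
  "coeff (theta v) (Suc i) = of_nat (Suc i) * coeff v (Suc i) - 7 * of_nat i * coeff v i - 8 * (of_nat i - 1) * coeff (pCons 0 v) i"
proof -
  have "theta v = pCons 0 (pderiv v + pCons 0 (smult (-7) (pderiv v) + pCons 0 (smult (-8) (pderiv v))))"
    by (simp add: theta_def ode_P_def)
  then show ?thesis
    by (auto simp: coeff_pCons coeff_pderiv algebra_simps split: nat.splits)
qed

lemma coeff_theta_low:
  assumes "\<And>i. i < m \<Longrightarrow> coeff v i = 0"
  shows "i < m \<Longrightarrow> coeff (theta v) i = 0" and "coeff (theta v) m = of_nat m * coeff v m"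
proof -
  show "coeff (theta v) m = of_nat m * coeff v m"
    using assms by (cases m) (auto simp: coeff_theta_Suc coeff_pCons split: nat.splits)
  show "coeff (theta v) i = 0" if "i < m"
    using that assms by (cases i) (auto simp: coeff_theta_Suc coeff_pCons split: nat.splits)
qed

lemma coeff_theta_high:
  assumes "degree v \<le> M"
  shows "degree (theta v) \<le> M + 2" and "coeff (theta v) (M + 2) = - 8 * of_nat M * coeff v M"
proof -
  have z: "coeff v i = 0" if "i > M" for i using assms that by (simp add: coeff_eq_0)
  show "degree (theta v) \<le> M + 2"
  proof (rule degree_le, intro allI impI)
    fix i assume "M + 2 < i"
    then show "coeff (theta v) i = 0" using z
      by (cases i) (auto simp: coeff_theta_Suc coeff_pCons split: nat.splits)
  qed
  show "coeff (theta v) (M + 2) = - 8 * of_nat M * coeff v M"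
    using z[of "M + 1"] z[of "M + 2"] coeff_theta_Suc[of v "M + 1"] by (simp add: coeff_pCons)
qed

lemma coeff_mult_low:
  fixes R v :: "'a::comm_ring_1 poly"
  assumes "coeff R 0 = 0" "\<And>i. i < m \<Longrightarrow> coeff v i = 0"
  shows "coeff (R * v) m = 0"
  unfolding coeff_mult
proof (rule sum.neutral, intro ballI)
  fix i assume "i \<in> {..m}"
  then show "coeff R i * coeff v (m - i) = 0" using assms by (cases "i = 0") auto
qed

lemma coeff_mult_high:
  fixes R v :: "'a::comm_ring_1 poly"
  assumes "degree R \<le> a" "degree v \<le> b"
  shows "coeff (R * v) (a + b) = coeff R a * coeff v b"
proof -
  have "coeff (R * v) (a + b) = (\<Sum>i\<le>a + b. if i = a then coeff R a * coeff v b else 0)"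
    unfolding coeff_mult
  proof (rule sum.cong)
    fix i assume "i \<in> {..a + b}"
    then show "coeff R i * coeff v (a + b - i) = (if i = a then coeff R a * coeff v b else 0)"
      using assms by (cases i a rule: linorder_cases) (auto simp: coeff_eq_0)
  qed simp
  then show ?thesis by simp
qed

definition sym2_op :: "'a::field poly \<Rightarrow> 'a poly" where
  "sym2_op v = theta (theta (theta v)) - 4 * ode_Q * theta v - 2 * theta ode_Q * v"

lemma sym2_op_low:
  assumes "\<And>i. i < m \<Longrightarrow> coeff v i = 0"
  shows "coeff (sym2_op v) m = of_nat m ^ 3 * coeff v m"
proof -
  note 1 = coeff_theta_low[OF assms]
  note 2 = coeff_theta_low[OF 1(1)]
  note 3 = coeff_theta_low[OF 2(1)]
  have "coeff (4 * ode_Q * theta v) m = 0"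
    by (rule coeff_mult_low[OF _ 1(1)]) (simp_all add: ode_Q_def numeral_mult_conv_smult)
  moreover have "coeff (2 * theta ode_Q * v) m = 0"
    by (rule coeff_mult_low[OF _ assms]) (simp_all add: numeral_mult_conv_smult)
  ultimately show ?thesis unfolding sym2_op_def using 1(2) 2(2) 3(2) by (simp add: power3_eq_cube)
qed

text \<open>The symmetric square has the triple exponent \<open>- 2\<close> at infinity; \<open>sym2_op_low\<close> says that
  its exponent at 0 is 0, also triple.\<close>

lemma sym2_op_high:
  assumes "degree v \<le> M"
  shows "coeff (sym2_op v) (M + 6) = - 512 * (of_nat M + 2) ^ 3 * coeff v M"
proof -
  note 1 = coeff_theta_high[OF assms]
  note 2 = coeff_theta_high[OF 1(1)]
  note 3 = coeff_theta_high[OF 2(1)]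
  have e4: "4 * ode_Q = ([:0, 8, -24, -288, -256:] :: 'a poly)"
    by (simp add: ode_Q_def numeral_poly)
  have e2: "2 * theta ode_Q = ([:0, 4, -52, -296, 2704, 7040, 4096:] :: 'a poly)"
    by (simp add: theta_def ode_Q_def ode_P_def pderiv_pCons numeral_poly)
  have 4: "coeff (4 * ode_Q * theta v) (4 + (M + 2)) = coeff (4 * ode_Q) 4 * coeff (theta v) (M + 2)"
    by (rule coeff_mult_high[OF _ 1(1)]) (simp add: e4)
  have 5: "coeff (2 * theta ode_Q * v) (6 + M) = coeff (2 * theta ode_Q) 6 * coeff v M"
    by (rule coeff_mult_high[OF _ assms]) (simp add: e2)
  have Q: "coeff (2 * theta ode_Q :: 'a poly) 6 = 4096" and Q4: "coeff (4 * ode_Q :: 'a poly) 4 = - 256"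
    by (simp_all add: e2 e4 eval_nat_numeral)
  have n: "M + 2 + 2 + 2 = M + 6" "4 + (M + 2) = M + 6" "6 + M = M + 6" by simp_all
  have "coeff (theta (theta (theta v))) (M + 6) = - 8 * of_nat (M + 2 + 2) * (- 8 * of_nat (M + 2) * (- 8 * of_nat M * coeff v M))"
    unfolding n(1)[symmetric] 3(2) 2(2) 1(2) ..
  moreover have "coeff (4 * ode_Q * theta v) (M + 6) = - 256 * (- 8 * of_nat M * coeff v M)"
    using 4 unfolding n Q4 1(2) .
  moreover have "coeff (2 * theta ode_Q * v) (M + 6) = 4096 * coeff v M"
    using 5 unfolding n Q .
  ultimately show ?thesis unfolding sym2_op_def coeff_diff
    by (simp add: algebra_simps power3_eq_cube)
qed

lemma least_coeff:
  assumes "v \<noteq> 0"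
  obtains m where "coeff v m \<noteq> 0" "\<And>i. i < m \<Longrightarrow> coeff v i = 0"
proof -
  have ex: "\<exists>m. coeff v m \<noteq> 0" using assms by (metis coeff_0 poly_eqI)
  show thesis
    using that[of "LEAST m. coeff v m \<noteq> 0"] LeastI_ex[OF ex] not_less_Least by blast
qed

text \<open>The lowest index of a nonzero coefficient is divisible by \<open>p\<close>, and the degree is congruent
  to \<open>- 2\<close> modulo \<open>p\<close>. Up to degree \<open>2 p - 2\<close> the lowest index is 0, or the degree is
  \<open>2 p - 2\<close>. The two remaining coefficients therefore determine a solution.\<close>

lemma sym2_op_unique:
  fixes D :: "'p::prime_card mod_ring poly"
  assumes L: "sym2_op D = 0" and deg: "degree D \<le> 2 * CARD('p) - 2" and two: "(2::'p mod_ring) \<noteq> 0"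
    and c0: "coeff D 0 = 0" and ct: "coeff D (2 * CARD('p) - 2) = 0"
  shows "D = 0"
proof (rule ccontr)
  assume D: "D \<noteq> 0"
  let ?M = "degree D"
  have "(512::'p mod_ring) = 2 ^ 9" by simp
  then have n512: "(512::'p mod_ring) \<noteq> 0" using two by (metis power_not_zero)
  have "- 512 * (of_nat ?M + 2) ^ 3 * coeff D ?M = 0" using sym2_op_high[of D ?M] L by simp
  then have "of_nat (?M + 2) = (0 :: 'p mod_ring)" using n512 D by (simp add: add.commute)
  then have pM: "CARD('p) dvd ?M + 2" by (simp only: char_dvd_of_nat)
  obtain m where m: "coeff D m \<noteq> 0" "\<And>i. i < m \<Longrightarrow> coeff D i = 0" using least_coeff[OF D] by blast
  have "of_nat m ^ 3 * coeff D m = 0" using sym2_op_low[OF m(2)] L by simp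
  then have "of_nat m = (0 :: 'p mod_ring)" using m(1) by simp
  then have "CARD('p) dvd m" by (simp only: char_dvd_of_nat)
  moreover have "m \<noteq> 0" using m(1) c0 by metis
  ultimately have "CARD('p) \<le> m" by (simp add: dvd_imp_le)
  also have "m \<le> ?M" using m(1) by (rule le_degree)
  finally have le: "CARD('p) \<le> ?M" .
  obtain j where j: "?M + 2 = CARD('p) * j" using pM by blast
  have p2: "CARD('p) \<ge> 2" using prime_ge_2_nat[OF prime_card[where ?'a='p]] .
  have "CARD('p) * 1 < CARD('p) * j" "CARD('p) * j \<le> CARD('p) * 2" using le j deg p2 by linarith+
  then have "j = 2" by simp
  then have "?M = 2 * CARD('p) - 2" using j by simp
  then show False using ct D by (metis leading_coeff_0_iff)
qed

lemma second_order_unique: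
  fixes D :: "'p::prime_card mod_ring poly"
  assumes L: "theta (theta D) = ode_Q * D" and deg: "degree D < CARD('p)" and c0: "coeff D 0 = 0"
  shows "D = 0"
proof (rule ccontr)
  assume D: "D \<noteq> 0"
  obtain m where m: "coeff D m \<noteq> 0" "\<And>i. i < m \<Longrightarrow> coeff D i = 0" using least_coeff[OF D] by blast
  note 1 = coeff_theta_low[OF m(2)]
  note 2 = coeff_theta_low[OF 1(1)]
  have "coeff (ode_Q * D) m = 0" by (rule coeff_mult_low[OF _ m(2)]) (simp_all add: ode_Q_def)
  then have "of_nat m * (of_nat m * coeff D m) = 0" using 1(2) 2(2) L by simp
  then have "of_nat m = (0 :: 'p mod_ring)" using m(1) by simp
  then have "CARD('p) dvd m" by (simp only: char_dvd_of_nat)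
  moreover have "m \<noteq> 0" using m(1) c0 by metis
  ultimately have "CARD('p) \<le> m" by (simp add: dvd_imp_le)
  also have "m \<le> degree D" using m(1) by (rule le_degree)
  finally show False using deg by simp
qed

definition franel_poly :: "'p::prime_card mod_ring poly" where
  "franel_poly = (\<Sum>k<CARD('p). monom (of_nat (franel k)) k)"

lemma coeff_franel_poly: "coeff (franel_poly :: 'p::prime_card mod_ring poly) i = (if i < CARD('p) then of_nat (franel i) else 0)"
  unfolding franel_poly_def by (simp add: coeff_sum)

lemma degree_franel_poly: "degree (franel_poly :: 'p::prime_card mod_ring poly) < CARD('p)"
proof -
  have "degree (franel_poly :: 'p mod_ring poly) \<le> CARD('p) - 1"
    by (rule degree_le) (auto simp: coeff_franel_poly)
  moreover have "CARD('p) > 0" by simp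
  ultimately show ?thesis by linarith
qed

lemma poly_franel_poly: "poly franel_poly t = (\<Sum>k<CARD('p). of_nat (franel k) * t ^ k)" for t :: "'p::prime_card mod_ring"
  unfolding franel_poly_def by (simp add: poly_sum poly_monom)

text \<open>The recurrence survives the truncation because its leading factor vanishes modulo \<open>p\<close> at
  the index \<open>p\<close>, and its trailing factor vanishes at the index \<open>p + 1\<close>.\<close>

lemma franel_poly_recurrence:
  fixes i :: nat
  shows "(of_nat i + 1)^2 * coeff franel_poly (Suc i) = (7 * of_nat i ^ 2 + 7 * of_nat i + 2) * coeff franel_poly i
    + 8 * of_nat i ^ 2 * coeff (pCons 0 (franel_poly :: 'p::prime_card mod_ring poly)) i"
proof -
  let ?p = "CARD('p)"
  have p2: "?p \<ge> 2" using prime_ge_2_nat[OF prime_card[where ?'a='p]] .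
  have rec: "(of_nat i + 1)^2 * of_nat (franel (Suc i)) = (7 * of_nat i ^ 2 + 7 * of_nat i + 2) * of_nat (franel i)
    + 8 * of_nat i ^ 2 * (of_nat (franel (i - 1)) :: 'p mod_ring)" if i0: "i > 0" for i
  proof -
    obtain n where i: "i = n + 1" using i0 by (cases i) auto
    have "of_nat ((n + 2)^2 * franel (n + 2)) = (of_nat ((7 * n^2 + 21 * n + 16) * franel (n + 1) + 8 * (n + 1)^2 * franel n) :: 'p mod_ring)"
      unfolding franel_recurrence ..
    then have "(of_nat n + 2)^2 * of_nat (franel (n + 2)) = (7 * of_nat n^2 + 21 * of_nat n + 16) * of_nat (franel (n + 1))
        + 8 * (of_nat n + 1)^2 * (of_nat (franel n) :: 'p mod_ring)" by (simp add: add_ac)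
    moreover have "7 * (of_nat n + 1)^2 + 7 * (of_nat n + 1) + 2 = (7 * of_nat n^2 + 21 * of_nat n + 16 :: 'p mod_ring)"
      by (simp add: algebra_simps power2_eq_square)
    ultimately show ?thesis by (simp add: i add_ac)
  qed
  show ?thesis
  proof (cases "i = 0")
    case True then show ?thesis using p2 by (simp add: coeff_franel_poly)
  next
    case False
    then obtain j where j: "i = Suc j" by (metis not0_implies_Suc)
    consider "Suc i < ?p" | "Suc i = ?p" | "i = ?p" | "i > ?p" by linarith
    then show ?thesis
    proof cases
      case 1 then show ?thesis using rec[of i] j by (simp add: coeff_franel_poly)
    next
      case 2
      have "of_nat (Suc i) = (0 :: 'p mod_ring)" unfolding 2 by simp
      then have z: "of_nat i + 1 = (0 :: 'p mod_ring)" by (simp add: add.commute)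
      then show ?thesis using rec[of i] j 2 by (simp add: coeff_franel_poly)
    next
      case 3
      then have "of_nat i = (0 :: 'p mod_ring)" by simp
      then show ?thesis using 3 by (simp add: coeff_franel_poly)
    next
      case 4 then show ?thesis using j by (simp add: coeff_franel_poly)
    qed
  qed
qed

lemma franel_poly_ode: "theta (theta franel_poly) = ode_Q * (franel_poly :: 'p::prime_card mod_ring poly)"
proof -
  have "pderiv (theta franel_poly) = [:2, 8:] * (franel_poly :: 'p mod_ring poly)"
  proof (rule poly_eqI)
    fix i
    have "coeff (pderiv (theta (franel_poly :: 'p mod_ring poly))) i = of_nat (Suc i) * coeff (theta franel_poly) (Suc i)" by (rule coeff_pderiv)
    also have "\<dots> = (of_nat i + 1)^2 * coeff franel_poly (Suc i) - 7 * (of_nat i ^ 2 + of_nat i) * coeff franel_poly i - 8 * (of_nat i ^ 2 - 1) * coeff (pCons 0 franel_poly) i"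
      unfolding coeff_theta_Suc by (simp add: algebra_simps power2_eq_square)
    also have "\<dots> = 2 * coeff franel_poly i + 8 * coeff (pCons 0 franel_poly) i"
      unfolding franel_poly_recurrence by (simp add: algebra_simps power2_eq_square)
    also have "\<dots> = coeff ([:2, 8:] * franel_poly) i" by (simp add: coeff_pCons split: nat.split)
    finally show "coeff (pderiv (theta (franel_poly :: 'p mod_ring poly))) i = coeff ([:2, 8:] * franel_poly) i" .
  qed
  then have "theta (theta franel_poly) = ode_P * [:2, 8:] * (franel_poly :: 'p mod_ring poly)" unfolding theta_def[of "theta franel_poly"] by (simp only: mult.assoc)
  also have "ode_P * [:2, 8:] = (ode_Q :: 'p mod_ring poly)" by (simp add: ode_P_def ode_Q_def)
  finally show ?thesis .
qed

section \<open>The operators on Laurent series and the Clausen identity modulo p\<close>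

definition fls_theta :: "'a::field fls \<Rightarrow> 'a fls" where "fls_theta v = rf ode_P * fls_deriv v"

lemma rf_theta: "rf (theta v) = fls_theta (rf v)"
  by (simp add: theta_def fls_theta_def rf_mult fls_deriv_rf)

lemma fls_theta_hom: "fls_theta (u + v) = fls_theta u + fls_theta v" "fls_theta (u - v) = fls_theta u - fls_theta v"
  "fls_theta (u * v) = fls_theta u * v + u * fls_theta v"
  by (simp_all add: fls_theta_def algebra_simps)

lemma fls_theta_numeral [simp]: "fls_theta (numeral k) = 0" and fls_theta_const [simp]: "fls_theta (fls_const c) = 0" and fls_theta_0 [simp]: "fls_theta 0 = 0"
  by (simp_all add: fls_theta_def)

lemma fls_theta_sum: "fls_theta (\<Sum>k\<in>A. v k) = (\<Sum>k\<in>A. fls_theta (v k))"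
  by (induction A rule: infinite_finite_induct) (simp_all add: fls_theta_hom)

definition fls_sym2_op :: "'a::field fls \<Rightarrow> 'a fls" where
  "fls_sym2_op v = fls_theta (fls_theta (fls_theta v)) - 4 * rf ode_Q * fls_theta v - 2 * fls_theta (rf ode_Q) * v"

lemma rf_sym2_op: "rf (sym2_op v) = fls_sym2_op (rf v)"
  unfolding sym2_op_def fls_sym2_op_def by (simp add: rf_hom rf_theta)

lemma fls_sym2_op_sum: "fls_sym2_op (\<Sum>k\<in>A. v k) = (\<Sum>k\<in>A. fls_sym2_op (v k))"
  unfolding fls_sym2_op_def fls_theta_sum by (simp add: sum_subtractf sum_distrib_left)

lemma fls_sym2_op_const: "fls_sym2_op (fls_const c * v) = fls_const c * fls_sym2_op v"
  unfolding fls_sym2_op_def by (simp add: fls_theta_hom algebra_simps)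

lemma fls_sym2_op_scale: "fls_theta u = 0 \<Longrightarrow> fls_sym2_op (u * v) = u * fls_sym2_op v"
  unfolding fls_sym2_op_def by (simp add: fls_theta_hom algebra_simps)

text \<open>The defining property of the symmetric square: it annihilates the squares of the
  solutions.\<close>

lemma symmetric_square:
  assumes "fls_theta (fls_theta \<phi>) = rf ode_Q * \<phi>"
  shows "fls_sym2_op (\<phi>\<^sup>2) = 0"
  unfolding fls_sym2_op_def power2_eq_square by (simp add: fls_theta_hom assms algebra_simps)

text \<open>The argument of Clausen's identity is \<open>x = P / c\<^sup>2\<close> with this denominator \<open>c\<close> and
  \<open>P = t (1 + t) (1 - 8 t)\<close>.\<close>

definition clausen_c :: "'a::field poly" where "clausen_c = [:1, 0, 8:]"

lemma fls_polys:
  "rf ode_P = fls_X - 7 * fls_X\<^sup>2 - 8 * (fls_X ^ 3 :: 'a::field fls)"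
  "rf ode_Q = 2 * fls_X - 6 * fls_X\<^sup>2 - 72 * fls_X ^ 3 - 64 * (fls_X ^ 4 :: 'a::field fls)"
  "rf clausen_c = 1 + 8 * (fls_X\<^sup>2 :: 'a::field fls)"
proof -
  have "ode_P = pX - 7 * pX\<^sup>2 - 8 * (pX ^ 3 :: 'a poly)" "ode_Q = 2 * pX - 6 * pX\<^sup>2 - 72 * pX ^ 3 - 64 * (pX ^ 4 :: 'a poly)"
    "clausen_c = 1 + 8 * (pX\<^sup>2 :: 'a poly)"
    by (simp_all add: ode_P_def ode_Q_def clausen_c_def pX_def numeral_poly eval_nat_numeral one_pCons)
  note * = this
  show "rf ode_P = fls_X - 7 * fls_X\<^sup>2 - 8 * (fls_X ^ 3 :: 'a::field fls)"
    by (subst *(1)) (simp only: rf_hom rf_pX rf_1)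
  show "rf ode_Q = 2 * fls_X - 6 * fls_X\<^sup>2 - 72 * fls_X ^ 3 - 64 * (fls_X ^ 4 :: 'a::field fls)"
    by (subst *(2)) (simp only: rf_hom rf_pX rf_1)
  show "rf clausen_c = 1 + 8 * (fls_X\<^sup>2 :: 'a::field fls)"
    by (subst *(3)) (simp only: rf_hom rf_pX rf_1)
qed

text \<open>Every derivative of \<open>x ^ k / c\<close> is a multiple of \<open>x ^ k / c\<close>. The cofactors \<open>M\<close> and \<open>N\<close> of
  the first two derivatives are polynomials in \<open>t\<close> and \<open>k\<close> after clearing powers of \<open>c\<close>;
  this identity is the resulting value of the operator.\<close>

lemma clausen_certificate:
  fixes t k :: "'a::comm_ring_1"
  defines "c \<equiv> 1 + 8 * t^2" and "P \<equiv> t - 7 * t^2 - 8 * t^3"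
    and "W \<equiv> 1 - 14 * t - 48 * t^2 + 112 * t^3 + 64 * t^4"
    and "Q \<equiv> 2 * t - 6 * t^2 - 72 * t^3 - 64 * t^4"
  assumes P': "P' = 1 - 14 * t - 24 * t^2" and Q': "Q' = 2 - 12 * t - 216 * t^2 - 256 * t^3"
    and M: "M = k * W - 16 * t * P"
    and M': "M' = k * (-14 - 96 * t + 336 * t^2 + 256 * t^3) - 32 * t + 336 * t^2 + 512 * t^3"
    and M'': "M'' = k * (-96 + 672 * t + 768 * t^2) - 32 + 672 * t + 1536 * t^2"
    and N: "N = M * M + P * (M' * c - 16 * t * M)"
    and N': "N' = 2 * M * M' + P' * (M' * c - 16 * t * M) + P * (M'' * c - 16 * M)"
  shows "N * M + P * (N' * c - 32 * t * N) - 4 * Q * c^2 * M - 2 * (P * Q') * c^3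
    = W * (c^4 * k^3 - 2 * P * c^2 * ((2 * k + 1) * (7 * k^2 + 7 * k + 2))
        - 32 * P^2 * ((2 * k + 1) * (2 * k + 3) * (k + 1)))"
  unfolding N N' M M' M'' P' Q' c_def P_def W_def Q_def
  by (simp add: algebra_simps eval_nat_numeral)

text \<open>The coefficient of each power of \<open>x\<close> collects contributions of three consecutive indices,
  which cancel by the recurrence.\<close>

lemma telescoping_recurrence:
  fixes u K A B :: "nat \<Rightarrow> 'a::comm_ring_1"
  assumes K0: "K 0 = 0"
    and rec: "\<And>k. K (Suc k) * u (Suc k) = A k * u k + (case k of 0 \<Rightarrow> 0 | Suc j \<Rightarrow> B j * u j)"
    and z: "\<And>k. k \<ge> m \<Longrightarrow> u k = 0"
  shows "(\<Sum>k<m. u k * x ^ k * (K k - x * A k - x\<^sup>2 * B k)) = 0"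
proof -
  have "(\<Sum>k<Suc n. u k * x ^ k * (K k - x * A k - x\<^sup>2 * B k))
      = - (x ^ Suc n * (K (Suc n) * u (Suc n))) - x ^ (n + 2) * (B n * u n)" for n
  proof (induction n)
    case 0
    then show ?case using rec[of 0] K0 by (simp add: algebra_simps power2_eq_square)
  next
    case (Suc n)
    show ?case unfolding sum.lessThan_Suc[of _ "Suc n"] Suc.IH using rec[of "Suc n"]
      by (simp add: algebra_simps power2_eq_square)
  qed
  from this[of m] have "(\<Sum>k<Suc m. u k * x ^ k * (K k - x * A k - x\<^sup>2 * B k)) = 0" by (simp add: z)
  then show ?thesis by (simp add: z)
qed

lemma central_binomial_Suc: "(k + 1) * ((2 * (k + 1)) choose (k + 1)) = 2 * (2 * k + 1) * ((2 * k) choose k)"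
proof -
  have 1: "(k + 1) * ((2 * k + 2) choose (k + 1)) = (2 * k + 2) * ((2 * k + 1) choose k)"
    using Suc_times_binomial_eq[of "2 * k + 1" k] by (simp add: mult.commute)
  have 2: "(k + 1) * ((2 * k + 1) choose (k + 1)) = (2 * k + 1) * ((2 * k) choose k)"
    using Suc_times_binomial_eq[of "2 * k" k] by (simp add: mult.commute)
  have 3: "(2 * k + 1) choose (k + 1) = (2 * k + 1) choose k"
    using binomial_symmetric[of k "2 * k + 1"] by simp
  have "(k + 1) * ((k + 1) * ((2 * k + 2) choose (k + 1))) = (k + 1) * (2 * (2 * k + 1) * ((2 * k) choose k))"
  proof -
    have gen: "m * ((2 * m) * a) = m * (2 * n * c)" if "m * a = n * c" for m a n c :: nat
    proof -
      have "m * ((2 * m) * a) = 2 * m * (m * a)" by simp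
      also have "\<dots> = 2 * m * (n * c)" by (simp only: that)
      also have "\<dots> = m * (2 * n * c)" by simp
      finally show ?thesis .
    qed
    have "2 * k + 2 = 2 * (k + 1)" by simp
    then show ?thesis unfolding 1 using gen[OF 2[unfolded 3]] by simp
  qed
  then have "(k + 1) * ((2 * k + 2) choose (k + 1)) = 2 * (2 * k + 1) * ((2 * k) choose k)"
    by (metis Suc_eq_plus1 mult_left_cancel nat.distinct(1))
  then show ?thesis by simp
qed

definition franel_term :: "nat \<Rightarrow> nat" where "franel_term k = ((2 * k) choose k) * franel k"

lemma franel_term_recurrence:
  "(k + 2) ^ 3 * franel_term (k + 2) = 2 * (2 * k + 3) * (7 * k^2 + 21 * k + 16) * franel_term (k + 1)
     + 32 * (2 * k + 1) * (2 * k + 3) * (k + 1) * franel_term k"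
proof -
  have c2: "(k + 2) * ((2 * (k + 2)) choose (k + 2)) = 2 * (2 * k + 3) * ((2 * (k + 1)) choose (k + 1))"
    using central_binomial_Suc[of "k + 1"] by (simp add: algebra_simps)
  have "(k + 2) ^ 3 * franel_term (k + 2) = ((k + 2) * ((2 * (k + 2)) choose (k + 2))) * ((k + 2)^2 * franel (k + 2))"
    by (simp only: franel_term_def power3_eq_cube power2_eq_square mult_ac)
  also have "\<dots> = 2 * (2 * k + 3) * ((2 * (k + 1)) choose (k + 1)) * ((7 * k^2 + 21 * k + 16) * franel (k + 1) + 8 * (k + 1)^2 * franel k)"
    unfolding c2 franel_recurrence ..
  also have "\<dots> = 2 * (2 * k + 3) * (7 * k^2 + 21 * k + 16) * (((2 * (k + 1)) choose (k + 1)) * franel (k + 1))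
     + 8 * (2 * (2 * k + 3)) * (k + 1) * ((k + 1) * ((2 * (k + 1)) choose (k + 1))) * franel k"
  proof -
    have "s * c * (A * f1 + 8 * m^2 * f0) = s * A * (c * f1) + 8 * s * m * (m * c) * f0" for s c A f1 m f0 :: nat
      by (simp add: algebra_simps power2_eq_square)
    then show ?thesis .
  qed
  also have "\<dots> = 2 * (2 * k + 3) * (7 * k^2 + 21 * k + 16) * franel_term (k + 1)
     + 32 * (2 * k + 1) * (2 * k + 3) * (k + 1) * franel_term k"
  proof -
    have gen: "8 * (2 * s) * m * (2 * v * c) * f = 32 * v * s * m * (c * f)" for s m v c f :: nat by simp
    show ?thesis unfolding central_binomial_Suc franel_term_def by (simp only: gen)
  qed
  finally show ?thesis .
qed

text \<open>The truncation makes the recurrence hold for all indices in characteristic \<open>p\<close>.\<close>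

definition truncated_term :: "nat \<Rightarrow> 'p::prime_card mod_ring" where
  "truncated_term k = (if k < CARD('p) then of_nat (franel_term k) else 0)"

lemma truncated_term_recurrence:
  fixes k :: nat
  shows "of_nat (Suc k) ^ 3 * (truncated_term (Suc k) :: 'p::prime_card mod_ring)
    = 2 * ((2 * of_nat k + 1) * (7 * of_nat k ^ 2 + 7 * of_nat k + 2)) * truncated_term k
     + (case k of 0 \<Rightarrow> 0 | Suc j \<Rightarrow> 32 * ((2 * of_nat j + 1) * (2 * of_nat j + 3) * (of_nat j + 1)) * truncated_term j)"
proof -
  let ?p = "CARD('p)"
  have p2: "?p \<ge> 2" using prime_ge_2_nat[OF prime_card[where ?'a='p]] .
  show ?thesis
  proof (cases k)
    case 0
    have "franel_term 0 = 1" "franel_term 1 = 4" by (simp_all add: franel_term_def)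
    then show ?thesis using 0 p2 by (simp add: truncated_term_def)
  next
    case (Suc j)
    have "of_nat ((j + 2) ^ 3 * franel_term (j + 2)) = (of_nat (2 * (2 * j + 3) * (7 * j^2 + 21 * j + 16) * franel_term (j + 1)
     + 32 * (2 * j + 1) * (2 * j + 3) * (j + 1) * franel_term j) :: 'p mod_ring)" unfolding franel_term_recurrence ..
    then have base: "(of_nat j + 2) ^ 3 * of_nat (franel_term (j + 2)) = 2 * (2 * of_nat j + 3) * (7 * of_nat j^2 + 21 * of_nat j + 16) * of_nat (franel_term (j + 1))
     + 32 * (2 * of_nat j + 1) * (2 * of_nat j + 3) * (of_nat j + 1) * (of_nat (franel_term j) :: 'p mod_ring)"
      by (simp only: of_nat_mult of_nat_add of_nat_power of_nat_numeral of_nat_1)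
    have e: "2 * (2 * J + 3) * (7 * J^2 + 21 * J + 16) = 2 * ((2 * (J + 1) + 1) * (7 * (J + 1)^2 + 7 * (J + 1) + 2))"
       "32 * (2 * J + 1) * (2 * J + 3) * (J + 1) = 32 * ((2 * J + 1) * (2 * J + 3) * (J + 1))" for J :: "'p mod_ring"
      by (simp_all add: algebra_simps power2_eq_square)
    have kk: "of_nat j + 2 = (of_nat (Suc k) :: 'p mod_ring)" "of_nat j + 1 = (of_nat k :: 'p mod_ring)"
      "j + 2 = Suc k" "j + 1 = k" by (simp_all add: Suc add.commute)
    have rec: "of_nat (Suc k) ^ 3 * of_nat (franel_term (Suc k)) = 2 * ((2 * of_nat k + 1) * (7 * of_nat k ^ 2 + 7 * of_nat k + 2)) * of_nat (franel_term k)
      + 32 * ((2 * of_nat j + 1) * (2 * of_nat j + 3) * (of_nat j + 1)) * (of_nat (franel_term j) :: 'p mod_ring)"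
      using base unfolding e unfolding kk .
    consider "Suc k < ?p" | "Suc k = ?p" | "k = ?p" | "k > ?p" by linarith
    then show ?thesis
    proof cases
      case 1 then show ?thesis using rec Suc by (simp add: truncated_term_def)
    next
      case 2
      have z: "of_nat (Suc k) = (0 :: 'p mod_ring)" unfolding 2 by simp
      show ?thesis using rec 2 Suc unfolding z by (simp add: truncated_term_def)
    next
      case 3
      have "of_nat (Suc j) = (0 :: 'p mod_ring)" using 3 Suc by simp
      then have z: "of_nat j + 1 = (0 :: 'p mod_ring)" by (simp add: add.commute)
      have u: "truncated_term (Suc j) = (0 :: 'p mod_ring)" "truncated_term (Suc (Suc j)) = (0 :: 'p mod_ring)"
        using 3 Suc by (simp_all add: truncated_term_def)
      show ?thesis unfolding Suc by (simp only: nat.case u z mult_zero_right mult_zero_left add_0)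
    next
      case 4 then show ?thesis using Suc by (simp add: truncated_term_def)
    qed
  qed
qed

lemma truncated_term_zero:
  assumes "2 * k \<ge> CARD('p)" shows "(truncated_term k :: 'p::prime_card mod_ring) = 0"
proof (cases "k < CARD('p)")
  case True
  have p: "prime CARD('p)" by (rule prime_card)
  have "fact k * fact (2 * k - k) * ((2 * k) choose k) = (fact (2 * k) :: nat)"
    by (rule binomial_fact_lemma) simp
  moreover have "CARD('p) dvd (fact (2 * k) :: nat)" using assms p by (simp add: prime_dvd_fact_iff)
  ultimately have "CARD('p) dvd fact k * fact (2 * k - k) * ((2 * k) choose k)" by simp
  moreover have "\<not> CARD('p) dvd fact k" using True p by (simp add: prime_dvd_fact_iff)
  ultimately have "CARD('p) dvd ((2 * k) choose k)" using p by (simp add: prime_dvd_mult_iff)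
  then have "of_nat (franel_term k) = (0 :: 'p mod_ring)" by (simp add: char_dvd_of_nat franel_term_def)
  then show ?thesis by (simp add: truncated_term_def)
qed (simp add: truncated_term_def)

text \<open>The operator maps \<open>x ^ k / c\<close> to a common factor times a combination of \<open>x ^ k\<close>,
  \<open>x ^ (k + 1)\<close> and \<open>x ^ (k + 2)\<close>. The coefficients are exactly those of the recurrence of
  \<open>binom(2 k, k) f\<^sub>k\<close>.\<close>

lemma fls_sym2_op_basis:
  fixes k :: nat
  defines "i \<equiv> inverse (rf clausen_c) :: 'a::field fls"
  defines "x \<equiv> rf ode_P * i\<^sup>2"
  defines "W \<equiv> 1 - 14 * fls_X - 48 * fls_X^2 + 112 * fls_X^3 + 64 * (fls_X^4 :: 'a fls)"
  shows "fls_sym2_op (x ^ k * i) = W * (x ^ k * (of_nat k ^ 3 - x * (2 * ((2 * of_nat k + 1) * (7 * of_nat k ^ 2 + 7 * of_nat k + 2)))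
     - x\<^sup>2 * (32 * ((2 * of_nat k + 1) * (2 * of_nat k + 3) * (of_nat k + 1)))))"
proof -
  define t where "t = (fls_X :: 'a fls)"
  define c where "c = 1 + 8 * t^2"
  define P where "P = t - 7 * t^2 - 8 * t^3"
  define Q where "Q = 2 * t - 6 * t^2 - 72 * t^3 - 64 * t^4"
  define Q' where "Q' = 2 - 12 * t - 216 * t^2 - 256 * t^3"
  define P' where "P' = 1 - 14 * t - 24 * t^2"
  define \<kappa> where "\<kappa> = (of_nat k :: 'a fls)"
  define M where "M = \<kappa> * W - 16 * t * P"
  define M' where "M' = \<kappa> * (-14 - 96 * t + 336 * t^2 + 256 * t^3) - 32 * t + 336 * t^2 + 512 * t^3"
  define M'' where "M'' = \<kappa> * (-96 + 672 * t + 768 * t^2) - 32 + 672 * t + 1536 * t^2"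
  define N where "N = M * M + P * (M' * c - 16 * t * M)"
  define N' where "N' = 2 * M * M' + P' * (M' * c - 16 * t * M) + P * (M'' * c - 16 * M)"
  have rfs: "rf ode_P = P" "rf ode_Q = Q" "rf clausen_c = c" unfolding P_def Q_def c_def t_def by (rule fls_polys)+
  have Wt: "W = 1 - 14 * t - 48 * t^2 + 112 * t^3 + 64 * t^4" by (simp add: W_def t_def)
  have OMP: "fls_theta v = P * fls_deriv v" for v by (simp add: fls_theta_def rfs)
  have dt: "fls_deriv t = 1" by (simp add: t_def)
  have d\<kappa>: "fls_deriv \<kappa> = 0" by (simp add: \<kappa>_def)
  note ds = dt d\<kappa> power2_eq_square power3_eq_cube power4_eq_xxxx
  have c0: "c \<noteq> 0"
  proof
    assume "c = 0"
    then have "rf clausen_c = (0 :: 'a fls)" by (simp only: rfs)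
    then show False by (simp add: clausen_c_def)
  qed
  have ci: "c * i = 1" using c0 by (simp add: i_def rfs)
  have dc: "fls_deriv c = 16 * t" by (simp add: c_def ds algebra_simps)
  have dP: "fls_deriv P = P'" by (simp add: P_def P'_def ds algebra_simps)
  have dQ: "fls_deriv Q = Q'" by (simp add: Q_def Q'_def ds algebra_simps)
  have dM: "fls_deriv M = M'" by (simp add: M_def M'_def Wt P_def ds algebra_simps)
  have dM': "fls_deriv M' = M''" by (simp add: M'_def M''_def ds algebra_simps)
  have dN: "fls_deriv N = N'" unfolding N_def by (simp add: dM dM' dP dc dt N'_def algebra_simps)
  have di: "fls_deriv i = - 16 * t * i\<^sup>2"
  proof -
    have "fls_deriv (c * i) = 0" by (simp add: ci)
    then have "i * (16 * t * i + c * fls_deriv i) = 0" by (simp add: dc algebra_simps)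
    then have "16 * t * i\<^sup>2 + (c * i) * fls_deriv i = 0" by (simp add: algebra_simps power2_eq_square)
    then show ?thesis unfolding ci by (simp add: eq_neg_iff_add_eq_0 add.commute)
  qed
  have x: "x = P * i\<^sup>2" by (simp add: x_def rfs)
  \<comment> \<open>the logarithmic derivative of \<open>x = P / c\<^sup>2\<close> for the derivation is \<open>W / c\<close>\<close>
  have Wc: "P' * c - 32 * t * P = W"
    unfolding P'_def c_def P_def Wt by (simp add: algebra_simps eval_nat_numeral)
  have OMi: "fls_theta i = - 16 * t * P * i\<^sup>2" by (simp add: OMP di)
  have OMx: "fls_theta x = x * (W * i)"
  proof -
    have "fls_theta x = P * (P' * i\<^sup>2 + P * (2 * i * fls_deriv i))"
      unfolding x OMP by (simp add: dP power2_eq_square algebra_simps)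
    also have "\<dots> = P * (P' * (c * i) * i\<^sup>2 + P * (2 * i * fls_deriv i))" unfolding ci by simp
    also have "\<dots> = P * i\<^sup>2 * ((P' * c - 32 * t * P) * i)"
      unfolding di by (simp add: power2_eq_square algebra_simps)
    finally show ?thesis unfolding Wc x .
  qed
  have OMxk: "fls_theta (x ^ k) = of_nat k * x ^ k * (W * i)" for k
  proof (induction k)
    case 0 then show ?case by (simp add: OMP)
  next
    case (Suc k)
    have "fls_theta (x ^ Suc k) = fls_theta x * x ^ k + x * fls_theta (x ^ k)" by (simp add: fls_theta_hom)
    then show ?case unfolding Suc.IH OMx by (simp add: algebra_simps)
  qed
  define G where "G = x ^ k * i"
  have OMG: "fls_theta G = G * (M * i)"
  proof -
    have "fls_theta G = of_nat k * x ^ k * (W * i) * i + x ^ k * fls_theta i" by (simp add: G_def fls_theta_hom OMxk)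
    then show ?thesis unfolding OMi G_def M_def \<kappa>_def by (simp add: algebra_simps power2_eq_square)
  qed
  have OMG2: "fls_theta (G * (M * i)) = G * (N * i\<^sup>2)"
  proof -
    have "fls_theta (G * (M * i)) = G * (M * i) * (M * i) + G * (P * (M' * (c * i) * i) + M * fls_theta i - P * M' * (c * i) * i + P * M' * i)"
      unfolding fls_theta_hom OMG by (simp add: OMP dM algebra_simps)
    also have "\<dots> = G * (M * i) * (M * i) + G * (P * M' * (c * i) * i + M * fls_theta i)" unfolding ci by (simp add: algebra_simps)
    also have "\<dots> = G * (N * i\<^sup>2)" unfolding OMi N_def by (simp add: algebra_simps power2_eq_square)
    finally show ?thesis .
  qed
  have OMG3: "fls_theta (G * (N * i\<^sup>2)) = G * ((N * M + P * (N' * c - 32 * t * N)) * i ^ 3)"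
  proof -
    have "fls_theta (G * (N * i\<^sup>2)) = G * (M * i) * (N * i\<^sup>2) + G * (P * N' * i\<^sup>2 + N * (2 * i * fls_theta i))"
      unfolding fls_theta_hom OMG by (simp add: OMP dN algebra_simps power2_eq_square)
    also have "\<dots> = G * (M * i) * (N * i\<^sup>2) + G * (P * N' * (c * i) * i\<^sup>2 + N * (2 * i * fls_theta i))" unfolding ci by simp
    also have "\<dots> = G * ((N * M + P * (N' * c - 32 * t * N)) * i ^ 3)" unfolding OMi by (simp add: algebra_simps power2_eq_square power3_eq_cube)
    finally show ?thesis .
  qed
  have "fls_sym2_op G = G * ((N * M + P * (N' * c - 32 * t * N)) * i ^ 3) - 4 * Q * (G * (M * i)) - 2 * (P * Q') * G"
    unfolding fls_sym2_op_def OMG OMG2 OMG3 rfs by (simp add: OMP dQ)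
  also have "\<dots> = G * ((N * M + P * (N' * c - 32 * t * N)) * i ^ 3) - 4 * Q * (G * (M * i)) * (c * i)\<^sup>2 - 2 * (P * Q') * G * (c * i) ^ 3"
    unfolding ci by simp
  also have "\<dots> = G * i ^ 3 * (N * M + P * (N' * c - 32 * t * N) - 4 * Q * c^2 * M - 2 * (P * Q') * c^3)"
    by (simp add: algebra_simps power2_eq_square power3_eq_cube)
  also have "N * M + P * (N' * c - 32 * t * N) - 4 * Q * c^2 * M - 2 * (P * Q') * c^3
    = W * (c^4 * \<kappa>^3 - 2 * P * c^2 * ((2 * \<kappa> + 1) * (7 * \<kappa>^2 + 7 * \<kappa> + 2))
        - 32 * P^2 * ((2 * \<kappa> + 1) * (2 * \<kappa> + 3) * (\<kappa> + 1)))"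
    unfolding Wt c_def P_def Q_def
    by (rule clausen_certificate) (simp_all add: P'_def Q'_def M_def M'_def M''_def N_def N'_def c_def P_def Wt)
  also have "G * i ^ 3 * (W * (c^4 * \<kappa>^3 - 2 * P * c^2 * ((2 * \<kappa> + 1) * (7 * \<kappa>^2 + 7 * \<kappa> + 2))
        - 32 * P^2 * ((2 * \<kappa> + 1) * (2 * \<kappa> + 3) * (\<kappa> + 1))))
    = W * (x ^ k * ((c * i) ^ 4 * \<kappa> ^ 3 - (c * i)\<^sup>2 * (P * i\<^sup>2) * (2 * ((2 * \<kappa> + 1) * (7 * \<kappa>^2 + 7 * \<kappa> + 2)))
      - (P * i\<^sup>2)\<^sup>2 * (32 * ((2 * \<kappa> + 1) * (2 * \<kappa> + 3) * (\<kappa> + 1)))))"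
  proof -
    have gen: "X * i * i ^ 3 * (W * (c^4 * u - 2 * P * c^2 * v - 32 * P^2 * w))
      = W * (X * ((c * i) ^ 4 * u - (c * i)\<^sup>2 * (P * i\<^sup>2) * (2 * v) - (P * i\<^sup>2)\<^sup>2 * (32 * w)))" for X u v w
      by (simp add: algebra_simps eval_nat_numeral)
    show ?thesis unfolding G_def by (rule gen)
  qed
  finally show ?thesis unfolding ci G_def \<kappa>_def x by simp
qed

text \<open>The right-hand side of Clausen's identity, multiplied by \<open>c ^ p\<close> to make it a polynomial.\<close>

definition clausen_poly :: "'p::prime_card mod_ring poly" where
  "clausen_poly = (\<Sum>k<CARD('p). smult (truncated_term k) (ode_P ^ k * clausen_c ^ (CARD('p) - 1 - 2 * k)))"

text \<open>The operators are linear over the powers with exponent \<open>p\<close>, so denominators can be cleared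
  by multiplying with \<open>c ^ p\<close>.\<close>

lemma fls_theta_char_power: "fls_theta (v ^ CARD('p)) = (0 :: 'p::prime_card mod_ring fls)"
proof -
  have "fls_deriv (v ^ CARD('p)) = of_nat (CARD('p)) * v ^ (CARD('p) - 1) * fls_deriv v"
    by (simp add: fls_deriv_power mult_ac)
  moreover have "of_nat (CARD('p)) = (0 :: 'p mod_ring fls)"
    by (metis of_nat_card_eq_0 fls_const_0 fls_of_nat)
  ultimately show ?thesis by (simp add: fls_theta_def)
qed

lemma fls_const_of_nat: "fls_const (of_nat k) = (of_nat k :: 'a::comm_ring_1 fls)"
  by (metis fls_of_nat)

lemma rf_sum: "rf (\<Sum>k\<in>A. v k) = (\<Sum>k\<in>A. rf (v k))"
  by (induction A rule: infinite_finite_induct) (simp_all add: rf_add)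

lemma clausen_c_nonzero: "clausen_c \<noteq> 0" by (simp add: clausen_c_def)

lemma sym2_op_clausen_poly:
  assumes odd: "CARD('p) = 2 * n + 1"
  shows "sym2_op (clausen_poly :: 'p::prime_card mod_ring poly) = 0"
proof -
  let ?p = "CARD('p)"
  define i where "i = (inverse (rf clausen_c) :: 'p mod_ring fls)"
  define x where "x = rf ode_P * i\<^sup>2"
  define W where "W = 1 - 14 * fls_X - 48 * fls_X^2 + 112 * fls_X^3 + 64 * (fls_X^4 :: 'p mod_ring fls)"
  have ci: "rf clausen_c * i = 1" by (simp add: i_def clausen_c_nonzero)
  \<comment> \<open>each term is \<open>c ^ p\<close>, a constant of the derivation, times \<open>x ^ k / c\<close>; for \<open>2 k \<ge> p\<close> the
    truncated exponent does not fit, but the central binomial coefficient vanishes\<close>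
  have tm: "rf (smult (truncated_term k) (ode_P ^ k * clausen_c ^ (?p - 1 - 2 * k))) = rf clausen_c ^ ?p * (fls_const (truncated_term k) * (x ^ k * i))" for k
  proof (cases "2 * k \<ge> ?p")
    case True
    then show ?thesis by (simp add: truncated_term_zero)
  next
    case False
    then have e: "?p = (?p - 1 - 2 * k) + 2 * k + 1" by linarith
    have "rf clausen_c ^ ?p * (x ^ k * i) = rf clausen_c ^ ((?p - 1 - 2 * k) + 2 * k + 1) * (x ^ k * i)" using e by simp
    also have "\<dots> = rf clausen_c ^ (?p - 1 - 2 * k) * (rf clausen_c * i) ^ (2 * k + 1) * rf ode_P ^ k"
      unfolding x_def by (simp add: power_add power_mult_distrib mult_ac flip: power_mult)
    finally have "rf clausen_c ^ ?p * (x ^ k * i) = rf (ode_P ^ k * clausen_c ^ (?p - 1 - 2 * k))"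
      unfolding ci by (simp add: rf_hom)
    then show ?thesis unfolding rf_smult by (metis mult.left_commute)
  qed
  have "rf (clausen_poly :: 'p mod_ring poly) = (\<Sum>k<?p. rf (smult (truncated_term k) (ode_P ^ k * clausen_c ^ (?p - 1 - 2 * k))))"
    unfolding clausen_poly_def by (rule rf_sum)
  also have "\<dots> = rf clausen_c ^ ?p * (\<Sum>k<?p. fls_const (truncated_term k) * (x ^ k * i))"
    unfolding tm by (simp add: sum_distrib_left)
  finally have rC: "rf clausen_poly = rf clausen_c ^ ?p * (\<Sum>k<?p. fls_const (truncated_term k) * (x ^ k * i))" .
  define A where "A = (\<lambda>k. 2 * ((2 * of_nat k + 1) * (7 * of_nat k ^ 2 + 7 * of_nat k + 2)) :: 'p mod_ring fls)"
  define B where "B = (\<lambda>k. 32 * ((2 * of_nat k + 1) * (2 * of_nat k + 3) * (of_nat k + 1)) :: 'p mod_ring fls)"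
  have LFb: "fls_sym2_op (x ^ k * i) = W * (x ^ k * (of_nat k ^ 3 - x * A k - x\<^sup>2 * B k))" for k
    unfolding A_def B_def W_def x_def i_def by (rule fls_sym2_op_basis)
  have "fls_sym2_op (rf clausen_poly) = rf clausen_c ^ ?p * (\<Sum>k<?p. fls_const (truncated_term k) * fls_sym2_op (x ^ k * i))"
    unfolding rC fls_sym2_op_scale[OF fls_theta_char_power] fls_sym2_op_sum fls_sym2_op_const ..
  also have "(\<Sum>k<?p. fls_const (truncated_term k) * fls_sym2_op (x ^ k * i)) = W * (\<Sum>k<?p. fls_const (truncated_term k) * x ^ k * (of_nat k ^ 3 - x * A k - x\<^sup>2 * B k))"
    unfolding sum_distrib_left LFb
    by (rule sum.cong[OF refl]) (simp only: mult_ac)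
  also have "(\<Sum>k<?p. fls_const (truncated_term k) * x ^ k * (of_nat k ^ 3 - x * A k - x\<^sup>2 * B k)) = 0"
  proof (rule telescoping_recurrence)
    show "of_nat (Suc k) ^ 3 * fls_const (truncated_term (Suc k)) = A k * fls_const (truncated_term k) + (case k of 0 \<Rightarrow> 0 | Suc j \<Rightarrow> B j * fls_const (truncated_term j))" for k
    proof -
      have num: "fls_const (numeral m) = (numeral m :: 'p mod_ring fls)" for m by simp
      have "fls_const (of_nat (Suc k) ^ 3 * truncated_term (Suc k)) = (fls_const (2 * ((2 * of_nat k + 1) * (7 * of_nat k ^ 2 + 7 * of_nat k + 2)) * truncated_term k
     + (case k of 0 \<Rightarrow> 0 | Suc j \<Rightarrow> 32 * ((2 * of_nat j + 1) * (2 * of_nat j + 3) * (of_nat j + 1)) * truncated_term j)) :: 'p mod_ring fls)"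
        by (simp only: truncated_term_recurrence)
      then show ?thesis unfolding A_def B_def
        by (cases k) (simp_all only: fls_const_hom fls_const_power fls_const_of_nat num fls_const_1 fls_const_0 nat.case)
    qed
    show "fls_const (truncated_term k) = (0 :: 'p mod_ring fls)" if "k \<ge> ?p" for k using that by (simp add: truncated_term_def)
  qed simp
  finally have "rf (sym2_op (clausen_poly :: 'p mod_ring poly)) = 0" unfolding rf_sym2_op by simp
  then show ?thesis by simp
qed

text \<open>Modulo \<open>p\<close> the binomial coefficients of \<open>p - 1\<close> are alternating signs, and so are their
  cubes.\<close>

lemma franel_top:
  assumes "odd CARD('p)"
  shows "(of_nat (franel (CARD('p) - 1)) :: 'p::prime_card mod_ring) = 1"
proof -
  let ?p = "CARD('p)"
  have p2: "?p \<ge> 2" using prime_ge_2_nat[OF prime_card[where ?'a='p]] .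
  have ch: "(of_nat ((?p - 1) choose k) :: 'p mod_ring) = (-1) ^ k" if "k \<le> ?p - 1" for k
    using that
  proof (induction k)
    case (Suc k)
    have "?p dvd (?p choose Suc k)"
      by (rule dvd_choose_prime) (use Suc.prems p2 prime_card[where ?'a='p] in auto)
    moreover have "?p choose Suc k = ((?p - 1) choose k) + ((?p - 1) choose Suc k)"
      using p2 binomial_Suc_Suc[of "?p - 1" k] by simp
    ultimately have "of_nat ((?p - 1) choose k) + of_nat ((?p - 1) choose Suc k) = (0 :: 'p mod_ring)"
      by (simp only: char_dvd_of_nat flip: of_nat_add)
    then show ?case using Suc by (simp add: add_eq_0_iff)
  qed simp
  have "of_nat (franel (?p - 1)) = (\<Sum>k\<le>?p - 1. of_nat ((?p - 1) choose k) ^ 3 :: 'p mod_ring)"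
    by (simp add: franel_def)
  also have "\<dots> = (\<Sum>k\<le>?p - 1. (-1) ^ k)"
  proof (rule sum.cong)
    fix k assume "k \<in> {..?p - 1}"
    then have "of_nat ((?p - 1) choose k) = ((-1) ^ k :: 'p mod_ring)" by (intro ch) simp
    then show "of_nat ((?p - 1) choose k) ^ 3 = ((-1) ^ k :: 'p mod_ring)" by (cases "even k") simp_all
  qed simp
  also have "\<dots> = 1"
  proof -
    have "(\<Sum>k\<le>2 * m. (-1) ^ k) = (1 :: 'p mod_ring)" for m by (induction m) simp_all
    moreover obtain m where "?p = 2 * m + 1" using assms by (elim oddE)
    ultimately show ?thesis by simp
  qed
  finally show ?thesis .
qed

text \<open>Both sides solve the symmetric square and agree in the coefficients at \<open>0\<close> and \<open>2 p - 2\<close>,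
  where both have the value 1.\<close>

lemma clausen_mod_p:
  assumes odd: "CARD('p) = 2 * n + 1" and n0: "n > 0"
  shows "(franel_poly :: 'p::prime_card mod_ring poly)\<^sup>2 = clausen_poly"
proof -
  let ?p = "CARD('p)"
  let ?D = "franel_poly\<^sup>2 - clausen_poly :: 'p mod_ring poly"
  have two: "(2 :: 'p mod_ring) \<noteq> 0"
  proof -
    have "of_nat 2 \<noteq> (0 :: 'p mod_ring)" unfolding char_dvd_of_nat using odd n0 by (auto dest: dvd_imp_le)
    then show ?thesis by simp
  qed
  have "fls_theta (fls_theta (rf franel_poly)) = rf ode_Q * rf (franel_poly :: 'p mod_ring poly)"
    unfolding rf_theta[symmetric] franel_poly_ode by (simp add: rf_mult)
  then have "rf (sym2_op (franel_poly\<^sup>2 :: 'p mod_ring poly)) = 0" unfolding rf_sym2_op rf_power by (rule symmetric_square)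
  then have "sym2_op (franel_poly\<^sup>2 :: 'p mod_ring poly) = 0" by simp
  moreover have "sym2_op (u - v) = sym2_op u - sym2_op v" for u v :: "'p mod_ring poly"
    unfolding sym2_op_def theta_def by (simp add: pderiv_diff algebra_simps)
  ultimately have L: "sym2_op ?D = 0" using sym2_op_clausen_poly[OF odd] by simp
  have degP: "degree (ode_P :: 'p mod_ring poly) \<le> 3" and degc: "degree (clausen_c :: 'p mod_ring poly) \<le> 2"
    by (simp_all add: ode_P_def clausen_c_def)
  have degt: "degree (ode_P ^ k * clausen_c ^ (?p - 1 - 2 * k) :: 'p mod_ring poly) \<le> 2 * (?p - 1) - k" if "2 * k < ?p" for k
  proof -
    have "degree (ode_P ^ k * clausen_c ^ (?p - 1 - 2 * k) :: 'p mod_ring poly) \<le> 3 * k + 2 * (?p - 1 - 2 * k)"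
      using degree_mult_le[of "ode_P ^ k" "clausen_c ^ (?p - 1 - 2 * k) :: 'p mod_ring poly"] degree_power_le[of "ode_P :: 'p mod_ring poly" k]
        degree_power_le[of "clausen_c :: 'p mod_ring poly" "?p - 1 - 2 * k"] mult_right_mono[OF degP, of k] mult_right_mono[OF degc, of "?p - 1 - 2 * k"]
      by linarith
    also have "\<dots> \<le> 2 * (?p - 1) - k" using that by linarith
    finally show ?thesis .
  qed
  have term0: "smult (truncated_term k) (ode_P ^ k * clausen_c ^ (?p - 1 - 2 * k)) = (0 :: 'p mod_ring poly)" if "2 * k \<ge> ?p" for k
    using that by (simp add: truncated_term_zero)
  have degC: "degree (clausen_poly :: 'p mod_ring poly) \<le> 2 * ?p - 2" unfolding clausen_poly_def
  proof (rule degree_sum_le)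
    fix k assume "k \<in> {..<?p}"
    show "degree (smult (truncated_term k) (ode_P ^ k * clausen_c ^ (?p - 1 - 2 * k)) :: 'p mod_ring poly) \<le> 2 * ?p - 2"
    proof (cases "2 * k \<ge> ?p")
      case True then show ?thesis using term0[of k] by (simp only: degree_0)
    next
      case False
      then show ?thesis using degt[of k] degree_smult_le[of "truncated_term k" "ode_P ^ k * clausen_c ^ (?p - 1 - 2 * k) :: 'p mod_ring poly"] by simp
    qed
  qed simp
  have degF: "degree (franel_poly\<^sup>2 :: 'p mod_ring poly) \<le> 2 * ?p - 2"
    using degree_power_le[of "franel_poly :: 'p mod_ring poly" 2] degree_franel_poly[where ?'p='p] by linarith
  have deg: "degree ?D \<le> 2 * ?p - 2" by (rule degree_diff_le[OF degF degC])
  have uu0: "truncated_term 0 = (1 :: 'p mod_ring)" using odd by (simp add: truncated_term_def franel_term_def)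
  have c0: "coeff ?D 0 = 0"
  proof -
    have "poly (clausen_poly :: 'p mod_ring poly) 0 = (\<Sum>k<?p. if k = 0 then 1 else 0)"
      unfolding clausen_poly_def poly_sum
    proof (rule sum.cong)
      fix k assume "k \<in> {..<?p}"
      show "poly (smult (truncated_term k) (ode_P ^ k * clausen_c ^ (?p - 1 - 2 * k))) 0 = (if k = 0 then 1 else (0 :: 'p mod_ring))"
        by (simp add: ode_P_def clausen_c_def uu0)
    qed simp
    also have "\<dots> = 1" using odd by simp
    finally have "poly (clausen_poly :: 'p mod_ring poly) 0 = 1" .
    moreover have "poly (franel_poly :: 'p mod_ring poly) 0 = 1" using odd by (simp add: poly_0_coeff_0 coeff_franel_poly)
    ultimately have "poly ?D 0 = 0" by simp
    then show ?thesis by (simp only: poly_0_coeff_0)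
  qed
  \<comment> \<open>on the right-hand side only \<open>k = 0\<close> reaches the degree \<open>2 p - 2\<close>, with coefficient
    \<open>8 ^ (p - 1) = 1\<close>\<close>
  have ct: "coeff ?D (2 * ?p - 2) = 0"
  proof -
    have "coeff (clausen_poly :: 'p mod_ring poly) (2 * ?p - 2) = (\<Sum>k<?p. if k = 0 then 1 else 0)"
      unfolding clausen_poly_def coeff_sum
    proof (rule sum.cong)
      fix k assume "k \<in> {..<?p}"
      consider "k = 0" | "k > 0" "2 * k < ?p" | "2 * k \<ge> ?p" by linarith
      then show "coeff (smult (truncated_term k) (ode_P ^ k * clausen_c ^ (?p - 1 - 2 * k))) (2 * ?p - 2) = (if k = 0 then 1 else (0 :: 'p mod_ring))"
      proof cases
        case 1
        have "(8 :: 'p mod_ring) \<noteq> 0"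
        proof -
          have "(8 :: 'p mod_ring) = 2 ^ 3" by simp
          then show ?thesis using two by (metis power_not_zero)
        qed
        then have dc: "degree (clausen_c :: 'p mod_ring poly) = 2" "lead_coeff (clausen_c :: 'p mod_ring poly) = 8" by (simp_all add: clausen_c_def)
        have "degree (clausen_c ^ (?p - 1) :: 'p mod_ring poly) = 2 * ?p - 2"
          using dc(1) by (simp add: degree_power_eq clausen_c_nonzero)
        then have "coeff (clausen_c ^ (?p - 1) :: 'p mod_ring poly) (2 * ?p - 2) = 8 ^ (?p - 1)"
          using lead_coeff_power[of "clausen_c :: 'p mod_ring poly" "?p - 1"] dc by metis
        also have "\<dots> = (1 :: 'p mod_ring)" by (rule fermat_mod_ring_unit[OF \<open>8 \<noteq> 0\<close>])
        finally show ?thesis using 1 uu0 by simp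
      next
        case 2
        then have "degree (ode_P ^ k * clausen_c ^ (?p - 1 - 2 * k) :: 'p mod_ring poly) < 2 * ?p - 2" using degt[of k] by linarith
        then have "coeff (ode_P ^ k * clausen_c ^ (?p - 1 - 2 * k) :: 'p mod_ring poly) (2 * ?p - 2) = 0" by (rule coeff_eq_0)
        then show ?thesis using 2 by simp
      next
        case 3
        then have "k \<noteq> 0" using odd by auto
        then show ?thesis by (subst term0[OF 3]) simp
      qed
    qed simp
    also have "\<dots> = 1" using odd by simp
    finally have C: "coeff (clausen_poly :: 'p mod_ring poly) (2 * ?p - 2) = 1" .
    have "coeff (franel_poly * franel_poly :: 'p mod_ring poly) ((?p - 1) + (?p - 1)) = coeff franel_poly (?p - 1) * coeff franel_poly (?p - 1)"
      by (rule coeff_mult_high) (use degree_franel_poly[where ?'p='p] in linarith)+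
    moreover have "(?p - 1) + (?p - 1) = 2 * ?p - 2" by simp
    moreover have "coeff franel_poly (?p - 1) = (1 :: 'p mod_ring)"
      using franel_top[where ?'p='p] odd by (simp add: coeff_franel_poly)
    ultimately have "coeff (franel_poly\<^sup>2 :: 'p mod_ring poly) (2 * ?p - 2) = 1" by (simp add: power2_eq_square)
    then show ?thesis using C by simp
  qed
  have "?D = 0" by (rule sym2_op_unique[OF L deg two c0 ct])
  then show ?thesis by simp
qed

text \<open>Here \<open>t\<close> is \<open>- 1 + 3 r / 4\<close>, and \<open>32 P(t) = c(t)\<^sup>2\<close>. The powers of \<open>c(t)\<close> disappear
  because \<open>c(t) ^ (p - 1) = 1\<close>.\<close>

lemma sum_eq_franel_poly_square:
  fixes r :: "'p::prime_card mod_ring"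
  assumes odd: "CARD('p) = 2 * n + 1" and n1: "n > 1" and r: "r\<^sup>2 = 2"
  defines "t \<equiv> inverse (8 + 6 * r)"
  shows "(\<Sum>k<CARD('p). of_nat (franel_term k) / 32 ^ k) = (poly franel_poly t)\<^sup>2"
proof -
  let ?p = "CARD('p)"
  have nz: "of_nat k \<noteq> (0::'p mod_ring)" if "0 < k" "k < ?p" for k
    using that by (simp add: char_dvd_of_nat nat_dvd_not_less)
  have two: "(2::'p mod_ring) \<noteq> 0" and three: "(3::'p mod_ring) \<noteq> 0" using nz[of 2] nz[of 3] odd n1 by simp_all
  have pow2: "(2::'p mod_ring) ^ k \<noteq> 0" for k using two by simp
  have rr: "r * r = 2" using r by (simp add: power2_eq_square)
  then have rrz: "r * (r * z) = 2 * z" for z by (metis mult.assoc)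
  have four: "(4 :: 'p mod_ring) \<noteq> 0" and eight: "(8 :: 'p mod_ring) \<noteq> 0" and thirtytwo: "(32 :: 'p mod_ring) \<noteq> 0"
    using pow2[of 2] pow2[of 3] pow2[of 5] by simp_all
  have e: "(8 + 6 * r) * (6 * r - 8) = 8" by (simp add: algebra_simps rr rrz)
  then have l0: "8 + 6 * r \<noteq> 0" using eight by auto
  define s where "s = 3 * r - 4"
  have t: "4 * t = s"
  proof -
    have "8 * t = t * ((8 + 6 * r) * (6 * r - 8))" unfolding e by simp
    also have "\<dots> = 6 * r - 8" unfolding t_def using l0 by simp
    finally have "2 * (4 * t) = 2 * s" by (simp add: s_def algebra_simps)
    then show ?thesis using two by (metis mult_left_cancel)
  qed
  have Pt: "poly ode_P t = t - 7 * t^2 - 8 * t^3" by (simp add: ode_P_def algebra_simps power2_eq_square power3_eq_cube)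
  have ct: "poly clausen_c t = 1 + 8 * t^2" by (simp add: clausen_c_def algebra_simps power2_eq_square)
  have c2: "2 * poly clausen_c t = 2 * (6 * (3 - 2 * r))"
  proof -
    have "2 * poly clausen_c t = 2 + (4 * t)\<^sup>2" unfolding ct by (simp add: algebra_simps power2_eq_square)
    then show ?thesis unfolding t s_def by (simp add: algebra_simps power2_eq_square rr rrz)
  qed
  then have c: "poly clausen_c t = 6 * (3 - 2 * r)" using two by (metis mult_left_cancel)
  have six: "(6::'p mod_ring) \<noteq> 0"
  proof -
    have "(6::'p mod_ring) = 2 * 3" by simp
    then show ?thesis using two three by (metis mult_eq_0_iff)
  qed
  have c0: "poly clausen_c t \<noteq> 0"
  proof
    assume "poly clausen_c t = 0"
    then have "6 * (3 - 2 * r) * (3 + 2 * r) = 0" using c by simp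
    then have "(6::'p mod_ring) = 0" by (simp add: algebra_simps rr rrz)
    then show False using six by simp
  qed
  have P32: "32 * poly ode_P t = (poly clausen_c t)\<^sup>2"
  proof -
    have "8 * (4 * poly ode_P t * 8) = 8 * (poly clausen_c t)\<^sup>2"
    proof -
      have "8 * (4 * poly ode_P t * 8) = 64 * (4 * t) - 112 * (4 * t)^2 - 32 * (4 * t)^3"
        unfolding Pt by (simp add: algebra_simps power2_eq_square power3_eq_cube)
      then show ?thesis unfolding t c s_def by (simp add: algebra_simps power2_eq_square power3_eq_cube rr rrz)
    qed
    then have "4 * poly ode_P t * 8 = (poly clausen_c t)\<^sup>2" using eight by (metis mult_left_cancel)
    then show ?thesis by simp
  qed
  have fl: "poly clausen_c t ^ (?p - 1) = 1" by (rule fermat_mod_ring_unit[OF c0])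
  have "(poly franel_poly t)\<^sup>2 = poly clausen_poly t" using clausen_mod_p[OF odd] n1 by (metis less_trans poly_power zero_less_one)
  also have "\<dots> = (\<Sum>k<?p. of_nat (franel_term k) / 32 ^ k)"
    unfolding clausen_poly_def poly_sum
  proof (rule sum.cong)
    fix k assume k: "k \<in> {..<?p}"
    show "poly (smult (truncated_term k) (ode_P ^ k * clausen_c ^ (?p - 1 - 2 * k))) t = of_nat (franel_term k) / 32 ^ k"
    proof (cases "2 * k \<ge> ?p")
      case True
      then have "(of_nat (franel_term k) :: 'p mod_ring) = 0" using truncated_term_zero[of k] k by (metis lessThan_iff truncated_term_def)
      then show ?thesis using True by (simp add: truncated_term_zero)
    next
      case False
      then have e: "?p - 1 = (?p - 1 - 2 * k) + 2 * k" by linarith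
      have "(32 * poly ode_P t) ^ k * poly clausen_c t ^ (?p - 1 - 2 * k) = poly clausen_c t ^ ((?p - 1 - 2 * k) + 2 * k)"
        unfolding P32 by (simp add: power_add mult.commute flip: power_mult)
      also have "\<dots> = 1" using fl e by simp
      finally have "32 ^ k * (poly ode_P t ^ k * poly clausen_c t ^ (?p - 1 - 2 * k)) = 1" by (simp add: power_mult_distrib mult_ac)
      then have "poly ode_P t ^ k * poly clausen_c t ^ (?p - 1 - 2 * k) = 1 / 32 ^ k" using thirtytwo by (simp add: field_simps)
      then show ?thesis using k by (simp add: truncated_term_def)
    qed
  qed simp
  finally show ?thesis by simp
qed

section \<open>The symmetry of the differential equation\<close>

text \<open>The analogue of \<open>clausen_certificate\<close> for the functions \<open>x ^ k / (1 + t)\<close> with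
  \<open>x = (1 - 8 t) / (8 (1 + t))\<close> and the operator of order two.\<close>

lemma involution_certificate:
  fixes t k :: "'a::comm_ring_1"
  assumes M: "M = - t * (9 * k + 1 - 8 * t)" and M': "M' = - (9 * k + 1) + 16 * t"
    and P: "P = t - 7 * t^2 - 8 * t^3" and Q: "Q = 2 * t - 6 * t^2 - 72 * t^3 - 64 * t^4"
  shows "M * M + P * M' - Q = 8 * t * (1 + t)^2 * k^2 - P * (7 * k^2 + 7 * k + 2) - t * (1 - 8 * t)^2 * (k + 1)^2"
  unfolding assms by (simp add: algebra_simps eval_nat_numeral)

text \<open>The polynomial \<open>(1 + t) ^ (p - 1) F((1 - 8 t) / (8 (1 + t)))\<close>.\<close>

definition dual_franel_poly :: "'p::prime_card mod_ring poly" where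
  "dual_franel_poly = (\<Sum>k<CARD('p). smult (of_nat (franel k) / 8 ^ k) ([:1, -8:] ^ k * [:1, 1:] ^ (CARD('p) - 1 - k)))"

lemma dual_franel_poly_ode:
  assumes eight: "(8 :: 'p::prime_card mod_ring) \<noteq> 0"
  shows "theta (theta dual_franel_poly) = ode_Q * (dual_franel_poly :: 'p::prime_card mod_ring poly)"
proof -
  let ?p = "CARD('p)"
  define t where "t = (fls_X :: 'p mod_ring fls)"
  define P where "P = t - 7 * t^2 - 8 * t^3"
  define Q where "Q = 2 * t - 6 * t^2 - 72 * t^3 - 64 * t^4"
  have rfs: "rf ode_P = P" "rf ode_Q = Q" unfolding P_def Q_def t_def by (rule fls_polys)+
  have e8: "(8 :: 'p mod_ring fls) \<noteq> 0" using eight by (metis fls_const_numeral fls_const_eq_0_iff)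
  have dt: "fls_deriv t = 1" by (simp add: t_def)
  have r1: "rf [:1, 1:] = 1 + t" and r8: "rf [:1, -8:] = 1 - 8 * t"
  proof -
    have "[:1, 1:] = 1 + (pX :: 'p mod_ring poly)" "[:1, -8:] = 1 - 8 * (pX :: 'p mod_ring poly)"
      by (simp_all add: pX_def one_pCons numeral_poly)
    then show "rf [:1, 1:] = 1 + t" "rf [:1, -8:] = 1 - 8 * t" unfolding t_def by (simp_all only: rf_hom rf_pX rf_1)
  qed
  define d where "d = 1 + t"
  have d0: "d \<noteq> 0" 
  proof
    assume "d = 0"
    then have "rf [:1, 1:] = (0 :: 'p mod_ring fls)" unfolding r1 d_def .
    then show False by simp
  qed
  define i where "i = inverse d"
  have di: "d * i = 1" using d0 by (simp add: i_def)
  have dd: "fls_deriv d = 1" by (simp add: d_def dt)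
  have Pd: "P = t * d * (1 - 8 * t)" unfolding P_def d_def by (simp add: algebra_simps power2_eq_square power3_eq_cube)
  define x where "x = (1 - 8 * t) * i / 8"
  have x8: "8 * x = (1 - 8 * t) * i" using e8 by (simp add: x_def)
  have OMP: "fls_theta v = P * fls_deriv v" for v by (simp add: fls_theta_def rfs)
  have dvi: "fls_deriv i = - (i\<^sup>2)"
  proof -
    have "fls_deriv (d * i) = 0" by (simp add: di)
    then have "i * (i + d * fls_deriv i) = 0" by (simp add: dd algebra_simps)
    then have "i\<^sup>2 + (d * i) * fls_deriv i = 0" by (simp add: algebra_simps power2_eq_square)
    then show ?thesis unfolding di by (simp add: eq_neg_iff_add_eq_0 add.commute)
  qed
  have OMi: "fls_theta i = - t * (1 - 8 * t) * i"
  proof -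
    have "fls_theta i = - t * (1 - 8 * t) * (d * i) * i" unfolding OMP dvi Pd by (simp add: power2_eq_square algebra_simps)
    then show ?thesis unfolding di by simp
  qed
  have OMx: "fls_theta x = x * (- 9 * t)"
  proof -
    have "8 * fls_theta x = fls_theta (8 * x)" by (simp add: fls_theta_hom)
    also have "\<dots> = P * (- 8) * i + (1 - 8 * t) * fls_theta i" unfolding x8 fls_theta_hom by (simp add: OMP dt)
    also have "\<dots> = (1 - 8 * t) * i * (- 8 * t * d - t * (1 - 8 * t))" unfolding OMi Pd by (simp add: algebra_simps)
    also have "- 8 * t * d - t * (1 - 8 * t) = - 9 * t" by (simp add: d_def algebra_simps)
    also have "(1 - 8 * t) * i * (- 9 * t) = 8 * (x * (- 9 * t))" unfolding x8[symmetric] by (simp add: mult_ac)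
    finally show ?thesis using e8 by (metis mult_left_cancel)
  qed
  have OMxk: "fls_theta (x ^ k) = of_nat k * x ^ k * (- 9 * t)" for k
  proof (induction k)
    case 0 then show ?case by (simp add: OMP)
  next
    case (Suc k)
    have "fls_theta (x ^ Suc k) = fls_theta x * x ^ k + x * fls_theta (x ^ k)" by (simp add: fls_theta_hom)
    then show ?case unfolding Suc.IH OMx by (simp add: algebra_simps)
  qed
  have LGk: "fls_theta (fls_theta (x ^ k * i)) - Q * (x ^ k * i) = 8 * t * d\<^sup>2 * i * (x ^ k * (of_nat k ^ 2 - x * (7 * of_nat k ^ 2 + 7 * of_nat k + 2) - x\<^sup>2 * (8 * (of_nat k + 1)\<^sup>2)))" for k
  proof -
    define \<kappa> where "\<kappa> = (of_nat k :: 'p mod_ring fls)"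
    define M where "M = - t * (9 * \<kappa> + 1 - 8 * t)"
    have d\<kappa>: "fls_deriv \<kappa> = 0" by (simp add: \<kappa>_def)
    have OMM: "fls_theta M = P * (- (9 * \<kappa> + 1) + 16 * t)" unfolding OMP M_def by (simp add: dt d\<kappa> algebra_simps)
    have g1: "fls_theta (x ^ k * i) = x ^ k * i * M"
      unfolding fls_theta_hom OMxk OMi M_def \<kappa>_def by (simp add: algebra_simps)
    have "fls_theta (fls_theta (x ^ k * i)) - Q * (x ^ k * i) = x ^ k * i * (M * M + P * (- (9 * \<kappa> + 1) + 16 * t) - Q)"
      unfolding g1 fls_theta_hom(3)[of "x ^ k * i" M] OMM by (simp add: algebra_simps)
    also have "M * M + P * (- (9 * \<kappa> + 1) + 16 * t) - Q = 8 * t * (1 + t)^2 * \<kappa>^2 - P * (7 * \<kappa>^2 + 7 * \<kappa> + 2) - t * (1 - 8 * t)^2 * (\<kappa> + 1)^2"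
      by (rule involution_certificate) (simp_all add: M_def P_def Q_def)
    also have "\<dots> = 8 * t * d\<^sup>2 * (\<kappa>^2 - x * (7 * \<kappa>^2 + 7 * \<kappa> + 2) - x\<^sup>2 * (8 * (\<kappa> + 1)\<^sup>2))"
    proof -
      have dx: "8 * (d * x) = 1 - 8 * t" using x8 di by (metis (no_types, opaque_lifting) mult.assoc mult.commute mult.right_neutral)
      have "8 * t * d\<^sup>2 * (u - x * v - x\<^sup>2 * (8 * w)) = 8 * t * d\<^sup>2 * u - t * d * (8 * (d * x)) * v - t * (8 * (d * x))\<^sup>2 * w" for u v w
        by (simp add: algebra_simps power2_eq_square)
      then show ?thesis unfolding dx Pd d_def[symmetric] by simp
    qed
    finally show ?thesis unfolding \<kappa>_def by (simp add: mult_ac)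
  qed
  have tm: "rf (smult (of_nat (franel k) / 8 ^ k) ([:1, -8:] ^ k * [:1, 1:] ^ (?p - 1 - k))) = d ^ ?p * (fls_const (coeff franel_poly k) * (x ^ k * i))" if "k < ?p" for k
  proof -
    have e: "?p = (?p - 1 - k) + k + 1" using that by linarith
    have "8 ^ k * (d ^ ?p * (x ^ k * i)) = d ^ ((?p - 1 - k) + k + 1) * ((8 * x) ^ k * i)" using e by (simp add: power_mult_distrib mult_ac)
    also have "\<dots> = d ^ (?p - 1 - k) * (1 - 8 * t) ^ k * (d * i) ^ (k + 1)"
      unfolding x8 by (simp add: power_add power_mult_distrib mult_ac)
    finally have "8 ^ k * (d ^ ?p * (x ^ k * i)) = d ^ (?p - 1 - k) * (1 - 8 * t) ^ k" unfolding di by simp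
    moreover have "fls_const (8 ^ k) = (8 ^ k :: 'p mod_ring fls)" by (simp add: fls_const_power)
    ultimately have "rf ([:1, -8:] ^ k * [:1, 1:] ^ (?p - 1 - k)) = fls_const (8 ^ k) * (d ^ ?p * (x ^ k * i))"
      unfolding rf_mult rf_power r1 r8 d_def[symmetric] by (simp add: mult.commute)
    then have "rf (smult (of_nat (franel k) / 8 ^ k) ([:1, -8:] ^ k * [:1, 1:] ^ (?p - 1 - k))) = fls_const (of_nat (franel k) / 8 ^ k * 8 ^ k) * (d ^ ?p * (x ^ k * i))"
      unfolding rf_smult fls_const_hom(4) by (simp add: mult.assoc)
    then show ?thesis using eight that by (simp add: coeff_franel_poly mult_ac)
  qed
  have rG: "rf dual_franel_poly = d ^ ?p * (\<Sum>k<?p. fls_const (coeff franel_poly k) * (x ^ k * i))"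
    unfolding dual_franel_poly_def rf_sum sum_distrib_left by (rule sum.cong) (use tm in auto)
  define A where "A = (\<lambda>k. (7 * of_nat k ^ 2 + 7 * of_nat k + 2) :: 'p mod_ring fls)"
  define B where "B = (\<lambda>k. 8 * (of_nat k + 1)\<^sup>2 :: 'p mod_ring fls)"
  have OMd: "fls_theta (d ^ ?p) = 0" by (rule fls_theta_char_power)
  have "fls_theta (fls_theta (rf dual_franel_poly)) - Q * rf dual_franel_poly = d ^ ?p * (\<Sum>k<?p. fls_const (coeff franel_poly k) * (fls_theta (fls_theta (x ^ k * i)) - Q * (x ^ k * i)))"
    unfolding rG by (simp add: fls_theta_hom OMd fls_theta_sum sum_subtractf sum_distrib_left algebra_simps)
  also have "(\<Sum>k<?p. fls_const (coeff franel_poly k) * (fls_theta (fls_theta (x ^ k * i)) - Q * (x ^ k * i)))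
     = 8 * t * d\<^sup>2 * i * (\<Sum>k<?p. fls_const (coeff franel_poly k) * x ^ k * (of_nat k ^ 2 - x * A k - x\<^sup>2 * B k))"
    unfolding LGk sum_distrib_left A_def B_def by (rule sum.cong[OF refl]) (simp only: mult_ac)
  also have "(\<Sum>k<?p. fls_const (coeff franel_poly k) * x ^ k * (of_nat k ^ 2 - x * A k - x\<^sup>2 * B k)) = 0"
  proof (rule telescoping_recurrence)
    show "of_nat (Suc k) ^ 2 * fls_const (coeff franel_poly (Suc k)) = A k * fls_const (coeff franel_poly k) + (case k of 0 \<Rightarrow> 0 | Suc j \<Rightarrow> B j * fls_const (coeff franel_poly j))" for k
    proof -
      have num: "fls_const (numeral m) = (numeral m :: 'p mod_ring fls)" for m by simp
      have "fls_const ((of_nat k + 1)^2 * coeff franel_poly (Suc k)) = (fls_const ((7 * of_nat k ^ 2 + 7 * of_nat k + 2) * coeff franel_poly k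
        + 8 * of_nat k ^ 2 * coeff (pCons 0 franel_poly) k) :: 'p mod_ring fls)"
        by (simp only: franel_poly_recurrence)
      then have "of_nat (Suc k) ^ 2 * fls_const (coeff franel_poly (Suc k)) = A k * fls_const (coeff franel_poly k) + 8 * of_nat k ^ 2 * fls_const (coeff (pCons 0 franel_poly) k)"
        unfolding A_def fls_const_hom fls_const_power fls_const_of_nat num fls_const_1 by (simp add: add.commute)
      then show ?thesis unfolding B_def by (cases k) (simp_all add: add.commute)
    qed
    show "fls_const (coeff franel_poly k) = (0 :: 'p mod_ring fls)" if "k \<ge> ?p" for k using that by (simp add: coeff_franel_poly)
  qed simp
  finally have "rf (theta (theta dual_franel_poly)) = rf (ode_Q * (dual_franel_poly :: 'p mod_ring poly))" unfolding rf_theta rf_mult rfs by simp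
  then show ?thesis by simp
qed

text \<open>Both sides solve the same equation of order two, have degree less than \<open>p\<close> and agree at 0.\<close>

lemma dual_franel_poly_eq:
  assumes eight: "(8 :: 'p::prime_card mod_ring) \<noteq> 0"
  shows "dual_franel_poly = smult (poly franel_poly (1 / 8)) (franel_poly :: 'p::prime_card mod_ring poly)"
proof -
  let ?p = "CARD('p)" and ?c = "poly franel_poly (1 / 8) :: 'p mod_ring"
  have p0: "?p > 0" by simp
  let ?D = "dual_franel_poly - smult ?c (franel_poly :: 'p mod_ring poly)"
  have "?D = 0"
  proof (rule second_order_unique)
    show "theta (theta ?D) = ode_Q * ?D"
    proof -
      have "theta (u - smult c v) = theta u - smult c (theta v)" for u v :: "'p mod_ring poly" and c
        by (simp add: theta_def pderiv_diff pderiv_smult algebra_simps)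
      then show ?thesis by (simp add: dual_franel_poly_ode[OF eight] franel_poly_ode right_diff_distrib)
    qed
    have "degree (dual_franel_poly :: 'p mod_ring poly) \<le> ?p - 1" unfolding dual_franel_poly_def
    proof (rule degree_sum_le)
      fix k assume k: "k \<in> {..<?p}"
      have "degree ([:1, -8:] ^ k * [:1, 1:] ^ (?p - 1 - k) :: 'p mod_ring poly) \<le> degree ([:1, -8:] :: 'p mod_ring poly) * k + degree ([:1, 1:] :: 'p mod_ring poly) * (?p - 1 - k)"
        using degree_mult_le[of "[:1, -8:] ^ k" "[:1, 1:] ^ (?p - 1 - k) :: 'p mod_ring poly"]
          degree_power_le[of "[:1, -8:] :: 'p mod_ring poly" k] degree_power_le[of "[:1, 1:] :: 'p mod_ring poly" "?p - 1 - k"] by linarith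
      also have "\<dots> \<le> ?p - 1" using k by auto
      finally show "degree (smult (of_nat (franel k) / 8 ^ k) ([:1, -8:] ^ k * [:1, 1:] ^ (?p - 1 - k)) :: 'p mod_ring poly) \<le> ?p - 1"
        using degree_smult_le order_trans by blast
    qed simp
    moreover have "degree (smult ?c franel_poly) \<le> ?p - 1"
      using degree_smult_le[of ?c "franel_poly :: 'p mod_ring poly"] degree_franel_poly[where ?'p='p] by linarith
    ultimately have "degree ?D \<le> ?p - 1" by (rule degree_diff_le)
    then show "degree ?D < ?p" using p0 by linarith
    have "poly (dual_franel_poly :: 'p mod_ring poly) 0 = ?c"
      unfolding dual_franel_poly_def poly_sum poly_franel_poly by (rule sum.cong) (simp_all add: power_divide)
    moreover have "poly (smult ?c (franel_poly :: 'p mod_ring poly)) 0 = ?c" by (simp add: poly_0_coeff_0 coeff_franel_poly)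
    ultimately have "poly ?D 0 = 0" by simp
    then show "coeff ?D 0 = 0" by (simp only: poly_0_coeff_0)
  qed
  then show ?thesis by simp
qed

text \<open>The number \<open>t = 1 / (8 + 6 r)\<close> is fixed by the symmetry: \<open>1 - 8 t = 8 t (1 + t)\<close>.\<close>

lemma franel_poly_fixed_point:
  fixes r :: "'p::prime_card mod_ring"
  assumes p: "CARD('p) > 3" and r: "r\<^sup>2 = 2"
  defines "t \<equiv> inverse (8 + 6 * r)"
  shows "poly franel_poly t = poly franel_poly (1 / 8) * poly franel_poly t"
proof -
  let ?p = "CARD('p)"
  have nz: "of_nat k \<noteq> (0::'p mod_ring)" if "0 < k" "k < ?p" for k
    using that by (simp add: char_dvd_of_nat nat_dvd_not_less)
  have two: "(2::'p mod_ring) \<noteq> 0" and three: "(3::'p mod_ring) \<noteq> 0" using nz[of 2] nz[of 3] p by simp_all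
  have pow2: "(2::'p mod_ring) ^ k \<noteq> 0" for k using two by simp
  have rr: "r * r = 2" using r by (simp add: power2_eq_square)
  then have rrz: "r * (r * z) = 2 * z" for z by (metis mult.assoc)
  have eight: "(8 :: 'p mod_ring) \<noteq> 0" using pow2[of 3] by simp
  have e: "(8 + 6 * r) * (6 * r - 8) = 8" by (simp add: algebra_simps rr rrz)
  then have l0: "8 + 6 * r \<noteq> 0" using eight by auto
  have t: "4 * t = 3 * r - 4"
  proof -
    have "8 * t = t * ((8 + 6 * r) * (6 * r - 8))" unfolding e by simp
    also have "\<dots> = 6 * r - 8" unfolding t_def using l0 by simp
    finally have "2 * (4 * t) = 2 * (3 * r - 4)" by (simp add: algebra_simps)
    then show ?thesis using two by (metis mult_left_cancel)
  qed
  have r0: "r \<noteq> 0" using rr two by auto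
  have t1: "1 + t \<noteq> 0"
  proof
    assume "1 + t = 0"
    then have "4 * (1 + t) = 0" by simp
    then have "3 * r = 0" using t by (simp add: algebra_simps)
    then show False using three r0 by simp
  qed
  have fixd: "1 - 8 * t = 8 * t * (1 + t)"
  proof -
    have "2 * (1 - 8 * t) = 2 * (8 * t * (1 + t))"
    proof -
      have "2 * (8 * t * (1 + t)) = 4 * (4 * t) + (4 * t)\<^sup>2" by (simp add: algebra_simps power2_eq_square)
      moreover have "2 * (1 - 8 * t) = 2 - 4 * (4 * t)" by (simp add: algebra_simps)
      ultimately show ?thesis unfolding t by (simp add: algebra_simps power2_eq_square rr rrz)
    qed
    then show ?thesis using two by (metis mult_left_cancel)
  qed
  have fl: "(1 + t) ^ (?p - 1) = 1" by (rule fermat_mod_ring_unit[OF t1])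
  have "poly dual_franel_poly t = (\<Sum>k<?p. of_nat (franel k) * t ^ k)"
    unfolding dual_franel_poly_def poly_sum
  proof (rule sum.cong)
    fix k assume "k \<in> {..<?p}"
    then have e: "?p - 1 = k + (?p - 1 - k)" by auto
    have "poly ([:1, -8:] ^ k * [:1, 1:] ^ (?p - 1 - k)) t = (1 - 8 * t) ^ k * (1 + t) ^ (?p - 1 - k)"
      by (simp add: mult.commute)
    also have "\<dots> = 8 ^ k * t ^ k * (1 + t) ^ (k + (?p - 1 - k))" unfolding fixd by (simp add: power_mult_distrib power_add)
    also have "\<dots> = 8 ^ k * t ^ k" using fl e by simp
    finally show "poly (smult (of_nat (franel k) / 8 ^ k) ([:1, -8:] ^ k * [:1, 1:] ^ (?p - 1 - k))) t = of_nat (franel k) * t ^ k"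
      using eight by simp
  qed simp
  also have "\<dots> = poly franel_poly t" by (simp add: poly_franel_poly)
  finally show ?thesis unfolding dual_franel_poly_eq[OF eight] by simp
qed

section \<open>Power sums and square roots in a prime field\<close>

text \<open>A polynomial of degree \<open>e\<close> has at most \<open>e\<close> roots. This weak substitute for a primitive
  root suffices for power sums and for elements of order 3.\<close>

lemma exists_power_neq_1:
  assumes "0 < e" "e < CARD('p) - 1"
  shows "\<exists>g :: 'p::prime_card mod_ring. g \<noteq> 0 \<and> g ^ e \<noteq> 1"
proof (rule ccontr)
  assume "\<not> ?thesis"
  then have all: "\<And>g :: 'p mod_ring. g \<noteq> 0 \<Longrightarrow> g ^ e = 1" by blast
  define q where "q = (monom 1 e - 1 :: 'p mod_ring poly)"
  have "coeff q e = 1" using assms by (simp add: q_def)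
  then have q0: "q \<noteq> 0" by auto
  have "degree q \<le> e" unfolding q_def using assms by (intro degree_diff_le) (simp_all add: degree_monom_le)
  have "UNIV - {0} \<subseteq> {g. poly q g = 0}" using all by (auto simp: q_def poly_monom)
  then have "card (UNIV - {0 :: 'p mod_ring}) \<le> card {g. poly q g = 0}"
    by (intro card_mono) (use q0 poly_roots_finite in auto)
  also have "\<dots> \<le> degree q" by (rule card_poly_roots_bound[OF q0])
  finally have "CARD('p) - 1 \<le> e" using \<open>degree q \<le> e\<close> by (simp add: card_Diff_singleton)
  then show False using assms by simp
qed

text \<open>Multiplication by an element \<open>g\<close> with \<open>g ^ e \<noteq> 1\<close> permutes the summands and multiplies the
  sum by \<open>g ^ e\<close>.\<close>

lemma power_sum_mod_ring:
  "(\<Sum>z\<in>UNIV. (z :: 'p::prime_card mod_ring) ^ e) = (if e > 0 \<and> (CARD('p) - 1) dvd e then - 1 else 0)"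
proof -
  let ?p = "CARD('p)"
  have p2: "?p \<ge> 2" using prime_ge_2_nat[OF prime_card[where ?'a='p]] .
  consider "e = 0" | "e > 0" "(?p - 1) dvd e" | "\<not> (?p - 1) dvd e" by blast
  then show ?thesis
  proof cases
    case 1 then show ?thesis by simp
  next
    case 2
    then obtain m where m: "e = (?p - 1) * m" by blast
    have "(\<Sum>z\<in>UNIV. (z :: 'p mod_ring) ^ e) = (\<Sum>z\<in>(UNIV :: 'p mod_ring set). 1 - (if z = 0 then 1 else 0))"
      using 2 by (intro sum.cong) (auto simp: m power_mult fermat_mod_ring_unit[unfolded One_nat_def])
    also have "\<dots> = -1" by (simp add: sum_subtractf)
    finally show ?thesis using 2 by simp
  next
    case 3
    define e' where "e' = e mod (?p - 1)"
    have e': "0 < e'" "e' < ?p - 1" using 3 p2 by (auto simp: e'_def mod_greater_zero_iff_not_dvd)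
    obtain g :: "'p mod_ring" where g: "g \<noteq> 0" "g ^ e' \<noteq> 1" using exists_power_neq_1[OF e'] by blast
    have "g ^ e = (g ^ (?p - 1)) ^ (e div (?p - 1)) * g ^ e'"
      unfolding e'_def by (simp flip: power_mult power_add)
    then have ge: "g ^ e \<noteq> 1" using g fermat_mod_ring_unit[OF g(1)] by simp
    have "bij ((*) g)" using g(1) by (intro bij_betwI[of _ _ _ "(*) (inverse g)"]) (simp_all add: mult.assoc[symmetric])
    then have "(\<Sum>z\<in>UNIV. z ^ e) = (\<Sum>z\<in>UNIV. (g * z) ^ e)"
      using sum.reindex_bij_betw[of "(*) g" UNIV UNIV "\<lambda>z. z ^ e"] by simp
    also have "\<dots> = g ^ e * (\<Sum>z\<in>UNIV. z ^ e)" by (simp add: power_mult_distrib sum_distrib_left)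
    finally have "(g ^ e - 1) * (\<Sum>z\<in>UNIV. z ^ e) = 0" by (simp add: algebra_simps)
    then show ?thesis using ge 3 by auto
  qed
qed

text \<open>By Frobenius the left-hand side is \<open>(u ^ p - v ^ p) / (u - v)\<close> for \<open>u \<noteq> v\<close>, a geometric
  sum.\<close>

lemma diff_power_pred:
  fixes u v :: "'p::prime_card mod_ring"
  shows "(u - v) ^ (CARD('p) - 1) = (\<Sum>k<CARD('p). u ^ (CARD('p) - 1 - k) * v ^ k)"
proof (cases "u = v")
  case True
  let ?p = "CARD('p)"
  have p2: "?p \<ge> 2" using prime_ge_2_nat[OF prime_card[where ?'a='p]] .
  have "(\<Sum>k<?p. u ^ (?p - 1 - k) * v ^ k) = (\<Sum>k<?p. u ^ (?p - 1))"
    by (rule sum.cong) (auto simp: True simp flip: power_add)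
  then show ?thesis using True p2 by simp
next
  case False
  let ?p = "CARD('p)"
  have "v ^ ?p - u ^ ?p = (v - u) * (\<Sum>k<?p. u ^ (?p - 1 - k) * v ^ k)"
    using power_diff_sumr2[of v ?p u] by simp
  then have "(v - u) * (\<Sum>k<?p. u ^ (?p - 1 - k) * v ^ k) = (v - u) * 1" by (simp add: fermat_mod_ring)
  then have "(\<Sum>k<?p. u ^ (?p - 1 - k) * v ^ k) = 1" using False by (metis mult_left_cancel right_minus_eq)
  then show ?thesis using False fermat_mod_ring_unit[of "u - v"] by simp
qed

lemma zero_indicator: "(if z = 0 then 1 else 0) = 1 - (z :: 'p::prime_card mod_ring) ^ (CARD('p) - 1)"
proof -
  have "CARD('p) \<ge> 2" using prime_ge_2_nat[OF prime_card[where ?'a='p]] .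
  then show ?thesis using fermat_mod_ring_unit[of z] by (cases "z = 0") simp_all
qed

lemma of_nat_card_zeros:
  fixes h :: "'b \<Rightarrow> 'p::prime_card mod_ring"
  assumes "finite S"
  shows "of_nat (card {s\<in>S. h s = 0}) = (\<Sum>s\<in>S. 1 - h s ^ (CARD('p) - 1))"
proof -
  have "of_nat (card {s\<in>S. h s = 0}) = (\<Sum>s\<in>S. if h s = 0 then 1 else (0 :: 'p mod_ring))"
    using assms by (simp add: sum.If_cases Int_def)
  then show ?thesis by (simp add: zero_indicator)
qed

text \<open>The power \<open>d ^ n\<close> with \<open>n = (p - 1) / 2\<close> is the quadratic character, viewed in the field
  itself.\<close>

lemma card_square_roots:
  fixes d :: "'p::prime_card mod_ring"
  assumes odd: "CARD('p) = 2 * n + 1" and n0: "n > 0"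
  shows "of_nat (card {w. w\<^sup>2 = d}) = 1 + d ^ n"
proof -
  let ?p = "CARD('p)"
  have "of_nat (card {w\<in>UNIV. w\<^sup>2 - d = 0}) = (\<Sum>w\<in>UNIV. 1 - (w\<^sup>2 - d) ^ (?p - 1))"
    by (rule of_nat_card_zeros) simp
  also have "\<dots> = - (\<Sum>w\<in>UNIV. (w\<^sup>2 - d) ^ (?p - 1))" by (simp add: sum_subtractf)
  also have "(\<Sum>w\<in>UNIV. (w\<^sup>2 - d) ^ (?p - 1)) = (\<Sum>w\<in>UNIV. \<Sum>k<?p. w ^ (2 * (?p - 1 - k)) * d ^ k)"
    unfolding diff_power_pred by (simp add: power_mult)
  also have "\<dots> = (\<Sum>k<?p. (\<Sum>w\<in>UNIV. w ^ (2 * (?p - 1 - k))) * d ^ k)"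
    by (subst sum.swap) (simp add: sum_distrib_right)
  also have "\<dots> = (\<Sum>k<?p. (if k = 0 \<or> k = n then - 1 else 0) * d ^ k)"
  proof (rule sum.cong)
    fix k assume k: "k \<in> {..<?p}"
    have "(0 < 2 * (?p - 1 - k) \<and> (?p - 1) dvd 2 * (?p - 1 - k)) \<longleftrightarrow> (k = 0 \<or> k = n)"
    proof
      assume *: "0 < 2 * (?p - 1 - k) \<and> (?p - 1) dvd 2 * (?p - 1 - k)"
      then have "2 * n dvd 2 * (2 * n - k)" "k < 2 * n" using odd by auto
      then obtain j where j: "2 * n - k = n * j" by (auto simp: dvd_def)
      then have "n * j \<le> n * 2" "n * j > 0" using \<open>k < 2 * n\<close> by linarith+
      then have "j = 1 \<or> j = 2" using n0 by auto
      then show "k = 0 \<or> k = n" using j \<open>k < 2 * n\<close> by auto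
    next
      assume "k = 0 \<or> k = n" then show "0 < 2 * (?p - 1 - k) \<and> (?p - 1) dvd 2 * (?p - 1 - k)" using odd n0 by auto
    qed
    then show "(\<Sum>w\<in>UNIV. w ^ (2 * (?p - 1 - k))) * d ^ k = (if k = 0 \<or> k = n then - 1 else 0) * d ^ k"
      unfolding power_sum_mod_ring by simp
  qed simp
  also have "\<dots> = (\<Sum>k\<in>{0, n}. - (d ^ k))"
    by (rule sum.mono_neutral_cong_right) (use odd in auto)
  also have "\<dots> = - (1 + d ^ n)" using n0 by simp
  finally show ?thesis by simp
qed

lemma euler_criterion_mod_ring:
  fixes d :: "'p::prime_card mod_ring"
  assumes odd: "CARD('p) = 2 * n + 1" and n0: "n > 0" and d: "d ^ n = 1"
  shows "\<exists>w. w\<^sup>2 = d"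
proof (rule ccontr)
  assume "\<not> ?thesis"
  then have "{w. w\<^sup>2 = d} = {}" by auto
  then have "(1 :: 'p mod_ring) + 1 = 0" using card_square_roots[OF odd n0, of d] d by simp
  then have "of_nat 2 = (0 :: 'p mod_ring)" by simp
  then show False unfolding char_dvd_of_nat using odd n0 by (auto dest: dvd_imp_le)
qed

lemma card_quadratic_roots:
  fixes m q :: "'p::prime_card mod_ring"
  assumes odd: "CARD('p) = 2 * n + 1" and n0: "n > 0"
  shows "of_nat (card {a. a * (m - a) = q}) = 1 + (m\<^sup>2 - 4 * q) ^ n"
proof -
  have "of_nat 2 \<noteq> (0 :: 'p mod_ring)" unfolding char_dvd_of_nat using odd n0 by (auto dest: dvd_imp_le)
  then have two: "(2 :: 'p mod_ring) \<noteq> 0" by simp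
  then have four: "(4 :: 'p mod_ring) \<noteq> 0" by (metis mult_eq_0_iff mult_2 numeral_Bit0)
  have "bij_betw (\<lambda>a. 2 * a - m) {a. a * (m - a) = q} {w. w\<^sup>2 = m\<^sup>2 - 4 * q}"
  proof (rule bij_betwI[where g = "\<lambda>w. (w + m) / 2"])
    have e: "(2 * a - m)\<^sup>2 = m\<^sup>2 - 4 * (a * (m - a))" for a by (simp add: algebra_simps power2_eq_square)
    show "(\<lambda>a. 2 * a - m) \<in> {a. a * (m - a) = q} \<rightarrow> {w. w\<^sup>2 = m\<^sup>2 - 4 * q}" using e by auto
    show "(\<lambda>w. (w + m) / 2) \<in> {w. w\<^sup>2 = m\<^sup>2 - 4 * q} \<rightarrow> {a. a * (m - a) = q}"
    proof
      fix w assume "w \<in> {w. w\<^sup>2 = m\<^sup>2 - 4 * q}"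
      then have w: "w\<^sup>2 = m\<^sup>2 - 4 * q" by simp
      define a where "a = (w + m) / 2"
      have "w = 2 * a - m" using two by (simp add: a_def)
      then have "4 * (a * (m - a)) = 4 * q" using w e[of a] by simp
      then have "a * (m - a) = q" using four by (metis mult_left_cancel)
      then show "(w + m) / 2 \<in> {a. a * (m - a) = q}" unfolding a_def by simp
    qed
  qed (use two in auto)
  then have "card {a. a * (m - a) = q} = card {w. w\<^sup>2 = m\<^sup>2 - 4 * q}" by (rule bij_betw_same_card)
  then show ?thesis by (simp only: card_square_roots[OF odd n0])
qed

section \<open>Counting points on the cubic attached to the Franel polynomial\<close>

text \<open>Only the exponents \<open>p - 1\<close> and \<open>2 (p - 1)\<close> contribute to the power sums. The second one
  occurs in a single boundary case and accounts for the last term.\<close>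

lemma binomial_power_sum:
  fixes m k :: nat
  assumes "m \<le> CARD('p) - 1" "k \<le> CARD('p) - 1"
  shows "(\<Sum>a\<in>UNIV. (a :: 'p::prime_card mod_ring) ^ m * (1 + a) ^ k)
     = - of_nat (k choose (CARD('p) - 1 - m)) - (if m = CARD('p) - 1 \<and> k = CARD('p) - 1 then 1 else 0)"
proof -
  let ?p = "CARD('p)"
  have p2: "?p \<ge> 2" using prime_ge_2_nat[OF prime_card[where ?'a='p]] .
  have "(\<Sum>a\<in>UNIV. (a :: 'p mod_ring) ^ m * (1 + a) ^ k) = (\<Sum>a\<in>UNIV. \<Sum>j\<le>k. of_nat (k choose j) * a ^ (m + j))"
  proof (rule sum.cong)
    fix a :: "'p mod_ring"
    have "(1 + a) ^ k = (a + 1) ^ k" by (simp add: add.commute)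
    also have "\<dots> = (\<Sum>j\<le>k. of_nat (k choose j) * a ^ j)" by (simp add: binomial_ring)
    finally show "a ^ m * (1 + a) ^ k = (\<Sum>j\<le>k. of_nat (k choose j) * a ^ (m + j))"
      by (simp add: sum_distrib_left power_add mult_ac)
  qed simp
  also have "\<dots> = (\<Sum>j\<le>k. of_nat (k choose j) * (\<Sum>a\<in>UNIV. (a :: 'p mod_ring) ^ (m + j)))"
    by (subst sum.swap) (simp add: sum_distrib_left)
  also have "\<dots> = (\<Sum>j\<le>k. (if j = ?p - 1 - m then - of_nat (k choose (?p - 1 - m)) else 0)
      + (if j = k then - (if m = ?p - 1 \<and> k = ?p - 1 then 1 else 0) else (0 :: 'p mod_ring)))"
  proof (rule sum.cong)
    fix j assume j: "j \<in> {..k}"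
    have iff: "0 < m + j \<and> (?p - 1) dvd (m + j) \<longleftrightarrow> m + j = ?p - 1 \<or> m + j = 2 * (?p - 1)"
    proof
      assume *: "0 < m + j \<and> (?p - 1) dvd (m + j)"
      then obtain i where i: "m + j = (?p - 1) * i" by (auto simp: dvd_def)
      have "m + j \<le> (?p - 1) + (?p - 1)" using assms j by (intro add_mono) auto
      then have "(?p - 1) * i \<le> (?p - 1) * 2" unfolding i by (simp only: mult_2_right)
      moreover have "(?p - 1) * i > 0" using * unfolding i by simp
      ultimately have "i = 1 \<or> i = 2" using p2 by auto
      then show "m + j = ?p - 1 \<or> m + j = 2 * (?p - 1)" using i by auto
    qed (use p2 in auto)
    consider "j = ?p - 1 - m" "m \<noteq> ?p - 1 \<or> k \<noteq> ?p - 1 \<or> j \<noteq> k" | "m = ?p - 1" "k = ?p - 1" "j = k"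
      | "j \<noteq> ?p - 1 - m" "m \<noteq> ?p - 1 \<or> k \<noteq> ?p - 1 \<or> j \<noteq> k" by blast
    then show "of_nat (k choose j) * (\<Sum>a\<in>UNIV. (a :: 'p mod_ring) ^ (m + j)) = (if j = ?p - 1 - m then - of_nat (k choose (?p - 1 - m)) else 0)
      + (if j = k then - (if m = ?p - 1 \<and> k = ?p - 1 then 1 else 0) else (0 :: 'p mod_ring))"
    proof cases
      case 1
      then have mj: "m + j = ?p - 1" using assms by simp
      have sm: "(\<Sum>a\<in>UNIV. (a :: 'p mod_ring) ^ (m + j)) = - 1" unfolding power_sum_mod_ring iff by (simp add: mj)
      have e: "?p - 1 - m = j" using 1(1) by (rule sym)
      show ?thesis unfolding sm e using 1(2) by (cases "j = k") simp_all
    next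
      case 2
      then have mj: "m + j = 2 * (?p - 1)" by simp
      have sm: "(\<Sum>a\<in>UNIV. (a :: 'p mod_ring) ^ (m + j)) = - 1" unfolding power_sum_mod_ring iff by (simp add: mj)
      have "j \<noteq> ?p - 1 - m" using 2 p2 by simp
      then show ?thesis unfolding sm using 2 by simp
    next
      case 3
      then have "m + j \<noteq> ?p - 1" "m + j \<noteq> 2 * (?p - 1)" using assms j by auto
      then have sm: "(\<Sum>a\<in>UNIV. (a :: 'p mod_ring) ^ (m + j)) = 0" unfolding power_sum_mod_ring iff by simp
      show ?thesis unfolding sm using 3 by (cases "j = k") simp_all
    qed
  qed simp
  also have "\<dots> = (if ?p - 1 - m \<le> k then - of_nat (k choose (?p - 1 - m)) else 0) - (if m = ?p - 1 \<and> k = ?p - 1 then 1 else 0)"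
    by (simp add: sum.distrib)
  also have "\<dots> = - of_nat (k choose (?p - 1 - m)) - (if m = ?p - 1 \<and> k = ?p - 1 then 1 else 0)"
    by (simp add: binomial_eq_0)
  finally show ?thesis .
qed

text \<open>The coefficient of \<open>t ^ k\<close> is a product of two binomial power sums for each term of
  \<open>(a + b) ^ k\<close>, which gives a sum of cubes of binomial coefficients. The boundary terms for
  \<open>k = p - 1\<close> contribute the 2.\<close>

lemma plane_curve_sum:
  fixes t :: "'p::prime_card mod_ring"
  assumes t0: "t \<noteq> 0"
  shows "(\<Sum>a\<in>UNIV. \<Sum>b\<in>UNIV. (a * b - t * ((a + b) * (1 + a) * (1 + b))) ^ (CARD('p) - 1)) = poly franel_poly t + 2"
proof -
  let ?p = "CARD('p)"
  have p2: "?p \<ge> 2" using prime_ge_2_nat[OF prime_card[where ?'a='p]] .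
  have separate: "(\<Sum>a\<in>UNIV. \<Sum>b\<in>UNIV. c * v a * w b) = c * ((\<Sum>a\<in>UNIV. v a) * (\<Sum>b\<in>UNIV. w b))"
    for c :: "'p mod_ring" and v w :: "'p mod_ring \<Rightarrow> 'p mod_ring"
    unfolding sum_product by (simp only: sum_distrib_left mult.assoc)
  define S where "S = (\<lambda>k. \<Sum>a\<in>UNIV. \<Sum>b\<in>(UNIV :: 'p mod_ring set). (a * b) ^ (?p - 1 - k) * ((a + b) * (1 + a) * (1 + b)) ^ k)"
  have S: "S k = of_nat (franel k) + (if k = ?p - 1 then 2 else 0)" if k: "k \<le> ?p - 1" for k
  proof -
    have "S k = (\<Sum>a\<in>UNIV. \<Sum>b\<in>UNIV. \<Sum>i\<le>k. of_nat (k choose i) * (a ^ (?p - 1 - k + i) * (1 + a) ^ k) * (b ^ (?p - 1 - i) * (1 + b) ^ k))"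
      unfolding S_def
    proof (intro sum.cong refl)
      fix a b :: "'p mod_ring"
      have "(a * b) ^ (?p - 1 - k) * ((a + b) * (1 + a) * (1 + b)) ^ k
        = (\<Sum>i\<le>k. of_nat (k choose i) * a ^ i * b ^ (k - i)) * (a ^ (?p - 1 - k) * b ^ (?p - 1 - k) * (1 + a) ^ k * (1 + b) ^ k)"
        unfolding binomial_ring[symmetric] by (simp add: power_mult_distrib mult_ac)
      also have "\<dots> = (\<Sum>i\<le>k. of_nat (k choose i) * (a ^ (?p - 1 - k + i) * (1 + a) ^ k) * (b ^ (?p - 1 - i) * (1 + b) ^ k))"
        unfolding sum_distrib_right
      proof (rule sum.cong)
        fix i assume "i \<in> {..k}"
        then have e: "?p - 1 - i = (?p - 1 - k) + (k - i)" using k by auto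
        show "of_nat (k choose i) * a ^ i * b ^ (k - i) * (a ^ (?p - 1 - k) * b ^ (?p - 1 - k) * (1 + a) ^ k * (1 + b) ^ k)
          = of_nat (k choose i) * (a ^ (?p - 1 - k + i) * (1 + a) ^ k) * (b ^ (?p - 1 - i) * (1 + b) ^ k)"
          unfolding e power_add by (simp only: mult_ac)
      qed simp
      finally show "(a * b) ^ (?p - 1 - k) * ((a + b) * (1 + a) * (1 + b)) ^ k
        = (\<Sum>i\<le>k. of_nat (k choose i) * (a ^ (?p - 1 - k + i) * (1 + a) ^ k) * (b ^ (?p - 1 - i) * (1 + b) ^ k))" .
    qed
    also have "\<dots> = (\<Sum>a\<in>UNIV. \<Sum>i\<le>k. \<Sum>b\<in>UNIV. of_nat (k choose i) * (a ^ (?p - 1 - k + i) * (1 + a) ^ k) * (b ^ (?p - 1 - i) * (1 + b) ^ k))"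
      by (rule sum.cong[OF refl], rule sum.swap)
    also have "\<dots> = (\<Sum>i\<le>k. \<Sum>a\<in>UNIV. \<Sum>b\<in>UNIV. of_nat (k choose i) * (a ^ (?p - 1 - k + i) * (1 + a) ^ k) * (b ^ (?p - 1 - i) * (1 + b) ^ k))"
      by (rule sum.swap)
    also have "\<dots> = (\<Sum>i\<le>k. of_nat (k choose i) * ((\<Sum>a\<in>UNIV. (a :: 'p mod_ring) ^ (?p - 1 - k + i) * (1 + a) ^ k) * (\<Sum>b\<in>UNIV. (b :: 'p mod_ring) ^ (?p - 1 - i) * (1 + b) ^ k)))"
      by (simp only: separate)
    also have "\<dots> = (\<Sum>i\<le>k. of_nat (k choose i) ^ 3 + (if i = k \<and> k = ?p - 1 then 1 else 0) + (if i = 0 \<and> k = ?p - 1 then 1 else 0))"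
    proof (rule sum.cong)
      fix i assume i: "i \<in> {..k}"
      have 1: "(\<Sum>a\<in>UNIV. (a :: 'p mod_ring) ^ (?p - 1 - k + i) * (1 + a) ^ k) = - of_nat (k choose i) - (if i = k \<and> k = ?p - 1 then 1 else 0)"
      proof -
        have "?p - 1 - (?p - 1 - k + i) = k - i" using k i by auto
        moreover have "(?p - 1 - k + i = ?p - 1 \<and> k = ?p - 1) \<longleftrightarrow> (i = k \<and> k = ?p - 1)" using k i by auto
        moreover have "k choose (k - i) = k choose i" using i binomial_symmetric[of i k] by simp
        moreover have "?p - 1 - k + i \<le> ?p - 1" using k i by auto
        ultimately show ?thesis using binomial_power_sum[of "?p - 1 - k + i" k, where ?'p='p] k by simp
      qed
      have 2: "(\<Sum>b\<in>UNIV. (b :: 'p mod_ring) ^ (?p - 1 - i) * (1 + b) ^ k) = - of_nat (k choose i) - (if i = 0 \<and> k = ?p - 1 then 1 else 0)"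
      proof -
        have "?p - 1 - (?p - 1 - i) = i" using k i by auto
        moreover have "(?p - 1 - i = ?p - 1 \<and> k = ?p - 1) \<longleftrightarrow> (i = 0 \<and> k = ?p - 1)" using k i p2 by auto
        ultimately show ?thesis using binomial_power_sum[of "?p - 1 - i" k, where ?'p='p] k by simp
      qed
      show "of_nat (k choose i) * ((\<Sum>a\<in>UNIV. (a :: 'p mod_ring) ^ (?p - 1 - k + i) * (1 + a) ^ k) * (\<Sum>b\<in>UNIV. (b :: 'p mod_ring) ^ (?p - 1 - i) * (1 + b) ^ k))
        = of_nat (k choose i) ^ 3 + (if i = k \<and> k = ?p - 1 then 1 else 0) + (if i = 0 \<and> k = ?p - 1 then 1 else 0)"
        unfolding 1 2 using p2 by (auto simp: power3_eq_cube algebra_simps)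
    qed simp
    also have "\<dots> = of_nat (franel k) + (if k = ?p - 1 then 2 else 0)"
      by (auto simp: sum.distrib franel_def)
    finally show ?thesis .
  qed
  have "(\<Sum>a\<in>UNIV. \<Sum>b\<in>UNIV. (a * b - t * ((a + b) * (1 + a) * (1 + b))) ^ (?p - 1))
     = (\<Sum>a\<in>UNIV. \<Sum>b\<in>(UNIV :: 'p mod_ring set). \<Sum>k<?p. t ^ k * ((a * b) ^ (?p - 1 - k) * ((a + b) * (1 + a) * (1 + b)) ^ k))"
    unfolding diff_power_pred by (simp add: power_mult_distrib mult_ac)
  also have "\<dots> = (\<Sum>a\<in>UNIV. \<Sum>k<?p. \<Sum>b\<in>(UNIV :: 'p mod_ring set). t ^ k * ((a * b) ^ (?p - 1 - k) * ((a + b) * (1 + a) * (1 + b)) ^ k))"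
    by (rule sum.cong[OF refl], rule sum.swap)
  also have "\<dots> = (\<Sum>k<?p. \<Sum>a\<in>UNIV. \<Sum>b\<in>(UNIV :: 'p mod_ring set). t ^ k * ((a * b) ^ (?p - 1 - k) * ((a + b) * (1 + a) * (1 + b)) ^ k))"
    by (rule sum.swap)
  also have "\<dots> = (\<Sum>k<?p. t ^ k * S k)" unfolding S_def by (simp only: sum_distrib_left)
  also have "\<dots> = (\<Sum>k<?p. of_nat (franel k) * t ^ k + (if k = ?p - 1 then t ^ (?p - 1) * 2 else 0))"
    by (rule sum.cong) (auto simp: S algebra_simps)
  also have "\<dots> = poly franel_poly t + 2"
    unfolding sum.distrib poly_franel_poly using p2 t0 by (simp add: fermat_mod_ring_unit[unfolded One_nat_def])
  finally show ?thesis .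
qed

text \<open>The sum in \<open>plane_curve_sum\<close> counts zeros, since \<open>1 - u ^ (p - 1)\<close> is the indicator of
  \<open>u = 0\<close>. For a fixed value \<open>m\<close> of \<open>a + b\<close> the equation is quadratic in \<open>a\<close> and its
  solutions are counted by the quadratic character of the discriminant \<open>q m\<close>. The
  substitution \<open>m = 4 \<mu> / (4 - z)\<close> turns the quartic \<open>q\<close> into the cubic \<open>h\<close> up to a square
  factor.\<close>

lemma franel_poly_point_count:
  fixes \<mu> :: "'p::prime_card mod_ring"
  assumes odd: "CARD('p) = 2 * n + 1" and n0: "n > 0" and l: "\<mu> \<noteq> 0" "\<mu> \<noteq> - 1"
  shows "poly franel_poly (inverse \<mu>) = - (\<Sum>z\<in>UNIV. (z * (z\<^sup>2 + (\<mu>\<^sup>2 - 4 * \<mu> - 8) * z + 16 * (1 + \<mu>))) ^ n)"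
proof -
  let ?p = "CARD('p)"
  define t where "t = inverse \<mu>"
  have tl: "t * \<mu> = 1" using l by (simp add: t_def)
  have t0: "t \<noteq> 0" using l by (simp add: t_def)
  have "of_nat 2 \<noteq> (0 :: 'p mod_ring)" unfolding char_dvd_of_nat using odd n0 by (auto dest: dvd_imp_le)
  then have two: "(2 :: 'p mod_ring) \<noteq> 0" by simp
  then have four: "(4 :: 'p mod_ring) \<noteq> 0" by (metis mult_eq_0_iff mult_2 numeral_Bit0)
  have sq: "(c * u\<^sup>2) ^ n = c ^ n" if "u \<noteq> 0" for c u :: "'p mod_ring"
    using fermat_mod_ring_unit[OF that] odd by (simp add: power_mult_distrib flip: power_mult)
  \<comment> \<open>the number of points with \<open>a + b = m\<close>\<close>
  define N where "N = (\<lambda>m. card {a. a * (m - a) = t * (m * (1 + m + a * (m - a)))})"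
  have cnt: "(\<Sum>m\<in>UNIV. (of_nat (N m) :: 'p mod_ring)) = - (poly franel_poly t + 2)"
  proof -
    have "(\<Sum>m\<in>UNIV. (of_nat (N m) :: 'p mod_ring)) = (\<Sum>m\<in>UNIV. \<Sum>a\<in>UNIV. 1 - (a * (m - a) - t * (m * (1 + m + a * (m - a)))) ^ (?p - 1))"
    proof (rule sum.cong)
      fix m :: "'p mod_ring"
      have "N m = card {a\<in>UNIV. a * (m - a) - t * (m * (1 + m + a * (m - a))) = 0}" by (simp add: N_def)
      then show "of_nat (N m) = (\<Sum>a\<in>UNIV. 1 - (a * (m - a) - t * (m * (1 + m + a * (m - a)))) ^ (?p - 1))"
        by (simp only: of_nat_card_zeros[OF finite])
    qed simp
    also have "\<dots> = - (\<Sum>m\<in>UNIV. \<Sum>a\<in>UNIV. (a * (m - a) - t * (m * (1 + m + a * (m - a)))) ^ (?p - 1))"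
      by (simp add: sum_subtractf sum_negf)
    also have "(\<Sum>m\<in>UNIV. \<Sum>a\<in>UNIV. (a * (m - a) - t * (m * (1 + m + a * (m - a)))) ^ (?p - 1))
      = (\<Sum>a\<in>UNIV. \<Sum>m\<in>UNIV. (a * (m - a) - t * (m * (1 + m + a * (m - a)))) ^ (?p - 1))" by (rule sum.swap)
    also have "\<dots> = (\<Sum>a\<in>UNIV. \<Sum>b\<in>UNIV. (a * b - t * ((a + b) * (1 + a) * (1 + b))) ^ (?p - 1))"
    proof (rule sum.cong)
      fix a :: "'p mod_ring"
      have "bij (\<lambda>b. a + b)" by (rule bij_plus_right[of a, unfolded add.commute[of _ a]])
      then have "(\<Sum>m\<in>UNIV. (a * (m - a) - t * (m * (1 + m + a * (m - a)))) ^ (?p - 1))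
        = (\<Sum>b\<in>UNIV. (a * ((a + b) - a) - t * ((a + b) * (1 + (a + b) + a * ((a + b) - a)))) ^ (?p - 1))"
        using sum.reindex_bij_betw[of "\<lambda>b. a + b" UNIV UNIV "\<lambda>m. (a * (m - a) - t * (m * (1 + m + a * (m - a)))) ^ (?p - 1)"] by simp
      also have "\<dots> = (\<Sum>b\<in>UNIV. (a * b - t * ((a + b) * (1 + a) * (1 + b))) ^ (?p - 1))"
      proof (rule sum.cong)
        fix b
        have "a * ((a + b) - a) - t * ((a + b) * (1 + (a + b) + a * ((a + b) - a))) = a * b - t * ((a + b) * (1 + a) * (1 + b))"
          by (simp add: algebra_simps)
        then show "(a * ((a + b) - a) - t * ((a + b) * (1 + (a + b) + a * ((a + b) - a)))) ^ (?p - 1) = (a * b - t * ((a + b) * (1 + a) * (1 + b))) ^ (?p - 1)"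
          by (simp only:)
      qed simp
      finally show "(\<Sum>m\<in>UNIV. (a * (m - a) - t * (m * (1 + m + a * (m - a)))) ^ (?p - 1)) = (\<Sum>b\<in>UNIV. (a * b - t * ((a + b) * (1 + a) * (1 + b))) ^ (?p - 1))" .
    qed simp
    also have "\<dots> = poly franel_poly t + 2" by (rule plane_curve_sum[OF t0])
    finally show ?thesis .
  qed
  define h where "h = (\<lambda>z. z * (z\<^sup>2 + (\<mu>\<^sup>2 - 4 * \<mu> - 8) * z + 16 * (1 + \<mu>)))"
  define q where "q = (\<lambda>m. m * (\<mu> - m) * (m * (\<mu> - m) - 4 * (1 + m)))"
  \<comment> \<open>for \<open>m = \<mu>\<close> the quadratic equation degenerates and has no solution\<close>
  have Nm: "(of_nat (N m) :: 'p mod_ring) = (if m = \<mu> then 0 else 1) + q m ^ n" for m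
  proof (cases "m = \<mu>")
    case True
    have "a * (m - a) \<noteq> t * (m * (1 + m + a * (m - a)))" for a
    proof
      assume "a * (m - a) = t * (m * (1 + m + a * (m - a)))"
      also have "\<dots> = (t * \<mu>) * (1 + \<mu>) + (t * \<mu>) * (a * (m - a))" by (simp add: True algebra_simps)
      finally have "1 + \<mu> = 0" unfolding tl by simp
      then show False using l by (simp add: add_eq_0_iff)
    qed
    then show ?thesis using True n0 by (simp add: N_def q_def)
  next
    case False
    define d where "d = \<mu> - m"
    have d0: "d \<noteq> 0" using False by (simp add: d_def)
    have td: "1 - t * m = t * d" using tl by (simp add: d_def algebra_simps)
    have iff: "a * (m - a) = t * (m * (1 + m + a * (m - a))) \<longleftrightarrow> a * (m - a) = m * (1 + m) / d" for a
    proof -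
      have "a * (m - a) = t * (m * (1 + m + a * (m - a))) \<longleftrightarrow> (1 - t * m) * (a * (m - a)) = t * (m * (1 + m))"
        by (auto simp: algebra_simps)
      also have "\<dots> \<longleftrightarrow> t * (d * (a * (m - a))) = t * (m * (1 + m))" unfolding td by (simp only: mult.assoc)
      also have "\<dots> \<longleftrightarrow> d * (a * (m - a)) = m * (1 + m)" using t0 by (metis mult_left_cancel)
      also have "\<dots> \<longleftrightarrow> a * (m - a) = m * (1 + m) / d" using d0 by (metis nonzero_eq_divide_eq mult.commute)
      finally show ?thesis .
    qed
    have "(of_nat (N m) :: 'p mod_ring) = 1 + (m\<^sup>2 - 4 * (m * (1 + m) / d)) ^ n"
      unfolding N_def iff by (rule card_quadratic_roots[OF odd n0])
    also have "(m\<^sup>2 - 4 * (m * (1 + m) / d)) ^ n = ((m\<^sup>2 - 4 * (m * (1 + m) / d)) * d\<^sup>2) ^ n" by (rule sq[OF d0, symmetric])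
    also have "(m\<^sup>2 - 4 * (m * (1 + m) / d)) * d\<^sup>2 = q m"
    proof -
      have "(m\<^sup>2 - 4 * (m * (1 + m) / d)) * d\<^sup>2 = m\<^sup>2 * d\<^sup>2 - 4 * (m * (1 + m)) * d"
        using d0 by (simp add: left_diff_distrib power2_eq_square)
      moreover have "q m = m * d * (m * d - 4 * (1 + m))" by (simp add: q_def d_def)
      ultimately show ?thesis by (simp add: algebra_simps power2_eq_square)
    qed
    finally show ?thesis using False by simp
  qed
  have "(\<Sum>m\<in>UNIV. (of_nat (N m) :: 'p mod_ring)) = - 1 + (\<Sum>m\<in>UNIV. q m ^ n)"
  proof -
    have "(\<Sum>m\<in>UNIV. if m = \<mu> then 0 else (1 :: 'p mod_ring)) = (\<Sum>m\<in>UNIV. 1 - (if m = \<mu> then 1 else 0))"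
      by (rule sum.cong) auto
    also have "\<dots> = -1" by (simp add: sum_subtractf)
    finally show ?thesis unfolding Nm sum.distrib by simp
  qed
  moreover have "(\<Sum>m\<in>UNIV. q m ^ n) = (\<Sum>z\<in>UNIV. h z ^ n) - 1"
  proof -
    have "(\<Sum>m\<in>UNIV. q m ^ n) = (\<Sum>m\<in>UNIV - {0}. q m ^ n)"
      by (rule sum.mono_neutral_right) (use n0 in \<open>auto simp: q_def\<close>)
    also have "\<dots> = (\<Sum>z\<in>UNIV - {4}. q (4 * \<mu> / (4 - z)) ^ n)"
    proof (rule sum.reindex_bij_betw[symmetric])
      show "bij_betw (\<lambda>z. 4 * \<mu> / (4 - z)) (UNIV - {4}) (UNIV - {0})"
      proof (rule bij_betwI[where g = "\<lambda>m. 4 - 4 * \<mu> / m"])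
        show "(\<lambda>z. 4 * \<mu> / (4 - z)) \<in> UNIV - {4} \<rightarrow> UNIV - {0}" using four l by auto
        show "(\<lambda>m. 4 - 4 * \<mu> / m) \<in> UNIV - {0} \<rightarrow> UNIV - {4}" using four l by auto
      qed (use four l in auto)
    qed
    also have "\<dots> = (\<Sum>z\<in>UNIV - {4}. h z ^ n)"
    proof (rule sum.cong)
      fix z :: "'p mod_ring" assume "z \<in> UNIV - {4}"
      then have w0: "4 - z \<noteq> 0" by auto
      define w where "w = 4 - z"
      define m where "m = 4 * \<mu> / w"
      have mw: "m * w = 4 * \<mu>" using w0 by (simp add: m_def w_def)
      have l4: "4 * \<mu> \<noteq> 0" using four l by simp
      have "q m * (w\<^sup>2)\<^sup>2 = (m * w) * (\<mu> * w - (m * w)) * ((m * w) * (\<mu> * w - (m * w)) - 4 * (w * w + (m * w) * w))"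
        by (simp add: q_def algebra_simps power2_eq_square)
      also have "\<dots> = h z * (4 * \<mu>)\<^sup>2"
        unfolding mw unfolding h_def w_def by (simp add: algebra_simps power2_eq_square)
      finally have "q m * (w\<^sup>2)\<^sup>2 = h z * (4 * \<mu>)\<^sup>2" .
      then have "q m ^ n = h z ^ n" using sq[of "w\<^sup>2" "q m"] sq[OF l4, of "h z"] w0 by (simp add: w_def)
      then show "q (4 * \<mu> / (4 - z)) ^ n = h z ^ n" by (simp add: m_def w_def)
    qed simp
    also have "\<dots> = (\<Sum>z\<in>UNIV. h z ^ n) - h 4 ^ n" by (simp add: sum_diff1)
    \<comment> \<open>the value \<open>z = 4\<close> corresponds to \<open>m\<close> at infinity and has to be removed\<close>
    also have "h 4 ^ n = 1"
    proof -
      have "h 4 = 1 * (4 * \<mu>)\<^sup>2" by (simp add: h_def algebra_simps power2_eq_square)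
      then show ?thesis using sq[of "4 * \<mu>" 1] four l by simp
    qed
    finally show ?thesis .
  qed
  ultimately have "- (poly franel_poly t + 2) = (\<Sum>z\<in>UNIV. h z ^ n) - 2" using cnt by simp
  then have "- poly franel_poly t = (\<Sum>z\<in>UNIV. h z ^ n)" by simp
  then have "- (- poly franel_poly t) = - (\<Sum>z\<in>UNIV. h z ^ n)" by (rule arg_cong)
  then have "poly franel_poly t = - (\<Sum>z\<in>UNIV. h z ^ n)" by (simp only: minus_minus)
  then show ?thesis unfolding t_def h_def .
qed

section \<open>Quadratic residues and primes of the form x^2 + 6 y^2\<close>

lemma char_dvd_of_int: "of_int i = (0 :: 'p::prime_card mod_ring) \<longleftrightarrow> int CARD('p) dvd i"
proof -
  have "of_int i = (0 :: 'p mod_ring) \<longleftrightarrow> of_nat (nat \<bar>i\<bar>) = (0 :: 'p mod_ring)"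
    by (cases i rule: int_cases2) simp_all
  also have "\<dots> \<longleftrightarrow> int CARD('p) dvd i" unfolding char_dvd_of_nat by (simp add: int_dvd_int_iff[symmetric])
  finally show ?thesis .
qed

text \<open>By Gauss's lemma the Legendre symbol of 2 is given by the number of even numbers in
  \<open>{n<..2 * n}\<close>, where \<open>n = (p - 1) / 2\<close>.\<close>

lemma two_quadratic_residue:
  assumes p: "prime p" and m: "p mod 8 = 1 \<or> p mod 8 = 7"
  shows "\<exists>y. [y\<^sup>2 = 2] (mod int p)"
proof -
  have "p \<noteq> 1" using p by auto
  then have p7: "p \<ge> 7" using m by presburger
  have n2: "\<not> int p dvd 2" using p7 by (auto dest: zdvd_imp_le)
  interpret GAUSS p 2
    by unfold_locales (use p p7 n2 in \<open>auto simp: cong_0_iff\<close>)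
  define n where "n = (int p - 1) div 2"
  have "C = (\<lambda>x. x mod int p) ` ((\<lambda>x. x * 2) ` {0<..n})" by (simp add: C_def B_def A_def n_def)
  also have "\<dots> = (\<lambda>x. x * 2) ` {0<..n}" unfolding image_image
    by (rule image_cong) (use p_eq2 in \<open>auto simp: n_def\<close>)
  finally have "E = (\<lambda>x. x * 2) ` {0<..n} \<inter> {n<..}" by (simp add: E_def n_def)
  also have "\<dots> = (\<lambda>x. x * 2) ` {n div 2<..n}" by (auto simp: image_iff)
  finally have "card E = card {n div 2<..n}" by (simp add: card_image inj_on_def)
  also have "\<dots> = nat (n - n div 2)" by simp
  finally have "card E = nat (n - n div 2)" .
  moreover have "even (n - n div 2)" "n - n div 2 \<ge> 0" using m p7 unfolding n_def by presburger+
  ultimately have "even (card E)" by (simp add: even_nat_iff)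
  then have "Legendre 2 (int p) = 1" using gauss_lemma by simp
  then show ?thesis by (auto simp: Legendre_def QuadRes_def split: if_splits)
qed

text \<open>There are more than \<open>p\<close> pairs of numbers up to the integer part of the square root of \<open>p\<close>,
  so two of them give the same residue of \<open>a - u b\<close>.\<close>

lemma thue:
  assumes p: "prime (p::nat)"
  shows "\<exists>a b :: int. (a \<noteq> 0 \<or> b \<noteq> 0) \<and> a\<^sup>2 < int p \<and> b\<^sup>2 < int p \<and> int p dvd a - u * b"
proof -
  define s :: nat where "s = floor_sqrt p"
  have s1: "s\<^sup>2 \<le> p" unfolding s_def by (rule floor_sqrt_power2_le)
  have s2: "p < (s + 1)\<^sup>2" unfolding s_def using Suc_floor_sqrt_power2_gt[of p] by simp
  have "s\<^sup>2 \<noteq> p"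
  proof
    assume "s\<^sup>2 = p"
    then have "prime (s ^ 2)" using p by simp
    then show False by (simp add: prime_power_iff)
  qed
  then have s3: "s\<^sup>2 < p" using s1 by simp
  define D where "D = {0..s} \<times> {0..s}"
  define f where "f = (\<lambda>(i, j). (int i - u * int j) mod int p)"
  have p0: "int p > 0" using p prime_gt_0_nat by simp
  have "f ` D \<subseteq> {0..<int p}" using p0 by (auto simp: f_def)
  then have "card (f ` D) \<le> p" using card_mono[of "{0..<int p}" "f ` D"] by simp
  also have "p < card D" using s2 by (simp add: D_def power2_eq_square)
  finally have "\<not> inj_on f D" using pigeonhole by blast
  then obtain i j i' j' where d: "(i, j) \<in> D" "(i', j') \<in> D" "(i, j) \<noteq> (i', j')" "f (i, j) = f (i', j')"
    unfolding inj_on_def by auto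
  have bound: "(int k - int l)\<^sup>2 < int p" if "k \<le> s" "l \<le> s" for k l
  proof -
    have "\<bar>int k - int l\<bar> \<le> \<bar>int s\<bar>" using that by auto
    then have "(int k - int l)\<^sup>2 \<le> (int s)\<^sup>2" by (simp only: abs_le_square_iff)
    also have "\<dots> = int (s\<^sup>2)" by simp
    also have "\<dots> < int p" using s3 by (simp only: of_nat_less_iff)
    finally show ?thesis .
  qed
  have "int p dvd (int i - u * int j) - (int i' - u * int j')" using d(4) by (simp add: f_def mod_eq_dvd_iff)
  then have "int p dvd (int i - int i') - u * (int j - int j')" by (simp add: algebra_simps)
  then show ?thesis using d bound by (intro exI[of _ "int i - int i'"] exI[of _ "int j - int j'"]) (auto simp: D_def)
qed

lemma square_mod_3: "(a::int)\<^sup>2 mod 3 = 0 \<and> 3 dvd a \<or> a\<^sup>2 mod 3 = 1"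
proof -
  have "a mod 3 = 0 \<or> a mod 3 = 1 \<or> a mod 3 = 2" by presburger
  then show ?thesis
  proof (elim disjE)
    assume "a mod 3 = 2"
    then show ?thesis using power_mod[of a 3 2] by simp
  qed (use power_mod[of a 3 2] in \<open>auto simp: mod_eq_0_iff_dvd\<close>)
qed

text \<open>Thue's lemma gives \<open>a\<^sup>2 + 6 b\<^sup>2 = k p\<close> with \<open>k < 7\<close>. The values 2, 3 and 5 of \<open>k\<close> are
  impossible modulo 3, the value 3 after dividing by 3. For \<open>k = 4\<close> both \<open>a\<close> and \<open>b\<close> are
  even, and for \<open>k = 6\<close> the number \<open>a\<close> is divisible by 6, which exchanges the two squares.\<close>

lemma represented_by_x2_6y2:
  assumes p: "prime (p::nat)" and m3: "p mod 3 = 1" and u: "int p dvd u\<^sup>2 + 6"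
  shows "\<exists>x y :: int. int p = x\<^sup>2 + 6 * y\<^sup>2"
proof -
  obtain a b where ab: "a \<noteq> 0 \<or> b \<noteq> 0" "a\<^sup>2 < int p" "b\<^sup>2 < int p" "int p dvd a - u * b" using thue[OF p, of u] by blast
  have "a\<^sup>2 + 6 * b\<^sup>2 = (a - u * b) * (a + u * b) + (u\<^sup>2 + 6) * b\<^sup>2" by (simp add: algebra_simps power2_eq_square)
  then have "int p dvd a\<^sup>2 + 6 * b\<^sup>2" using ab(4) u by (metis dvd_add dvd_mult2)
  then obtain k where k: "a\<^sup>2 + 6 * b\<^sup>2 = int p * k" by (elim dvdE)
  have p0: "int p > 0" using p prime_gt_0_nat by simp
  have "0 < a\<^sup>2 + 6 * b\<^sup>2" using ab(1) zero_le_power2[of a] zero_le_power2[of b]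
    by (cases "a = 0") (auto simp: add_pos_nonneg)
  then have k0: "k > 0" using k p0 by (simp add: zero_less_mult_iff)
  have "int p * k < int p * 7" using k ab by linarith
  then have "k < 7" using p0 by simp
  then consider "k = 1" | "k = 2" | "k = 3" | "k = 4" | "k = 5" | "k = 6" using k0 by linarith
  then show ?thesis
  proof cases
    case 1
    then have "int p = a\<^sup>2 + 6 * b\<^sup>2" using k by simp
    then show ?thesis by blast
  next
    case 2
    note k = k[unfolded this]
    have "a\<^sup>2 mod 3 = 2" using k m3 by presburger
    then show ?thesis using square_mod_3[of a] by simp
  next
    case 3
    note k = k[unfolded this]
    have "a\<^sup>2 mod 3 = 0" using k by presburger
    then obtain c where c: "a = 3 * c" using square_mod_3[of a] by (auto simp: dvd_def)
    then have "3 * c\<^sup>2 + 2 * b\<^sup>2 = int p" using k by (simp add: power2_eq_square)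
    then have "2 * b\<^sup>2 mod 3 = 1" using m3 by presburger
    then have False using square_mod_3[of b] by presburger
    then show ?thesis by blast
  next
    case 4
    note k = k[unfolded this]
    have "a\<^sup>2 = 2 * (2 * int p - 3 * b\<^sup>2)" using k by simp
    then have "2 dvd a\<^sup>2" by (rule dvdI)
    then obtain c where c: "a = 2 * c" by (auto elim!: evenE)
    then have e: "2 * c\<^sup>2 + 3 * b\<^sup>2 = 2 * int p" using k by (simp add: power2_eq_square)
    then have "b\<^sup>2 = 2 * (int p - c\<^sup>2 - b\<^sup>2)" by simp
    then have "2 dvd b\<^sup>2" by (rule dvdI)
    then obtain d where "b = 2 * d" by (auto elim!: evenE)
    then have "int p = c\<^sup>2 + 6 * d\<^sup>2" using e by (simp add: power2_eq_square)
    then show ?thesis by blast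
  next
    case 5
    note k = k[unfolded this]
    have "a\<^sup>2 mod 3 = 2" using k m3 by presburger
    then show ?thesis using square_mod_3[of a] by simp
  next
    case 6
    note k = k[unfolded this]
    have "a\<^sup>2 mod 3 = 0" using k by presburger
    then have "3 dvd a" using square_mod_3[of a] by auto
    moreover have "2 dvd a"
    proof -
      have "a\<^sup>2 = 2 * (3 * int p - 3 * b\<^sup>2)" using k by simp
      then have "2 dvd a\<^sup>2" by (rule dvdI)
      then show ?thesis by simp
    qed
    ultimately have "6 dvd a" by presburger
    then obtain c where "a = 6 * c" by (elim dvdE)
    then have "int p = b\<^sup>2 + 6 * c\<^sup>2" using k by (simp add: power2_eq_square)
    then show ?thesis by blast
  qed
qed

text \<open>An element of order 3 is \<open>(-1 + w) / 2\<close> with \<open>w\<^sup>2 = -3\<close>.\<close>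

lemma sqrt_minus_3_exists:
  assumes "CARD('p) mod 3 = 1"
  shows "\<exists>w :: 'p::prime_card mod_ring. w\<^sup>2 = - 3"
proof -
  have p: "prime CARD('p)" by (rule prime_card)
  define e where "e = (CARD('p) - 1) div 3"
  have "CARD('p) \<noteq> 1" using p by auto
  then have "0 < e" "e < CARD('p) - 1" and e3: "e * 3 = CARD('p) - 1" using assms unfolding e_def by presburger+
  then obtain g :: "'p mod_ring" where g: "g \<noteq> 0" "g ^ e \<noteq> 1" using exists_power_neq_1 by blast
  define \<omega> where "\<omega> = g ^ e"
  have "\<omega> ^ 3 = 1" unfolding \<omega>_def power_mult[symmetric] e3 by (rule fermat_mod_ring_unit[OF g(1)])
  then have "(\<omega> - 1) * (\<omega>\<^sup>2 + \<omega> + 1) = 0" by (simp add: algebra_simps power2_eq_square power3_eq_cube)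
  then have "\<omega>\<^sup>2 + \<omega> + 1 = 0" using g(2) by (simp add: \<omega>_def)
  moreover have "(2 * \<omega> + 1)\<^sup>2 = 4 * (\<omega>\<^sup>2 + \<omega> + 1) - 3" by (simp add: algebra_simps power2_eq_square)
  ultimately show ?thesis by auto
qed

text \<open>A square root of \<open>-3\<close> would give an element of order 3, but 3 does not divide \<open>p - 1\<close>.\<close>

lemma no_sqrt_minus_3:
  fixes w :: "'p::prime_card mod_ring"
  assumes "CARD('p) mod 3 = 2" "CARD('p) > 3"
  shows "w\<^sup>2 \<noteq> - 3"
proof
  assume w: "w\<^sup>2 = - 3"
  have nz: "of_nat k \<noteq> (0::'p mod_ring)" if "0 < k" "k < CARD('p)" for k
    using that by (simp add: char_dvd_of_nat nat_dvd_not_less)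
  have two: "(2::'p mod_ring) \<noteq> 0" and three: "(3::'p mod_ring) \<noteq> 0" using nz[of 2] nz[of 3] assms(2) by simp_all
  define \<omega> where "\<omega> = (w - 1) / 2"
  have "w = 2 * \<omega> + 1" using two by (simp add: \<omega>_def)
  then have "(2 * 2) * (\<omega>\<^sup>2 + \<omega> + 1) = 0" using w by (simp add: algebra_simps power2_eq_square)
  then have q: "\<omega>\<^sup>2 + \<omega> + 1 = 0" using two by (metis mult_eq_0_iff)
  have "\<omega> ^ 3 - 1 = (\<omega> - 1) * (\<omega>\<^sup>2 + \<omega> + 1)" by (simp add: algebra_simps power2_eq_square power3_eq_cube)
  then have c: "\<omega> ^ 3 = 1" unfolding q by simp
  then have "\<omega> \<noteq> 0" by auto
  then have f: "\<omega> ^ (CARD('p) - 1) = 1" by (rule fermat_mod_ring_unit)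
  define j where "j = CARD('p) div 3"
  have "CARD('p) - 1 = 3 * j + 1" using assms(1) unfolding j_def by presburger
  then have "\<omega> = 1" using f c by (simp add: power_add power_mult)
  then show False using q three by simp
qed

text \<open>At \<open>\<mu> = 8\<close> the cubic is \<open>z (z + 12)\<^sup>2\<close>, so the character sum is the sum of all \<open>z ^ n\<close>,
  which is zero, without the term for \<open>z = -12\<close>.\<close>

lemma franel_poly_one_eighth:
  assumes m3: "CARD('p) mod 3 = 2" and big: "CARD('p) > 3"
  shows "poly franel_poly (1 / 8) = (- 1 :: 'p::prime_card mod_ring)"
proof -
  let ?p = "CARD('p)"
  have "odd ?p" using prime_card[where ?'a='p] big prime_odd_nat by simp
  then obtain n where pn: "?p = 2 * n + 1" by (elim oddE)
  have n0: "n > 0" using big pn by simp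
  have nz: "of_nat k \<noteq> (0::'p mod_ring)" if "0 < k" "k < ?p" for k
    using that by (simp add: char_dvd_of_nat nat_dvd_not_less)
  have two: "(2::'p mod_ring) \<noteq> 0" and three: "(3::'p mod_ring) \<noteq> 0" using nz[of 2] nz[of 3] big by simp_all
  have l: "(8::'p mod_ring) \<noteq> 0" "(8::'p mod_ring) \<noteq> - 1"
    using power_not_zero[OF two, of 3] power_not_zero[OF three, of 2] by (simp_all add: eq_neg_iff_add_eq_0)
  have fl: "z ^ n * z ^ n = 1" if "z \<noteq> 0" for z :: "'p mod_ring"
    using fermat_mod_ring_unit[OF that] pn by (simp add: mult_2 flip: power_add)
  have "(\<Sum>z\<in>UNIV. (z * (z\<^sup>2 + (8\<^sup>2 - 4 * 8 - 8) * z + 16 * (1 + 8))) ^ n)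
      = (\<Sum>z\<in>(UNIV :: 'p mod_ring set). z ^ n - (if z = - 12 then (- 12) ^ n else 0))"
  proof (rule sum.cong)
    fix z :: "'p mod_ring"
    have "z * (z\<^sup>2 + (8\<^sup>2 - 4 * 8 - 8) * z + 16 * (1 + 8)) = z * ((z + 12) * (z + 12))"
      by (simp add: algebra_simps power2_eq_square)
    then have "(z * (z\<^sup>2 + (8\<^sup>2 - 4 * 8 - 8) * z + 16 * (1 + 8))) ^ n = z ^ n * ((z + 12) ^ n * (z + 12) ^ n)"
      by (simp only: power_mult_distrib)
    also have "\<dots> = z ^ n - (if z = - 12 then (- 12) ^ n else 0)"
      using fl[of "z + 12"] n0 by (cases "z = - 12") (auto simp: add_eq_0_iff2)
    finally show "(z * (z\<^sup>2 + (8\<^sup>2 - 4 * 8 - 8) * z + 16 * (1 + 8))) ^ n = z ^ n - (if z = - 12 then (- 12) ^ n else 0)" .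
  qed simp
  also have "\<dots> = - ((- 12) ^ n)"
    using n0 pn by (simp add: sum_subtractf power_sum_mod_ring)
  finally have "poly franel_poly (1 / 8) = (- 12 :: 'p mod_ring) ^ n"
    using franel_poly_point_count[OF pn n0 l] by (simp add: inverse_eq_divide)
  also have "\<dots> = ((- 3) * (2 * 2)) ^ n" by simp
  also have "\<dots> = (- 3) ^ n * (2 ^ n * 2 ^ n)" by (simp only: power_mult_distrib)
  also have "\<dots> = (- 3) ^ n" unfolding fl[OF two] by simp
  also have "\<dots> = - 1"
  proof -
    have "(- 3 :: 'p mod_ring) ^ n * (- 3) ^ n = 1" by (rule fl) (use three in simp)
    then have "((- 3 :: 'p mod_ring) ^ n - 1) * ((- 3) ^ n + 1) = 0" by (simp add: algebra_simps)
    moreover have "(- 3 :: 'p mod_ring) ^ n \<noteq> 1"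
      using euler_criterion_mod_ring[OF pn n0] no_sqrt_minus_3[OF m3 big] by blast
    ultimately show ?thesis by (auto simp: eq_neg_iff_add_eq_0)
  qed
  finally show ?thesis .
qed

lemma sum_supersingular:
  fixes r :: "'p::prime_card mod_ring"
  assumes m3: "CARD('p) mod 3 = 2" and big: "CARD('p) > 3" and r: "r\<^sup>2 = 2"
  shows "(\<Sum>k<CARD('p). of_nat (franel_term k) / 32 ^ k) = (0 :: 'p mod_ring)"
proof -
  let ?t = "inverse (8 + 6 * r)"
  have "odd CARD('p)" using prime_card[where ?'a='p] big prime_odd_nat by simp
  then obtain n where pn: "CARD('p) = 2 * n + 1" by (elim oddE)
  have n1: "n > 1" using big pn by simp
  have "of_nat 2 \<noteq> (0 :: 'p mod_ring)" unfolding char_dvd_of_nat using big by (auto dest: dvd_imp_le)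
  then have two: "(2 :: 'p mod_ring) \<noteq> 0" by simp
  have "poly franel_poly ?t = - poly franel_poly ?t" using franel_poly_fixed_point[OF big r] unfolding franel_poly_one_eighth[OF m3 big] by simp
  then have "2 * poly franel_poly ?t = 0" by (simp only: eq_neg_iff_add_eq_0 mult_2)
  then have "poly franel_poly ?t = 0" using two by simp
  then show ?thesis unfolding sum_eq_franel_poly_square[OF pn n1 r] by simp
qed

text \<open>The factor \<open>\<kappa> = 4 (1 + r)\<close> rescales the cubic at \<open>\<mu> = 8 + 6 r\<close> to the cubic of \<open>cm_trace\<close>.
  It changes the character sum by a sign only, which disappears in the square.\<close>

lemma sum_ordinary:
  fixes r :: "'p::prime_card mod_ring" and x y :: nat
  assumes p: "CARD('p) = x\<^sup>2 + 6 * y\<^sup>2" and r: "r\<^sup>2 = 2"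
    and big: "CARD('p) > 3" "CARD('p) \<noteq> 17" "CARD('p) \<noteq> 23"
  shows "(\<Sum>k<CARD('p). of_nat (franel_term k) / 32 ^ k) = (4 * of_nat x ^ 2 :: 'p mod_ring)"
proof -
  let ?p = "CARD('p)"
  have "odd ?p" using prime_card[where ?'a='p] big prime_odd_nat by simp
  then obtain n where pn: "?p = 2 * n + 1" by (elim oddE)
  have n1: "n > 1" using big pn by simp
  have nz: "of_nat k \<noteq> (0::'p mod_ring)" if "0 < k" "k < ?p" for k
    using that by (simp add: char_dvd_of_nat nat_dvd_not_less)
  have two: "(2::'p mod_ring) \<noteq> 0" and three: "(3::'p mod_ring) \<noteq> 0" using nz[of 2] nz[of 3] big by simp_all
  have eight: "(2::'p mod_ring) ^ 3 \<noteq> 0" and nine: "(3::'p mod_ring) ^ 2 \<noteq> 0" and four: "(2::'p mod_ring) ^ 2 \<noteq> 0"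
    by (rule power_not_zero[OF two] power_not_zero[OF three])+
  have rr: "r * r = 2" using r by (simp add: power2_eq_square)
  then have rrz: "r * (r * z) = 2 * z" for z by (metis mult.assoc)
  define \<mu> where "\<mu> = 8 + 6 * r"
  define \<kappa> where "\<kappa> = 4 * (1 + r)"
  have "\<mu> * (6 * r - 8) = 2 ^ 3" by (simp add: \<mu>_def algebra_simps rr rrz)
  then have m0: "\<mu> \<noteq> 0" using eight by auto
  have "(\<mu> + 1) * (9 - 6 * r) = 3 ^ 2" by (simp add: \<mu>_def algebra_simps rr rrz)
  then have "\<mu> + 1 \<noteq> 0" using nine by auto
  then have m1: "\<mu> \<noteq> - 1" by (auto simp: eq_neg_iff_add_eq_0)
  have "\<kappa> * (r - 1) = 2 ^ 2" by (simp add: \<kappa>_def algebra_simps rr rrz)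
  then have k0: "\<kappa> \<noteq> 0" using four by auto
  define T where "T = (\<Sum>z\<in>UNIV. poly (cubic_poly (6 * (2 + r)) 3) z ^ n)"
  have "(\<Sum>z\<in>UNIV. (z * (z\<^sup>2 + (\<mu>\<^sup>2 - 4 * \<mu> - 8) * z + 16 * (1 + \<mu>))) ^ n)
      = (\<Sum>z\<in>UNIV. ((\<kappa> * z) * ((\<kappa> * z)\<^sup>2 + (\<mu>\<^sup>2 - 4 * \<mu> - 8) * (\<kappa> * z) + 16 * (1 + \<mu>))) ^ n)"
  proof -
    have "bij ((*) \<kappa>)" using k0 by (intro bij_betwI[of _ _ _ "(*) (inverse \<kappa>)"]) (simp_all add: mult.assoc[symmetric])
    then show ?thesis
      using sum.reindex_bij_betw[of "(*) \<kappa>" UNIV UNIV "\<lambda>z. (z * (z\<^sup>2 + (\<mu>\<^sup>2 - 4 * \<mu> - 8) * z + 16 * (1 + \<mu>))) ^ n"] by simp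
  qed
  also have "\<dots> = (\<Sum>z\<in>UNIV. (\<kappa> ^ 3) ^ n * poly (cubic_poly (6 * (2 + r)) 3) z ^ n)"
  proof (rule sum.cong)
    fix z
    have "\<mu>\<^sup>2 - 4 * \<mu> - 8 = 6 * (2 + r) * \<kappa>" "16 * (1 + \<mu>) = 3 * \<kappa>\<^sup>2"
      by (simp_all add: \<mu>_def \<kappa>_def algebra_simps power2_eq_square rr rrz)
    then have "(\<kappa> * z) * ((\<kappa> * z)\<^sup>2 + (\<mu>\<^sup>2 - 4 * \<mu> - 8) * (\<kappa> * z) + 16 * (1 + \<mu>)) = \<kappa> ^ 3 * poly (cubic_poly (6 * (2 + r)) 3) z"
      by (simp add: cubic_poly_coeffs algebra_simps power2_eq_square power3_eq_cube)
    then show "((\<kappa> * z) * ((\<kappa> * z)\<^sup>2 + (\<mu>\<^sup>2 - 4 * \<mu> - 8) * (\<kappa> * z) + 16 * (1 + \<mu>))) ^ n = (\<kappa> ^ 3) ^ n * poly (cubic_poly (6 * (2 + r)) 3) z ^ n"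
      by (simp only: power_mult_distrib)
  qed simp
  also have "\<dots> = (\<kappa> ^ 3) ^ n * T" by (simp add: T_def sum_distrib_left)
  finally have "poly franel_poly (inverse \<mu>) = - ((\<kappa> ^ 3) ^ n * T)"
    using franel_poly_point_count[OF pn _ m0 m1] n1 by simp
  then have "(poly franel_poly (inverse \<mu>))\<^sup>2 = ((\<kappa> ^ 3) ^ n)\<^sup>2 * T\<^sup>2" by (simp add: power_mult_distrib)
  also have "((\<kappa> ^ 3) ^ n)\<^sup>2 = (\<kappa> ^ (?p - 1)) ^ 3" using pn by (simp add: mult_ac flip: power_mult)
  also have "\<dots> = 1" unfolding fermat_mod_ring_unit[OF k0] by simp
  finally have "(poly franel_poly (inverse \<mu>))\<^sup>2 = T\<^sup>2" by simp
  also have "T\<^sup>2 = 4 * of_nat x ^ 2" unfolding T_def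
    by (rule cm_trace[OF p r big]) (use pn in simp)
  finally show ?thesis unfolding sum_eq_franel_poly_square[OF pn n1 r] \<mu>_def .
qed

section \<open>From the prime field to the rational numbers\<close>

text \<open>The reduced denominator divides every denominator of the fraction.\<close>

lemma p_integral_of_int_divide:
  assumes p: "prime p" and d: "\<not> int p dvd d"
  shows "of_int a / of_int d \<in> p_integral_rats p"
proof -
  obtain m e where q: "quotient_of (of_int a / of_int d :: rat) = (m, e)" by (cases "quotient_of (of_int a / of_int d :: rat)")
  have "(of_int a / of_int d :: rat) = of_int m / of_int e" by (rule quotient_of_div[OF q])
  moreover have "e \<noteq> 0" "d \<noteq> 0" using quotient_of_denom_pos[OF q] d by auto
  ultimately have "(of_int (a * e) :: rat) = of_int (m * d)" by (simp add: field_simps)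
  then have eq: "a * e = m * d" by (simp only: of_int_eq_iff)
  have "\<not> int p dvd e"
  proof
    assume e: "int p dvd e"
    then have "int p dvd m * d" by (simp flip: eq)
    then have "int p dvd m" using p d by (simp add: prime_dvd_mult_iff)
    then have "int p dvd 1" using e quotient_of_coprime[OF q] by (meson coprime_common_divisor)
    then show False using p prime_gt_1_nat by fastforce
  qed
  then show ?thesis by (simp add: p_integral_rats_def q)
qed

lemma p_integral_of_int: "prime p \<Longrightarrow> of_int a \<in> p_integral_rats p"
  using p_integral_of_int_divide[of p 1 a] prime_gt_1_nat[of p] by auto

lemma clear_denominator:
  fixes a b :: "'a::field"
  assumes "k \<le> N" "b \<noteq> 0"
  shows "a * b ^ (N - k) = b ^ N * (a / b ^ k)"
proof -
  have "b ^ N = b ^ (N - k) * b ^ k" using assms(1) by (simp flip: power_add)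
  then show ?thesis using assms(2) by simp
qed

text \<open>After multiplication by \<open>32 ^ (p - 1)\<close> both sides are integers, and the equation in the
  prime field says that \<open>p\<close> divides their difference.\<close>

lemma rat_cong_from_mod_ring:
  fixes c :: int
  assumes big: "CARD('p::prime_card) > 2"
    and s: "(\<Sum>k<CARD('p). of_nat (franel_term k) / 32 ^ k) = (of_int c :: 'p mod_ring)"
  shows "rat_cong CARD('p)
    (\<Sum>k = 0..CARD('p) - 1. of_nat ((2 * k) choose k) * (of_nat (franel k) / 32 ^ k)) (of_int c)"
proof -
  let ?p = "CARD('p)"
  have p: "prime ?p" by (rule prime_card)
  define N where "N = ?p - 1"
  have I: "{..<?p} = {0..N}" using big by (auto simp: N_def)
  have "of_nat 2 \<noteq> (0 :: 'p mod_ring)" unfolding char_dvd_of_nat using big by (auto dest: dvd_imp_le)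
  then have two: "(2 :: 'p mod_ring) \<noteq> 0" by simp
  have nz: "(32 :: 'p mod_ring) \<noteq> 0" using power_not_zero[OF two, of 5] by simp
  define M where "M = (\<Sum>k = 0..N. int (franel_term k) * 32 ^ (N - k))"
  have "of_int M = (\<Sum>k = 0..N. of_nat (franel_term k) * 32 ^ (N - k) :: 'p mod_ring)" by (simp add: M_def)
  also have "\<dots> = (\<Sum>k = 0..N. 32 ^ N * (of_nat (franel_term k) / 32 ^ k))"
    by (rule sum.cong[OF refl], rule clear_denominator[OF _ nz]) simp
  also have "\<dots> = 32 ^ N * (of_int c :: 'p mod_ring)" unfolding s[unfolded I, symmetric] by (simp only: sum_distrib_left)
  finally have "of_int (M - 32 ^ N * c) = (0 :: 'p mod_ring)" by simp
  then obtain m where m: "M - 32 ^ N * c = int ?p * m" unfolding char_dvd_of_int by (elim dvdE)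
  define S where "S = (\<Sum>k = 0..N. of_nat ((2 * k) choose k) * (of_nat (franel k) / 32 ^ k) :: rat)"
  have "of_int M = (\<Sum>k = 0..N. of_nat (franel_term k) * 32 ^ (N - k) :: rat)" by (simp add: M_def)
  also have "\<dots> = (\<Sum>k = 0..N. 32 ^ N * (of_nat (franel_term k) / 32 ^ k))"
    by (rule sum.cong[OF refl], rule clear_denominator) simp_all
  also have "\<dots> = 32 ^ N * S" by (simp add: S_def sum_distrib_left franel_term_def)
  finally have SM: "S = of_int M / of_int (32 ^ N)" by simp
  have nd: "\<not> int ?p dvd 32 ^ N"
  proof
    assume "int ?p dvd 32 ^ N"
    then have "of_int (32 ^ N) = (0 :: 'p mod_ring)" by (simp only: char_dvd_of_int)
    then show False using nz by simp
  qed
  have "S - of_int c = of_int (M - 32 ^ N * c) / of_int (32 ^ N)" unfolding SM by (simp add: field_simps)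
  also have "\<dots> = of_nat ?p * (of_int m / of_int (32 ^ N))" unfolding m by simp
  finally have "S - of_int c = of_nat ?p * (of_int m / of_int (32 ^ N))" .
  moreover have "S \<in> p_integral_rats ?p" unfolding SM by (rule p_integral_of_int_divide[OF p nd])
  ultimately have "rat_cong ?p S (of_int c)"
    unfolding rat_cong_def using p_integral_of_int_divide[OF p nd] p_integral_of_int[OF p] by blast
  then show ?thesis unfolding S_def N_def .
qed

text \<open>The claim for a single number \<open>p\<close>, named because it has to be transported from
  cardinalities of types to all primes.\<close>

definition franel_congruence :: "nat \<Rightarrow> bool" where
  "franel_congruence p \<longleftrightarrow> ([int p = 1] (mod 8) \<or> [int p = -1] (mod 8) \<longrightarrow>
     ([p = 1] (mod 24) \<or> [p = 7] (mod 24) \<longrightarrow>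
            (\<exists>x y :: int. int p = x\<^sup>2 + 6 * y\<^sup>2) \<and>
            (\<forall>x y :: int. int p = x\<^sup>2 + 6 * y\<^sup>2 \<longrightarrow>
               rat_cong p
                 (\<Sum>k = 0..p - 1. of_nat ((2 * k) choose k) * (of_nat (franel k) / 32 ^ k))
                 (of_int (4 * x\<^sup>2)))) \<and>
         ([p = 17] (mod 24) \<or> [p = 23] (mod 24) \<longrightarrow>
            rat_cong p
              (\<Sum>k = 0..p - 1. of_nat ((2 * k) choose k) * (of_nat (franel k) / 32 ^ k))
              0))"

lemma franel_congruence_CARD: "franel_congruence CARD('p::prime_card)"
  unfolding franel_congruence_def
proof (intro impI conjI allI)
  let ?p = "CARD('p)"
  have p: "prime ?p" by (rule prime_card)
  assume "[int ?p = 1] (mod 8) \<or> [int ?p = -1] (mod 8)"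
  then have "int ?p mod 8 = 1 \<or> int ?p mod 8 = 7" by (simp add: cong_def)
  then have m8: "?p mod 8 = 1 \<or> ?p mod 8 = 7" by presburger
  have "?p \<noteq> 1" using p by auto
  then have big: "?p > 3" using m8 by presburger
  have "\<exists>r :: 'p mod_ring. r\<^sup>2 = 2"
  proof -
    obtain y where "[y\<^sup>2 = 2] (mod int ?p)" using two_quadratic_residue[OF p m8] by blast
    then have "of_int (y\<^sup>2 - 2) = (0 :: 'p mod_ring)" unfolding char_dvd_of_int by (simp only: cong_iff_dvd_diff)
    then have "(of_int y)\<^sup>2 = (2 :: 'p mod_ring)" by simp
    then show ?thesis by blast
  qed
  then obtain r :: "'p mod_ring" where r: "r\<^sup>2 = 2" by blast
  {
    assume "[?p = 1] (mod 24) \<or> [?p = 7] (mod 24)"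
    then have m24: "?p mod 24 = 1 \<or> ?p mod 24 = 7" by (simp add: cong_def)
    then have m3: "?p mod 3 = 1" by presburger
    show "\<exists>x y :: int. int ?p = x\<^sup>2 + 6 * y\<^sup>2"
    proof -
      obtain w :: "'p mod_ring" where w: "w\<^sup>2 = - 3" using sqrt_minus_3_exists[OF m3] by blast
      obtain i where i: "r * w = of_nat i" using surj_of_nat_mod_ring by blast
      have "of_int ((int i)\<^sup>2 + 6) = (r * w)\<^sup>2 + 6" by (simp add: i)
      also have "\<dots> = 0" unfolding power_mult_distrib r w by simp
      finally have "int ?p dvd (int i)\<^sup>2 + 6" by (simp only: char_dvd_of_int)
      then show ?thesis by (rule represented_by_x2_6y2[OF p m3])
    qed
    fix x y :: int
    assume "int ?p = x\<^sup>2 + 6 * y\<^sup>2"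
    then have "int ?p = int ((nat \<bar>x\<bar>)\<^sup>2 + 6 * (nat \<bar>y\<bar>)\<^sup>2)" by simp
    then have rep: "?p = (nat \<bar>x\<bar>)\<^sup>2 + 6 * (nat \<bar>y\<bar>)\<^sup>2" by (simp only: of_nat_eq_iff)
    have "(int (nat \<bar>x\<bar>))\<^sup>2 = x\<^sup>2" by simp
    moreover have "(4 * of_nat (nat \<bar>x\<bar>) ^ 2 :: 'p mod_ring) = of_int (4 * (int (nat \<bar>x\<bar>))\<^sup>2)"
      by (simp only: of_int_mult of_int_power of_int_of_nat_eq of_int_numeral)
    ultimately have c: "(4 * of_nat (nat \<bar>x\<bar>) ^ 2 :: 'p mod_ring) = of_int (4 * x\<^sup>2)" by (simp only:)
    show "rat_cong ?p (\<Sum>k = 0..?p - 1. of_nat ((2 * k) choose k) * (of_nat (franel k) / 32 ^ k)) (of_int (4 * x\<^sup>2))"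
    proof (rule rat_cong_from_mod_ring)
      show "(\<Sum>k<?p. of_nat (franel_term k) / 32 ^ k) = (of_int (4 * x\<^sup>2) :: 'p mod_ring)"
        unfolding c[symmetric] by (rule sum_ordinary[OF rep r big]) (use m24 in auto)
    qed (use big in simp)
  next
    assume "[?p = 17] (mod 24) \<or> [?p = 23] (mod 24)"
    then have "?p mod 24 = 17 \<or> ?p mod 24 = 23" by (simp add: cong_def)
    then have m3: "?p mod 3 = 2" by presburger
    show "rat_cong ?p (\<Sum>k = 0..?p - 1. of_nat ((2 * k) choose k) * (of_nat (franel k) / 32 ^ k)) 0"
      using rat_cong_from_mod_ring[where c = 0 and ?'p = 'p] sum_supersingular[OF m3 big r] big by simp
  }
qed

text \<open>The prime field is indexed by a type of cardinality \<open>p\<close>, but a type cannot depend on the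
  variable \<open>p\<close>. It suffices to treat one fixed prime: a counterexample if there is one, and
  2 otherwise. A type can be defined for this constant.\<close>

definition critical_prime :: nat where
  "critical_prime = (if \<exists>p. prime p \<and> \<not> franel_congruence p
     then SOME p. prime p \<and> \<not> franel_congruence p else 2)"

lemma critical_prime:
  "prime critical_prime" "prime p \<Longrightarrow> franel_congruence critical_prime \<Longrightarrow> franel_congruence p"
proof -
  have "prime critical_prime \<and> (prime p \<longrightarrow> franel_congruence critical_prime \<longrightarrow> franel_congruence p)" for p
  proof (cases "\<exists>p. prime p \<and> \<not> franel_congruence p")
    case True
    then have "critical_prime = (SOME p. prime p \<and> \<not> franel_congruence p)" by (simp add: critical_prime_def)
    then show ?thesis using someI_ex[OF True] by simp
  next
    case False
    then have "critical_prime = 2" unfolding critical_prime_def by (simp only: if_False)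
    then show ?thesis using False two_is_prime_nat by simp
  qed
  then show "prime critical_prime" "prime p \<Longrightarrow> franel_congruence critical_prime \<Longrightarrow> franel_congruence p" by blast+
qed

typedef critical_residue = "{0..<critical_prime}"
  using prime_gt_0_nat[OF critical_prime(1)] by auto

lemma CARD_critical_residue: "CARD(critical_residue) = critical_prime"
  using type_definition.card[OF type_definition_critical_residue] by simp

instance critical_residue :: prime_card
  by intro_classes (simp add: CARD_critical_residue critical_prime(1))

theorem theorem2p3:
  fixes p :: nat
  assumes "prime p"
    and "[int p = 1] (mod 8) \<or> [int p = -1] (mod 8)"
  shows "([p = 1] (mod 24) \<or> [p = 7] (mod 24) \<longrightarrow>
            (\<exists>x y :: int. int p = x\<^sup>2 + 6 * y\<^sup>2) \<and>
            (\<forall>x y :: int. int p = x\<^sup>2 + 6 * y\<^sup>2 \<longrightarrow>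
               rat_cong p
                 (\<Sum>k = 0..p - 1. of_nat ((2 * k) choose k) * (of_nat (franel k) / 32 ^ k))
                 (of_int (4 * x\<^sup>2)))) \<and>
         ([p = 17] (mod 24) \<or> [p = 23] (mod 24) \<longrightarrow>
            rat_cong p
              (\<Sum>k = 0..p - 1. of_nat ((2 * k) choose k) * (of_nat (franel k) / 32 ^ k))
              0)"
proof -
  have "franel_congruence critical_prime"
    using franel_congruence_CARD[where ?'p = critical_residue] unfolding CARD_critical_residue .
  then have "franel_congruence p" by (rule critical_prime(2)[OF assms(1)])
  then show ?thesis using assms(2) unfolding franel_congruence_def by (rule mp)
qed

end
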